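(* Let $M$ be an $m\times n$ grid graph with $m\geq 3$ rows, $N=mn$ nodes and positive integer node weights of total weight $W$. A connected bipartition $(U,V\setminus U)$ of $M$ maximizing $\min\{w(U),w(V\setminus U)\}$ can be computed in $O(mNW8^m)$ time.
   Context: An $m\times n$ grid graph has node set $V=\{M_{ij}: 1\leq i\leq m,\ 1\leq j\leq n\}$, with an edge between two nodes consecutive in the same row or the same column. For $S\subseteq V$, $w(S)=\sum_{v\in S}w(v)$, and $W=w(V)$. A connected bipartition is a partition $(U,V\setminus U)$ of $V$ into two nonempty sets such that both $M[U]$ and $M[V\setminus U]$ are connected. *)

theory Defs
  imports "Graph_Theory.Digraph_Component"
begin

text \<open>Undirected graphs are symmetric digraphs, as usual in Graph_Theory. The node in row \<open>i\<close>
  and column \<open>j\<close> is the pair \<open>(i, j)\<close>.\<close>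

definition grid_graph :: "nat \<Rightarrow> nat \<Rightarrow> (nat \<times> nat, (nat \<times> nat) \<times> (nat \<times> nat)) pre_digraph" where
  "grid_graph m n = with_proj
     \<lparr> pverts = {1..m} \<times> {1..n},
       parcs = {((i, j), (i', j')) | i j i' j'.
         (i, j) \<in> {1..m} \<times> {1..n} \<and> (i', j') \<in> {1..m} \<times> {1..n} \<and>
         (i = i' \<and> (j' = j + 1 \<or> j = j' + 1) \<or> j = j' \<and> (i' = i + 1 \<or> i = i' + 1))} \<rparr>"

definition weight :: "('a \<Rightarrow> nat) \<Rightarrow> 'a set \<Rightarrow> nat" where
  "weight w S = (\<Sum>v\<in>S. w v)"

definition connected_bipartition :: "('a, 'b) pre_digraph \<Rightarrow> 'a set \<Rightarrow> bool" where
  "connected_bipartition G U \<longleftrightarrow>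
     U \<subseteq> verts G \<and> U \<noteq> {} \<and> verts G - U \<noteq> {} \<and>
     connected (G \<restriction> U) \<and> connected (G \<restriction> (verts G - U))"

definition optimal_connected_bipartition ::
  "('a, 'b) pre_digraph \<Rightarrow> ('a \<Rightarrow> nat) \<Rightarrow> 'a set \<Rightarrow> bool" where
  "optimal_connected_bipartition G w U \<longleftrightarrow>
     is_arg_max (\<lambda>U. min (weight w U) (weight w (verts G - U))) (connected_bipartition G) U"

text \<open>The machine of Cook and Reckhow (Time bounded random access machines, 1973), with
  registers holding natural numbers and truncated subtraction: the only arithmetic is addition and
  subtraction, and each executed instruction takes one unit of time. In particular multiplication
  is not a primitive.\<close>

datatype instr =
    Const nat nat      \<comment> \<open>\<open>X\<^sub>r := c\<close>\<close>
  | Add nat nat nat    \<comment> \<open>\<open>X\<^sub>r := X\<^sub>a + X\<^sub>b\<close>\<close>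
  | Sub nat nat nat    \<comment> \<open>\<open>X\<^sub>r := X\<^sub>a - X\<^sub>b\<close>\<close>
  | Load nat nat       \<comment> \<open>\<open>X\<^sub>r := X\<close> at address \<open>X\<^sub>a\<close>\<close>
  | Store nat nat      \<comment> \<open>\<open>X\<close> at address \<open>X\<^sub>a := X\<^sub>r\<close>; the operands are \<open>a\<close>, \<open>r\<close>\<close>
  | Jump_pos nat nat   \<comment> \<open>go to instruction \<open>l\<close> if \<open>X\<^sub>r > 0\<close>; the operands are \<open>r\<close>, \<open>l\<close>\<close>
  | Read nat           \<comment> \<open>\<open>X\<^sub>r :=\<close> next number on the input tape\<close>
  | Print nat          \<comment> \<open>append \<open>X\<^sub>r\<close> to the output tape\<close>

type_synonym program = "instr list"

record config =
  pc :: nat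
  regs :: "nat \<Rightarrow> nat"
  in_tape :: "nat list"
  out_tape :: "nat list"

fun exec_instr :: "instr \<Rightarrow> config \<Rightarrow> config" where
  "exec_instr (Const r c) s = s\<lparr>regs := (regs s)(r := c), pc := pc s + 1\<rparr>"
| "exec_instr (Add r a b) s = s\<lparr>regs := (regs s)(r := regs s a + regs s b), pc := pc s + 1\<rparr>"
| "exec_instr (Sub r a b) s = s\<lparr>regs := (regs s)(r := regs s a - regs s b), pc := pc s + 1\<rparr>"
| "exec_instr (Load r a) s = s\<lparr>regs := (regs s)(r := regs s (regs s a)), pc := pc s + 1\<rparr>"
| "exec_instr (Store a r) s = s\<lparr>regs := (regs s)(regs s a := regs s r), pc := pc s + 1\<rparr>"
| "exec_instr (Jump_pos r l) s = s\<lparr>pc := (if regs s r > 0 then l else pc s + 1)\<rparr>"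
| "exec_instr (Read r) s =
     s\<lparr>regs := (regs s)(r := (case in_tape s of [] \<Rightarrow> 0 | x # _ \<Rightarrow> x)),
       in_tape := tl (in_tape s), pc := pc s + 1\<rparr>"
| "exec_instr (Print r) s = s\<lparr>out_tape := out_tape s @ [regs s r], pc := pc s + 1\<rparr>"

definition halted :: "program \<Rightarrow> config \<Rightarrow> bool" where
  "halted P s \<longleftrightarrow> length P \<le> pc s"

definition step :: "program \<Rightarrow> config \<Rightarrow> config" where
  "step P s = (if halted P s then s else exec_instr (P ! pc s) s)"

definition initial_config :: "nat list \<Rightarrow> config" where
  "initial_config xs = \<lparr>pc = 0, regs = (\<lambda>_. 0), in_tape = xs, out_tape = []\<rparr>"

text \<open>Since halted configurations are fixed points of \<^const>\<open>step\<close>, the following says that \<open>P\<close>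
  halts on input \<open>xs\<close> after executing at most \<open>t\<close> instructions, with output \<open>ys\<close>.\<close>

definition computes_within :: "program \<Rightarrow> nat list \<Rightarrow> nat list \<Rightarrow> nat \<Rightarrow> bool" where
  "computes_within P xs ys t \<longleftrightarrow>
     (let s = (step P ^^ t) (initial_config xs) in halted P s \<and> out_tape s = ys)"

definition grid_nodes :: "nat \<Rightarrow> nat \<Rightarrow> (nat \<times> nat) list" where
  "grid_nodes m n = [(i, j). i \<leftarrow> [1..<m+1], j \<leftarrow> [1..<n+1]]"

definition encode_instance :: "nat \<Rightarrow> nat \<Rightarrow> (nat \<times> nat \<Rightarrow> nat) \<Rightarrow> nat list" where
  "encode_instance m n w = m # n # map w (grid_nodes m n)"

definition encode_node_set :: "nat \<Rightarrow> nat \<Rightarrow> (nat \<times> nat) set \<Rightarrow> nat list" where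
  "encode_node_set m n U = map (\<lambda>v. if v \<in> U then 1 else 0) (grid_nodes m n)"

end

theory Submission
  imports Defs "HOL-Library.Nat_Bijection"
begin

text \<open>The grid is coloured cell by cell, column by column. Of a partial colouring only the last \<open>m\<close>
  cells matter (the frontier): their colours, the partition of the frontier into the traces of the
  monochromatic components, the weight of the colour class \<open>U\<close>, and how many components of
  either colour no longer meet the frontier. Colouring one more cell removes a frontier cell that is a
  cyclic neighbour of the new one and merges components of cyclic neighbours, so the partition stays
  noncrossing. It is then determined by the sets of first and last elements of its blocks; together
  with the colours this bounds the number of frontier states by a constant times \<open>8 ^ m\<close>. A
  breadth-first search over pairs of a state and a weight, with \<open>O(m)\<close> instructions per pair and
  cell, meets the time bound.

  Duplicates are recognized by direct addressing: the machine has unboundedly many registers, so a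
  state and its weight are encoded injectively in a register address.\<close>

section \<open>A while language compiled to the random access machine\<close>

text \<open>Discarding duplicates is sound because \<open>key\<close> is a congruence: colourings of
  equal length with equal keys still have equal keys after the same extension
  (\<open>key_snoc_cong\<close>), and the key of a full colouring determines both the weight of its
  class and whether it is a connected bipartition. One colouring per key therefore suffices in each
  layer, and the invariants of the search speak about these colourings, which the program never
  stores.

  The machine only adds and subtracts. Keys are therefore sums of \<open>m + 2\<close> table
  entries, and indices, products and remainders are carried along incrementally. Marks of visited
  keys are queue positions instead of flags, so that nothing has to be erased between layers. The
  virtual column gives every frontier exactly \<open>m\<close> cells from the start, so that all
  steps have the same form.\<close>

datatype vname =
  Vm | Vn | VN | VW | Vi | Vj | Vp | Vq | Vx | Vy | Vk | Vr | Vs | Vmm | Vhi | Vnx | Ve | Veb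
  | Vnb | Vwq | Vvx | Vtop | Va | Vb | Vv | Vkey | Vc0 | Vc1 | Vbv | Vbe | Vcnt

definition vnames :: "vname list" where
  "vnames = [Vm, Vn, VN, VW, Vi, Vj, Vp, Vq, Vx, Vy, Vk, Vr, Vs, Vmm, Vhi, Vnx, Ve, Veb, Vnb, Vwq,
     Vvx, Vtop, Va, Vb, Vv, Vkey, Vc0, Vc1, Vbv, Vbe, Vcnt]"

definition index :: "vname \<Rightarrow> nat" where
  "index v = (SOME i. vnames ! i = v)"

lemma nth_index: "vnames ! index v = v"
proof -
  have "v \<in> set vnames" by (cases v) (simp_all add: vnames_def)
  then have "\<exists>i. vnames ! i = v" by (auto simp: in_set_conv_nth)
  then show ?thesis unfolding index_def by (rule someI_ex)
qed

lemma index_inj: "index v = index w \<longleftrightarrow> v = w"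
  by (metis nth_index)

datatype aname = Weights | States | Table | Seen | Sums | Parent | Choice | Output

fun slot :: "aname \<Rightarrow> nat" where
  "slot Weights = 2"
| "slot States = 3"
| "slot Table = 4"
| "slot Seen = 5"
| "slot Sums = 6"
| "slot Parent = 7"
| "slot Choice = 8"
| "slot Output = 9"

datatype exp = Num nat | Var vname | Plus exp exp | Minus exp exp | Elem aname exp

datatype com =
    Skip
  | Assign vname exp
  | Put aname exp exp
  | Seq com com (infixr "\<Zsemi>" 60)
  | If exp com com
  | While exp com
  | Input vname
  | Out exp

record state =
  vars :: "vname \<Rightarrow> nat"
  arrs :: "aname \<Rightarrow> nat \<Rightarrow> nat"
  inp :: "nat list"
  outp :: "nat list"
  clk :: nat

fun eval :: "exp \<Rightarrow> state \<Rightarrow> nat" where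
  "eval (Num n) s = n"
| "eval (Var v) s = vars s v"
| "eval (Plus a b) s = eval a s + eval b s"
| "eval (Minus a b) s = eval a s - eval b s"
| "eval (Elem a e) s = arrs s a (eval e s)"

text \<open>Expressions compile to jump-free code, so its length is at once its running time and the
  offset needed for jump targets; the values are these lengths. The 7 for an array access is the six
  instructions of \<open>address\<close> and the final load.\<close>

fun cost :: "exp \<Rightarrow> nat" where
  "cost (Num n) = 1"
| "cost (Var v) = 2"
| "cost (Plus a b) = cost a + cost b + 1"
| "cost (Minus a b) = cost a + cost b + 1"
| "cost (Elem a e) = cost e + 7"

definition tick :: "nat \<Rightarrow> state \<Rightarrow> state" where
  "tick k s = s\<lparr>clk := clk s + k\<rparr>"

lemma tick_simps [simp]:
  "vars (tick k s) = vars s" "arrs (tick k s) = arrs s" "inp (tick k s) = inp s"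
  "outp (tick k s) = outp s" "clk (tick k s) = clk s + k"
  by (simp_all add: tick_def)

lemma eval_tick [simp]: "eval e (tick k s) = eval e s"
  by (induction e) simp_all

inductive big_step :: "com \<Rightarrow> state \<Rightarrow> state \<Rightarrow> bool" where
  Skip: "big_step Skip s s"
| Assign: "big_step (Assign v e) s
    (tick (cost e + 2) (s\<lparr>vars := (vars s)(v := eval e s)\<rparr>))"
| Put: "big_step (Put a e f) s
    (tick (cost e + cost f + 7)
      (s\<lparr>arrs := (arrs s)(a := (arrs s a)(eval e s := eval f s))\<rparr>))"
| Seq: "big_step c s s' \<Longrightarrow> big_step d s' s'' \<Longrightarrow> big_step (c \<Zsemi> d) s s''"
| IfTrue: "eval e s > 0 \<Longrightarrow> big_step c (tick (cost e + 1) s) s' \<Longrightarrow> big_step (If e c d) s s'"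
| IfFalse: "eval e s = 0 \<Longrightarrow> big_step d (tick (cost e + 1) s) s' \<Longrightarrow>
    big_step (If e c d) s (tick 2 s')"
| WhileTrue: "eval e s > 0 \<Longrightarrow> big_step c (tick (cost e + 1) s) s' \<Longrightarrow>
    big_step (While e c) (tick 2 s') s'' \<Longrightarrow> big_step (While e c) s s''"
| WhileFalse: "eval e s = 0 \<Longrightarrow> big_step (While e c) s (tick (cost e + 3) s)"
| Input: "big_step (Input v) s
    (tick 1 (s\<lparr>vars := (vars s)(v := (case inp s of [] \<Rightarrow> 0 | x # _ \<Rightarrow> x)),
               inp := tl (inp s)\<rparr>))"
| Out: "big_step (Out e) s (tick (cost e + 1) (s\<lparr>outp := outp s @ [eval e s]\<rparr>))"

inductive_cases big_step_elims:
  "big_step Skip s s'" "big_step (Assign v e) s s'" "big_step (Put a e f) s s'"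
  "big_step (c \<Zsemi> d) s s'" "big_step (If e c d) s s'" "big_step (Input v) s s'"
  "big_step (Out e) s s'"

subsection \<open>Compilation\<close>

text \<open>The registers are split into residue classes modulo 16: class 0 holds the variables,
  class 1 the temporaries, and class \<open>slot a\<close> the array \<open>a\<close>.\<close>

definition var_reg :: "vname \<Rightarrow> nat" where
  "var_reg v = 16 * index v"

definition tmp :: "nat \<Rightarrow> nat" where
  "tmp d = 16 * d + 1"

definition elem_reg :: "aname \<Rightarrow> nat \<Rightarrow> nat" where
  "elem_reg a x = 16 * x + slot a"

text \<open>Multiplication by 16 is four doublings in place. The scratch register lies above
  \<open>tmp d\<close>, so operands pending in lower temporaries survive.\<close>

definition address :: "aname \<Rightarrow> nat \<Rightarrow> program" where
  "address a d = (let t = tmp d in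
     [Add t t t, Add t t t, Add t t t, Add t t t, Const (tmp (d + 2)) (slot a),
      Add t t (tmp (d + 2))])"

fun comp_exp :: "exp \<Rightarrow> nat \<Rightarrow> program" where
  "comp_exp (Num n) d = [Const (tmp d) n]"
| "comp_exp (Var v) d = [Const (tmp d) 0, Add (tmp d) (tmp d) (var_reg v)]"
| "comp_exp (Plus a b) d = comp_exp a d @ comp_exp b (d + 1) @ [Add (tmp d) (tmp d) (tmp (d + 1))]"
| "comp_exp (Minus a b) d = comp_exp a d @ comp_exp b (d + 1) @ [Sub (tmp d) (tmp d) (tmp (d + 1))]"
| "comp_exp (Elem a e) d = comp_exp e d @ address a d @ [Load (tmp d) (tmp d)]"

text \<open>The else branch precedes the then branch because the only jump is taken on a positive
  register. An unconditional jump first sets \<open>tmp 0\<close> to 1, which accounts for the two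
  extra ticks in \<open>big_step\<close>; no temporary carries a value from one command to the
  next.\<close>

fun comp :: "com \<Rightarrow> nat \<Rightarrow> program" where
  "comp Skip p = []"
| "comp (Assign v e) p =
     comp_exp e 0 @ [Const (tmp 1) 0, Add (var_reg v) (tmp 0) (tmp 1)]"
| "comp (Put a e f) p =
     comp_exp e 0 @ address a 0 @ comp_exp f 1 @ [Store (tmp 0) (tmp 1)]"
| "comp (c \<Zsemi> d) p = (let C = comp c p in C @ comp d (p + length C))"
| "comp (If e c d) p = (let
     E = comp_exp e 0;
     D = comp d (p + length E + 1);
     q = p + length E + 1 + length D + 2;
     C = comp c q
     in E @ [Jump_pos (tmp 0) q] @ D @
        [Const (tmp 0) 1, Jump_pos (tmp 0) (q + length C)] @ C)"
| "comp (While e c) p = (let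
     E = comp_exp e 0;
     q = p + length E + 3;
     C = comp c q
     in E @ [Jump_pos (tmp 0) q, Const (tmp 0) 1, Jump_pos (tmp 0) (q + length C + 2)] @
        C @ [Const (tmp 0) 1, Jump_pos (tmp 0) p])"
| "comp (Input v) p = [Read (var_reg v)]"
| "comp (Out e) p = comp_exp e 0 @ [Print (tmp 0)]"

lemma length_address [simp]: "length (address a d) = 6"
  by (simp add: address_def Let_def)

lemma length_comp_exp [simp]: "length (comp_exp e d) = cost e"
  by (induction e arbitrary: d) simp_all

fun is_jump :: "instr \<Rightarrow> bool" where
  "is_jump (Jump_pos r l) = True"
| "is_jump _ = False"

lemma pc_exec_instr: "\<not> is_jump i \<Longrightarrow> pc (exec_instr i s) = pc s + 1"
  by (cases i) simp_all

lemma step_Suc_funpow: "(step P ^^ Suc k) s = (step P ^^ k) (step P s)"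
  by (metis comp_apply funpow_Suc_right)

lemma step_at:
  assumes "P = xs @ i # ys" "pc s = length xs"
  shows "step P s = exec_instr i s"
  using assms by (simp add: step_def halted_def nth_append)

lemma straight_line:
  assumes "P = xs @ is @ ys" "pc s = length xs" "\<forall>i \<in> set is. \<not> is_jump i"
  shows "(step P ^^ length is) s = fold exec_instr is s \<and>
         pc (fold exec_instr is s) = length xs + length is"
  using assms
proof (induction "is" arbitrary: xs s)
  case Nil
  then show ?case by simp
next
  case (Cons i "is")
  have st: "step P s = exec_instr i s"
    using Cons.prems by (intro step_at) auto
  have "(step P ^^ length is) (exec_instr i s) = fold exec_instr is (exec_instr i s) \<and>
        pc (fold exec_instr is (exec_instr i s)) = length (xs @ [i]) + length is"
    using Cons.prems by (intro Cons.IH) (auto simp: pc_exec_instr)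
  then show ?case
    by (simp only: list.size step_Suc_funpow st fold.simps comp_apply length_append add_Suc_right
        add_0_right add_Suc)
qed

lemma reg_neq [simp]:
  "var_reg v = var_reg v' \<longleftrightarrow> v = v'" "tmp d = tmp d' \<longleftrightarrow> d = d'"
  "var_reg v \<noteq> tmp d" "tmp d \<noteq> var_reg v"
  by (auto simp: var_reg_def tmp_def index_inj dest: arg_cong[of _ _ even])

lemma slot_bounds: "2 \<le> slot a" "slot a < 10"
  by (cases a; simp)+

lemma slot_inj: "slot a = slot b \<longleftrightarrow> a = b"
  by (cases a; cases b; simp)

lemma elem_reg_neq [simp]:
  "elem_reg a x = elem_reg b y \<longleftrightarrow> a = b \<and> x = y"
  "elem_reg a x \<noteq> var_reg v" "var_reg v \<noteq> elem_reg a x"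
  "elem_reg a x \<noteq> tmp d" "tmp d \<noteq> elem_reg a x"
proof -
  have *: "(16 * x + slot a) mod 16 = slot a" "(16 * x + slot a) div 16 = x"
    for a :: aname and x :: nat
    using slot_bounds(2)[of a] by auto
  show "elem_reg a x = elem_reg b y \<longleftrightarrow> a = b \<and> x = y"
    unfolding elem_reg_def by (metis * slot_inj)
  have "elem_reg a x mod 16 \<noteq> 0" "elem_reg a x mod 16 \<noteq> 1"
    unfolding elem_reg_def * using slot_bounds[of a] by auto
  moreover have "var_reg v mod 16 = 0" "tmp d mod 16 = 1"
    by (simp_all add: var_reg_def tmp_def)
  ultimately show "elem_reg a x \<noteq> var_reg v" "var_reg v \<noteq> elem_reg a x"
    "elem_reg a x \<noteq> tmp d" "tmp d \<noteq> elem_reg a x" by metis+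
qed

section \<open>Machine configurations representing high-level states\<close>

definition rep :: "state \<Rightarrow> config \<Rightarrow> bool" where
  "rep s c \<longleftrightarrow> (\<forall>v. regs c (var_reg v) = vars s v) \<and> (\<forall>a x. regs c (elem_reg a x) = arrs s a x) \<and>
     in_tape c = inp s \<and> out_tape c = outp s"

lemma fold_address:
  fixes a d c
  defines "c' \<equiv> fold exec_instr (address a d) c"
  shows "regs c' (tmp d) = elem_reg a (regs c (tmp d))"
    and "\<And>r. r \<noteq> tmp d \<Longrightarrow> r \<noteq> tmp (d + 2) \<Longrightarrow> regs c' r = regs c r"
    and "in_tape c' = in_tape c" "out_tape c' = out_tape c"
  by (simp_all add: c'_def address_def Let_def elem_reg_def)

lemma no_jump_address: "\<forall>i \<in> set (address a d). \<not> is_jump i"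
  by (simp add: address_def Let_def)

lemma no_jump_comp_exp: "\<forall>i \<in> set (comp_exp e d). \<not> is_jump i"
  by (induction e arbitrary: d) (auto simp: no_jump_address)

text \<open>The temporaries form a stack: preserving those below \<open>d\<close> keeps the left
  operand intact while the right one is evaluated one level higher.\<close>

lemma comp_exp_correct:
  assumes "rep s c"
  shows "regs (fold exec_instr (comp_exp e d) c) (tmp d) = eval e s \<and>
         (\<forall>k<d. regs (fold exec_instr (comp_exp e d) c) (tmp k) = regs c (tmp k)) \<and>
         rep s (fold exec_instr (comp_exp e d) c)"
  using assms
proof (induction e arbitrary: c d)
  case (Plus a b)
  from Plus.IH(1)[OF Plus.prems, of d] Plus.IH(2)[of "fold exec_instr (comp_exp a d) c" "d + 1"]
  show ?case by (auto simp: rep_def)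
next
  case (Minus a b)
  from Minus.IH(1)[OF Minus.prems, of d] Minus.IH(2)[of "fold exec_instr (comp_exp a d) c" "d + 1"]
  show ?case by (auto simp: rep_def)
next
  case (Elem a e)
  define c1 where "c1 = fold exec_instr (comp_exp e d) c"
  from Elem.IH[OF Elem.prems, of d] show ?case
    by (auto simp: rep_def fold_address c1_def[symmetric])
qed (auto simp: rep_def)

text \<open>The clock of a high-level state counts the machine instructions executed so far, so a
  high-level state determines the configuration that it represents.\<close>

definition reaches :: "program \<Rightarrow> config \<Rightarrow> nat \<Rightarrow> state \<Rightarrow> bool" where
  "reaches P c\<^sub>0 p s \<longleftrightarrow> pc ((step P ^^ clk s) c\<^sub>0) = p \<and> rep s ((step P ^^ clk s) c\<^sub>0)"

lemma funpow_tick: "(step P ^^ (k + j)) c = (step P ^^ j) ((step P ^^ k) c)"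
  by (metis add.commute comp_apply funpow_add)

lemma reaches_straight:
  assumes "reaches P c\<^sub>0 (length xs) s" "P = xs @ is @ ys" "\<forall>i \<in> set is. \<not> is_jump i"
    and "k = length is"
    and "\<And>c. rep s c \<Longrightarrow> rep s' (fold exec_instr is c)"
  shows "reaches P c\<^sub>0 (length xs + k) (s'\<lparr>clk := clk s + k\<rparr>)"
proof -
  define c where "c = (step P ^^ clk s) c\<^sub>0"
  have "(step P ^^ length is) c = fold exec_instr is c \<and>
         pc (fold exec_instr is c) = length xs + length is"
    using assms(1-3) by (intro straight_line) (auto simp: reaches_def c_def)
  then show ?thesis
    using assms(1,4,5) by (auto simp: reaches_def funpow_tick c_def[symmetric] rep_def)
qed

lemma reaches_test:
  assumes "reaches P c\<^sub>0 (length xs) s" "P = xs @ comp_exp e 0 @ Jump_pos (tmp 0) l # ys"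
  shows "reaches P c\<^sub>0 (if eval e s > 0 then l else length xs + cost e + 1) (tick (cost e + 1) s)"
proof -
  define c where "c = (step P ^^ clk s) c\<^sub>0"
  define c' where "c' = fold exec_instr (comp_exp e 0) c"
  have r: "rep s c" "pc c = length xs"
    using assms(1) by (auto simp: reaches_def c_def)
  have st: "(step P ^^ cost e) c = c'" "pc c' = length xs + cost e"
    using straight_line[of P xs "comp_exp e 0" "Jump_pos (tmp 0) l # ys" c] r assms(2)
      no_jump_comp_exp by (auto simp: c'_def)
  have "step P c' = exec_instr (Jump_pos (tmp 0) l) c'"
    using assms(2) st by (intro step_at[of _ "xs @ comp_exp e 0" _ ys]) auto
  then have "(step P ^^ (clk s + (cost e + 1))) c\<^sub>0 = exec_instr (Jump_pos (tmp 0) l) c'"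
    using st by (simp add: funpow_tick c_def[symmetric])
  then show ?thesis
    using comp_exp_correct[OF r(1), of e 0] st(2)
    by (auto simp: reaches_def c'_def[symmetric] rep_def)
qed

lemma reaches_goto:
  assumes "reaches P c\<^sub>0 (length xs) s" "P = xs @ Const (tmp 0) 1 # Jump_pos (tmp 0) l # ys"
  shows "reaches P c\<^sub>0 l (tick 2 s)"
proof -
  have "reaches P c\<^sub>0 (if eval (Num 1) s > 0 then l else length xs + cost (Num 1) + 1)
     (tick (cost (Num 1) + 1) s)"
    using assms by (intro reaches_test) auto
  then show ?thesis by (simp add: numeral_2_eq_2)
qed

text \<open>Jump targets are absolute, so code is compiled for its position
  \<open>length xs\<close>, and splitting \<open>P\<close> around it lets the induction hypotheses
  apply to subcommands in place. The exact running time is part of \<open>reaches\<close>, which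
  speaks of the configuration after \<open>clk\<close> steps.\<close>

lemma comp_correct:
  assumes "big_step c s s'" "reaches P c\<^sub>0 (length xs) s" "P = xs @ comp c (length xs) @ ys"
  shows "reaches P c\<^sub>0 (length xs + length (comp c (length xs))) s'"
  using assms
proof (induction arbitrary: xs ys rule: big_step.induct)
  case (Skip s)
  then show ?case by simp
next
  case (Assign v e s)
  have "reaches P c\<^sub>0 (length xs + (cost e + 2))
     ((s\<lparr>vars := (vars s)(v := eval e s)\<rparr>)\<lparr>clk := clk s + (cost e + 2)\<rparr>)"
    using Assign.prems
  proof (rule reaches_straight[where ys = ys])
    fix c assume "rep s c"
    from comp_exp_correct[OF this, of e 0]
    show "rep (s\<lparr>vars := (vars s)(v := eval e s)\<rparr>) (fold exec_instr (comp (Assign v e) (length xs)) c)"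
      by (auto simp: rep_def)
  qed (auto simp: no_jump_comp_exp)
  then show ?case by (simp add: tick_def)
next
  case (Put a e f s)
  let ?s' = "s\<lparr>arrs := (arrs s)(a := (arrs s a)(eval e s := eval f s))\<rparr>"
  have "reaches P c\<^sub>0 (length xs + (cost e + cost f + 7)) (?s'\<lparr>clk := clk s + (cost e + cost f + 7)\<rparr>)"
    using Put.prems
  proof (rule reaches_straight[where ys = ys])
    fix c assume r: "rep s c"
    define c1 where "c1 = fold exec_instr (comp_exp e 0) c"
    define c2 where "c2 = fold exec_instr (address a 0) c1"
    define c3 where "c3 = fold exec_instr (comp_exp f (Suc 0)) c2"
    have 1: "regs c1 (tmp 0) = eval e s" "rep s c1"
      using comp_exp_correct[OF r, of e 0] by (auto simp: c1_def)
    then have 2: "regs c2 (tmp 0) = elem_reg a (eval e s)" "rep s c2"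
      by (auto simp: c2_def rep_def fold_address)
    then have 3: "regs c3 (tmp 0) = elem_reg a (eval e s)" "rep s c3" "regs c3 (tmp (Suc 0)) = eval f s"
      using comp_exp_correct[OF 2(2), of f "Suc 0"] by (auto simp: c3_def)
    then show "rep ?s' (fold exec_instr (comp (Put a e f) (length xs)) c)"
      by (auto simp: rep_def c1_def[symmetric] c2_def[symmetric] c3_def[symmetric])
  qed (auto simp: no_jump_comp_exp no_jump_address)
  then show ?case by (simp add: tick_def ac_simps)
next
  case (Seq c s s' d s'')
  let ?C = "comp c (length xs)"
  have "reaches P c\<^sub>0 (length (xs @ ?C)) s'"
    using Seq.IH(1)[OF Seq.prems(1)] Seq.prems(2) by (simp add: Let_def)
  from Seq.IH(2)[OF this, of ys] Seq.prems(2) show ?case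
    by (simp add: Let_def add.assoc)
next
  case (IfTrue e s c s' d)
  let ?E = "comp_exp e 0"
  let ?D = "comp d (length xs + cost e + 1)"
  let ?q = "length xs + cost e + 1 + length ?D + 2"
  let ?C = "comp c ?q"
  let ?xs = "xs @ ?E @ [Jump_pos (tmp 0) ?q] @ ?D @
    [Const (tmp 0) 1, Jump_pos (tmp 0) (?q + length ?C)]"
  have P: "P = ?xs @ ?C @ ys"
    using IfTrue.prems(2) by (simp add: Let_def)
  have len: "length ?xs = ?q" by simp
  have "reaches P c\<^sub>0 (if eval e s > 0 then ?q else length xs + cost e + 1) (tick (cost e + 1) s)"
    by (rule reaches_test[OF IfTrue.prems(1)]) (use P in simp)
  then have "reaches P c\<^sub>0 (length ?xs) (tick (cost e + 1) s)"
    using IfTrue.hyps(1) len by (simp add: add.assoc)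
  from IfTrue.IH[OF this, unfolded len, OF P] show ?case
    by (simp add: Let_def add.assoc)
next
  case (IfFalse e s d s' c)
  let ?E = "comp_exp e 0"
  let ?D = "comp d (length xs + cost e + 1)"
  let ?q = "length xs + cost e + 1 + length ?D + 2"
  let ?C = "comp c ?q"
  let ?xs = "xs @ ?E @ [Jump_pos (tmp 0) ?q]"
  let ?ys = "[Const (tmp 0) 1, Jump_pos (tmp 0) (?q + length ?C)] @ ?C @ ys"
  have P: "P = ?xs @ ?D @ ?ys"
    using IfFalse.prems(2) by (simp add: Let_def)
  have len: "length ?xs = length xs + cost e + 1" by simp
  have "reaches P c\<^sub>0 (if eval e s > 0 then ?q else length xs + cost e + 1) (tick (cost e + 1) s)"
    by (rule reaches_test[OF IfFalse.prems(1)]) (use P in simp)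
  then have "reaches P c\<^sub>0 (length ?xs) (tick (cost e + 1) s)"
    using IfFalse.hyps(1) len by simp
  from IfFalse.IH[OF this, unfolded len, OF P]
  have "reaches P c\<^sub>0 (length (?xs @ ?D)) s'"
    by (simp add: Let_def add.assoc)
  then have "reaches P c\<^sub>0 (?q + length ?C) (tick 2 s')"
    by (rule reaches_goto) (use P in simp)
  then show ?case by (simp add: Let_def add.assoc)
next
  case (WhileTrue e s c s' s'')
  let ?E = "comp_exp e 0"
  let ?q = "length xs + cost e + 3"
  let ?C = "comp c ?q"
  let ?xs = "xs @ ?E @ [Jump_pos (tmp 0) ?q, Const (tmp 0) 1, Jump_pos (tmp 0) (?q + length ?C + 2)]"
  let ?ys = "[Const (tmp 0) 1, Jump_pos (tmp 0) (length xs)] @ ys"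
  have P: "P = ?xs @ ?C @ ?ys"
    using WhileTrue.prems(2) by (simp add: Let_def)
  have len: "length ?xs = ?q" by simp
  have "reaches P c\<^sub>0 (if eval e s > 0 then ?q else length xs + cost e + 1) (tick (cost e + 1) s)"
    by (rule reaches_test[OF WhileTrue.prems(1)]) (use P in simp)
  then have "reaches P c\<^sub>0 (length ?xs) (tick (cost e + 1) s)"
    using WhileTrue.hyps(1) len by (simp add: numeral_3_eq_3)
  from WhileTrue.IH(1)[OF this, unfolded len, OF P]
  have "reaches P c\<^sub>0 (length (?xs @ ?C)) s'"
    by (simp add: Let_def add.assoc numeral_3_eq_3)
  then have "reaches P c\<^sub>0 (length xs) (tick 2 s')"
    by (rule reaches_goto) (use P in simp)
  from WhileTrue.IH(2)[OF this WhileTrue.prems(2)] show ?case .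
next
  case (WhileFalse e s c)
  let ?E = "comp_exp e 0"
  let ?q = "length xs + cost e + 3"
  let ?C = "comp c ?q"
  let ?xs = "xs @ ?E @ [Jump_pos (tmp 0) ?q]"
  have P: "P = ?xs @ Const (tmp 0) 1 # Jump_pos (tmp 0) (?q + length ?C + 2) # ?C @
    [Const (tmp 0) 1, Jump_pos (tmp 0) (length xs)] @ ys"
    using WhileFalse.prems(2) by (simp add: Let_def)
  have "reaches P c\<^sub>0 (if eval e s > 0 then ?q else length xs + cost e + 1) (tick (cost e + 1) s)"
    by (rule reaches_test[OF WhileFalse.prems(1)]) (use P in simp)
  then have "reaches P c\<^sub>0 (length ?xs) (tick (cost e + 1) s)"
    using WhileFalse.hyps(1) by simp
  then have "reaches P c\<^sub>0 (?q + length ?C + 2) (tick 2 (tick (cost e + 1) s))"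
    by (rule reaches_goto) (use P in simp)
  then show ?case by (simp add: Let_def add.assoc tick_def numeral_3_eq_3)
next
  case (Input v s)
  let ?s' = "s\<lparr>vars := (vars s)(v := (case inp s of [] \<Rightarrow> 0 | x # _ \<Rightarrow> x)), inp := tl (inp s)\<rparr>"
  have "reaches P c\<^sub>0 (length xs + 1) (?s'\<lparr>clk := clk s + 1\<rparr>)"
    using Input.prems by (rule reaches_straight[where ys = ys]) (auto simp: rep_def)
  then show ?case by (simp add: tick_def)
next
  case (Out e s)
  have "reaches P c\<^sub>0 (length xs + (cost e + 1))
     ((s\<lparr>outp := outp s @ [eval e s]\<rparr>)\<lparr>clk := clk s + (cost e + 1)\<rparr>)"
    using Out.prems
  proof (rule reaches_straight[where ys = ys])
    fix c assume "rep s c"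
    from comp_exp_correct[OF this, of e 0]
    show "rep (s\<lparr>outp := outp s @ [eval e s]\<rparr>) (fold exec_instr (comp (Out e) (length xs)) c)"
      by (auto simp: rep_def)
  qed (auto simp: no_jump_comp_exp)
  then show ?case by (simp add: tick_def)
qed

definition start :: "nat list \<Rightarrow> state" where
  "start xs = \<lparr>vars = \<lambda>_. 0, arrs = \<lambda>_ _. 0, inp = xs, outp = [], clk = 0\<rparr>"

lemma start_simps [simp]:
  "vars (start xs) v = 0" "arrs (start xs) a i = 0" "inp (start xs) = xs" "outp (start xs) = []"
  "clk (start xs) = 0"
  by (simp_all add: start_def)

lemma halted_stays: "halted P c \<Longrightarrow> (step P ^^ k) c = c"
  by (induction k) (simp_all add: step_def)

lemma computes_within_comp:
  assumes "big_step c (start xs) s" "clk s \<le> t"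
  shows "computes_within (comp c 0) xs (outp s) t"
proof -
  let ?P = "comp c 0"
  have "reaches ?P (initial_config xs) (length ([] :: program)) (start xs)"
    by (simp add: reaches_def rep_def initial_config_def)
  from comp_correct[OF assms(1) this, of "[]"]
  have r: "reaches ?P (initial_config xs) (length ?P) s" by simp
  define c' where "c' = (step ?P ^^ clk s) (initial_config xs)"
  have h: "halted ?P c'" "out_tape c' = outp s"
    using r by (auto simp: reaches_def c'_def halted_def rep_def)
  have "(step ?P ^^ t) (initial_config xs) = (step ?P ^^ (clk s + (t - clk s))) (initial_config xs)"
    using assms(2) by simp
  also have "\<dots> = c'"
    unfolding funpow_tick c'_def[symmetric] using h(1) by (rule halted_stays)
  finally show ?thesis
    using h by (simp add: computes_within_def Let_def)
qed

subsection \<open>Weakest preconditions\<close>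

text \<open>Demanding a run makes this total correctness, and as the clock is a component of the
  state, time bounds are ordinary postconditions.\<close>

definition wp :: "com \<Rightarrow> (state \<Rightarrow> bool) \<Rightarrow> state \<Rightarrow> bool" where
  "wp c Q s \<longleftrightarrow> (\<exists>s'. big_step c s s' \<and> Q s')"

lemma wp_simps [simp]:
  "wp Skip Q s = Q s"
  "wp (Assign v e) Q s = Q (tick (cost e + 2) (s\<lparr>vars := (vars s)(v := eval e s)\<rparr>))"
  "wp (Put a e f) Q s = Q (tick (cost e + cost f + 7)
      (s\<lparr>arrs := (arrs s)(a := (arrs s a)(eval e s := eval f s))\<rparr>))"
  "wp (c \<Zsemi> d) Q s = wp c (wp d Q) s"
  "wp (If e c d) Q s = (if eval e s > 0 then wp c Q (tick (cost e + 1) s)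
     else wp d (\<lambda>s. Q (tick 2 s)) (tick (cost e + 1) s))"
  "wp (Input v) Q s = Q (tick 1 (s\<lparr>vars := (vars s)(v := (case inp s of [] \<Rightarrow> 0 | x # _ \<Rightarrow> x)),
               inp := tl (inp s)\<rparr>))"
  "wp (Out e) Q s = Q (tick (cost e + 1) (s\<lparr>outp := outp s @ [eval e s]\<rparr>))"
  unfolding wp_def by (auto elim!: big_step_elims intro: big_step.intros big_step.intros[simplified])

lemma wp_mono: "wp c Q s \<Longrightarrow> (\<And>s'. Q s' \<Longrightarrow> Q' s') \<Longrightarrow> wp c Q' s"
  by (auto simp: wp_def)

text \<open>The invariant is indexed by the number of completed rounds and \<open>n\<close> is their
  exact number, so termination and cost are proved together; the induction is on the rounds still to
  come.\<close>

lemma wp_loop: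
  assumes "I 0 s"
    and "\<And>i s. i < n \<Longrightarrow> I i s \<Longrightarrow> eval e s > 0 \<and> wp c (\<lambda>s'. I (Suc i) (tick 2 s')) (tick (cost e + 1) s)"
    and "\<And>s. I n s \<Longrightarrow> eval e s = 0 \<and> Q (tick (cost e + 3) s)"
  shows "wp (While e c) Q s"
proof -
  have "I (n - k) s \<Longrightarrow> k \<le> n \<Longrightarrow> wp (While e c) Q s" for k s
  proof (induction k arbitrary: s)
    case 0
    then show ?case using assms(3)[of s] by (auto simp: wp_def intro: WhileFalse)
  next
    case (Suc k)
    from assms(2)[of "n - Suc k" s] Suc.prems
    have e: "eval e s > 0" and w: "wp c (\<lambda>s'. I (Suc (n - Suc k)) (tick 2 s')) (tick (cost e + 1) s)"
      by auto
    from w obtain s' where s': "big_step c (tick (cost e + 1) s) s'" "I (n - k) (tick 2 s')"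
      using Suc.prems(2) by (auto simp: wp_def Suc_diff_Suc)
    from Suc.IH[OF s'(2)] Suc.prems(2) e s'(1) show ?case
      by (auto simp: wp_def intro: WhileTrue[simplified])
  qed
  from this[of n s] assms(1) show ?thesis by simp
qed

section \<open>Frame conditions\<close>

fun mod_vars :: "com \<Rightarrow> vname set" where
  "mod_vars (Assign v e) = {v}"
| "mod_vars (c \<Zsemi> d) = mod_vars c \<union> mod_vars d"
| "mod_vars (If e c d) = mod_vars c \<union> mod_vars d"
| "mod_vars (While e c) = mod_vars c"
| "mod_vars (Input v) = {v}"
| "mod_vars _ = {}"

fun mod_arrs :: "com \<Rightarrow> aname set" where
  "mod_arrs (Put a e f) = {a}"
| "mod_arrs (c \<Zsemi> d) = mod_arrs c \<union> mod_arrs d"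
| "mod_arrs (If e c d) = mod_arrs c \<union> mod_arrs d"
| "mod_arrs (While e c) = mod_arrs c"
| "mod_arrs _ = {}"

fun no_out :: "com \<Rightarrow> bool" where
  "no_out (Out e) = False"
| "no_out (c \<Zsemi> d) \<longleftrightarrow> no_out c \<and> no_out d"
| "no_out (If e c d) \<longleftrightarrow> no_out c \<and> no_out d"
| "no_out (While e c) \<longleftrightarrow> no_out c"
| "no_out _ = True"

definition frame :: "com \<Rightarrow> state \<Rightarrow> state \<Rightarrow> bool" where
  "frame c s s' \<longleftrightarrow> (\<forall>v. v \<notin> mod_vars c \<longrightarrow> vars s' v = vars s v) \<and>
     (\<forall>a. a \<notin> mod_arrs c \<longrightarrow> arrs s' a = arrs s a) \<and> (no_out c \<longrightarrow> outp s' = outp s)"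

lemma big_step_frame: "big_step c s s' \<Longrightarrow> frame c s s'"
  by (induction rule: big_step.induct) (auto simp: frame_def)

lemma wp_frame:
  assumes "wp c Q s" "\<And>s'. Q s' \<Longrightarrow> frame c s s' \<Longrightarrow> Q' s'"
  shows "wp c Q' s"
  using assms big_step_frame by (auto simp: wp_def)

section \<open>Connectivity labels of a growing colouring\<close>

text \<open>Step \<open>k\<close> colours cell \<open>m + k\<close>, whose left neighbour is cell
  \<open>k\<close>; for \<open>k < m\<close> this neighbour lies in the virtual column and is never
  joined.\<close>

definition joins_left :: "nat \<Rightarrow> (nat \<Rightarrow> bool) \<Rightarrow> nat \<Rightarrow> bool" where
  "joins_left m \<chi> k \<longleftrightarrow> m \<le> k \<and> \<chi> k = \<chi> (m + k)"

definition joins_up :: "nat \<Rightarrow> (nat \<Rightarrow> bool) \<Rightarrow> nat \<Rightarrow> bool" where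
  "joins_up m \<chi> k \<longleftrightarrow> k mod m \<noteq> 0 \<and> \<chi> (m + k - 1) = \<chi> (m + k)"

text \<open>Cells are numbered column by column; cell \<open>q\<close> is the node \<open>(q mod m + 1, q div m)\<close>. The cells
  \<open>q < m\<close> form a virtual column 0 of isolated cells. After \<open>k\<close> cells have been coloured,
  \<open>lab m \<chi> k q\<close> is the largest cell in the monochromatic component of \<open>q\<close>.\<close>

fun lab :: "nat \<Rightarrow> (nat \<Rightarrow> bool) \<Rightarrow> nat \<Rightarrow> nat \<Rightarrow> nat" where
  "lab m \<chi> 0 s = s"
| "lab m \<chi> (Suc k) s =
    (if s = m + k \<or> joins_left m \<chi> k \<and> lab m \<chi> k s = lab m \<chi> k k
        \<or> joins_up m \<chi> k \<and> lab m \<chi> k s = lab m \<chi> k (m + k - 1)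
     then m + k else lab m \<chi> k s)"

definition cell_edges :: "nat \<Rightarrow> (nat \<Rightarrow> bool) \<Rightarrow> nat \<Rightarrow> (nat \<times> nat) set" where
  "cell_edges m \<chi> k = {(a, b). m \<le> a \<and> a < m + k \<and> m \<le> b \<and> b < m + k \<and> \<chi> a = \<chi> b \<and>
     (b = a + m \<or> a = b + m \<or> b = a + 1 \<and> b mod m \<noteq> 0 \<or> a = b + 1 \<and> a mod m \<noteq> 0)}"

lemma lab_cong: "(\<And>q. q < m + k \<Longrightarrow> \<chi> q = \<chi>' q) \<Longrightarrow> lab m \<chi> k s = lab m \<chi>' k s"
proof (induction k arbitrary: s)
  case (Suc k)
  have "joins_left m \<chi> k = joins_left m \<chi>' k" "joins_up m \<chi> k = joins_up m \<chi>' k"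
    using Suc.prems by (auto simp: joins_left_def joins_up_def)
  moreover have "lab m \<chi> k s = lab m \<chi>' k s" for s
    using Suc by simp
  ultimately show ?case by simp
qed simp

context
  fixes m :: nat
  assumes m_pos: "0 < m"
begin

lemma lab_bounds: "s < m + k \<Longrightarrow> s \<le> lab m \<chi> k s \<and> lab m \<chi> k s < m + k"
proof (induction k arbitrary: s)
  case (Suc k)
  then show ?case by (cases "s = m + k") (fastforce simp: less_Suc_eq)+
qed simp

lemma lab_max: "lab m \<chi> k (m + k - 1) = m + k - 1"
  using lab_bounds[of "m + k - 1" k \<chi>] m_pos by linarith

lemma lab_idem: "lab m \<chi> k (lab m \<chi> k s) = lab m \<chi> k s"
proof (induction k arbitrary: s)
  case (Suc k)
  then show ?case by auto
qed simp

lemma lab_colour: "\<chi> (lab m \<chi> k s) = \<chi> s"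
proof (induction k arbitrary: s)
  case (Suc k)
  have "\<chi> s = \<chi> (m + k)" if "joins_left m \<chi> k" "lab m \<chi> k s = lab m \<chi> k k"
    using Suc[of s] Suc[of k] that unfolding joins_left_def by metis
  moreover have "\<chi> s = \<chi> (m + k)" if "joins_up m \<chi> k" "lab m \<chi> k s = lab m \<chi> k (m + k - 1)"
    using Suc[of s] Suc[of "m + k - 1"] that unfolding joins_up_def by metis
  ultimately show ?case using Suc by auto
qed simp

lemma lab_Suc_eq: "lab m \<chi> k a = lab m \<chi> k b \<Longrightarrow> a < m + k \<Longrightarrow> b < m + k \<Longrightarrow>
    lab m \<chi> (Suc k) a = lab m \<chi> (Suc k) b"
  by simp

text \<open>An edge at the newest cell is one of its two possible joins; all other edges persist
  because merging respects equality of old labels. Together with \<open>lab_reachable\<close>,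
  labels thus describe exactly the components.\<close>

lemma lab_edge: "(a, b) \<in> cell_edges m \<chi> k \<Longrightarrow> lab m \<chi> k a = lab m \<chi> k b"
proof (induction k arbitrary: a b)
  case 0
  then show ?case by (auto simp: cell_edges_def)
next
  case (Suc k)
  have up: "lab m \<chi> (Suc k) a = lab m \<chi> (Suc k) b"
    if "(a, b) \<in> cell_edges m \<chi> (Suc k)" "a < b" for a b
  proof (cases "b = m + k")
    case True
    from that True have "a = k \<and> joins_left m \<chi> k \<or> a = m + k - 1 \<and> joins_up m \<chi> k"
      by (auto simp: cell_edges_def joins_left_def joins_up_def)
    then show ?thesis using True by auto
  next
    case False
    then have "(a, b) \<in> cell_edges m \<chi> k" using that by (auto simp: cell_edges_def)
    from Suc.IH[OF this] show ?thesis
      using False that by (intro lab_Suc_eq) (auto simp: cell_edges_def)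
  qed
  have "(b, a) \<in> cell_edges m \<chi> (Suc k)" "a \<noteq> b"
    using Suc.prems m_pos by (auto simp: cell_edges_def)
  with up[of a b] up[of b a] Suc.prems show ?case by (metis linorder_neqE_nat)
qed

lemma sym_cell_edges: "sym (cell_edges m \<chi> k)"
  by (auto simp: sym_def cell_edges_def)

text \<open>A cell relabelled \<open>m + k\<close> had the label of the left or upper neighbour of
  the new cell; by induction it reaches that neighbour, and then the new cell by one edge.\<close>

lemma lab_reachable:
  "lab m \<chi> k a = lab m \<chi> k b \<Longrightarrow> a < m + k \<Longrightarrow> b < m + k \<Longrightarrow> (a, b) \<in> (cell_edges m \<chi> k)\<^sup>*"
proof (induction k arbitrary: a b)
  case (Suc k)
  let ?E = "cell_edges m \<chi> (Suc k)"
  have mono: "(cell_edges m \<chi> k)\<^sup>* \<subseteq> ?E\<^sup>*"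
    by (rule rtrancl_mono) (auto simp: cell_edges_def)
  have symE: "(x, y) \<in> ?E\<^sup>* \<Longrightarrow> (y, x) \<in> ?E\<^sup>*" for x y
    using sym_rtrancl[OF sym_cell_edges] by (blast dest: symD)
  have top: "(s, m + k) \<in> ?E\<^sup>*" if "lab m \<chi> (Suc k) s = m + k" "s < m + Suc k" for s
  proof (cases "s = m + k")
    case False
    with that have s: "s < m + k" by simp
    then have "lab m \<chi> k s < m + k" using lab_bounds by blast
    with that False consider
      "joins_left m \<chi> k" "lab m \<chi> k s = lab m \<chi> k k"
      | "joins_up m \<chi> k" "lab m \<chi> k s = lab m \<chi> k (m + k - 1)"
      by (auto split: if_splits)
    then show ?thesis
    proof cases
      case 1
      have "(s, k) \<in> (cell_edges m \<chi> k)\<^sup>*" using Suc.IH[OF 1(2)] s m_pos by simp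
      moreover have "(k, m + k) \<in> ?E" using 1(1) by (auto simp: cell_edges_def joins_left_def)
      ultimately show ?thesis using mono by (auto intro: rtrancl_into_rtrancl)
    next
      case 2
      have "(s, m + k - 1) \<in> (cell_edges m \<chi> k)\<^sup>*" using Suc.IH[OF 2(2)] s m_pos by simp
      moreover have "(m + k) mod m \<noteq> 0" "\<chi> (m + k - 1) = \<chi> (m + k)" "k \<noteq> 0"
        using 2(1) by (auto simp: joins_up_def intro!: Nat.gr0I)
      then have "(m + k - 1, m + k) \<in> ?E"
        unfolding cell_edges_def by (simp add: Suc_leI less_Suc_eq_le)
      ultimately show ?thesis using mono by (auto intro: rtrancl_into_rtrancl)
    qed
  qed simp
  show ?case
  proof (cases "lab m \<chi> (Suc k) a = m + k")
    case True
    then show ?thesis using top[of a] top[of b] Suc.prems by (metis symE rtrancl_trans)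
  next
    case False
    then have "lab m \<chi> k a = lab m \<chi> k b" "a < m + k" "b < m + k"
      using Suc.prems by (auto split: if_splits simp: less_Suc_eq)
    then show ?thesis using Suc.IH mono by blast
  qed
qed simp

text \<open>Read along the frontier \<open>k, \<dots>, m + k - 1\<close>, a step drops the first cell, appends a new last
  one and merges its component with those of the dropped and of the previously last cell, which are
  cyclic neighbours of the new cell. Such steps create no crossing.\<close>

lemma lab_noncrossing:
  "k \<le> a \<Longrightarrow> a < b \<Longrightarrow> b < c \<Longrightarrow> c < d \<Longrightarrow> d < m + k \<Longrightarrow>
   lab m \<chi> k a = lab m \<chi> k c \<Longrightarrow> lab m \<chi> k b = lab m \<chi> k d \<Longrightarrow> lab m \<chi> k a = lab m \<chi> k b"
proof (induction k arbitrary: a b c d)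
  case 0
  then show ?case by simp
next
  case (Suc k)
  let ?l = "lab m \<chi> k" and ?u = "m + k - 1"
  let ?J = "\<lambda>s. s = m + k \<or> joins_left m \<chi> k \<and> ?l s = ?l k \<or> joins_up m \<chi> k \<and> ?l s = ?l ?u"
  have J: "lab m \<chi> (Suc k) s = (if ?J s then m + k else ?l s)" for s by simp
  have lt: "?l s < m + k" if "s < m + k" for s using lab_bounds that by blast
  have ord: "k < a" "a < b" "b < c" "c < d" "c < m + k" "c \<le> ?u" "d \<le> m + k"
    using Suc.prems by auto
  have JT: "?J s" if "lab m \<chi> (Suc k) s = lab m \<chi> (Suc k) s'" "?J s'" "s < m + k" for s s'
    using that lt[OF that(3)] by (auto split: if_splits)
  have eqn: "?l s = ?l s'" if "lab m \<chi> (Suc k) s = lab m \<chi> (Suc k) s'" "\<not> ?J s" "\<not> ?J s'" for s s'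
    using that by auto
  show ?case
  proof (cases "?J a")
    case Ja: True
    then have Jc: "?J c" using JT[of c a] Suc.prems ord by simp
    show ?thesis
    proof (rule ccontr)
      assume contra: "\<not> ?thesis"
      then have nb: "\<not> ?J b" using Ja by auto
      have nd: "\<not> ?J d" using JT[of b d] nb Suc.prems ord by auto
      then have d: "d < m + k" using ord by (cases "d = m + k") auto
      have bd: "?l b = ?l d" using eqn nb nd Suc.prems by blast
      have la: "joins_left m \<chi> k \<and> ?l a = ?l k \<or> joins_up m \<chi> k \<and> ?l a = ?l ?u"
        using Ja ord by auto
      have lc: "joins_left m \<chi> k \<and> ?l c = ?l k \<or> joins_up m \<chi> k \<and> ?l c = ?l ?u"
        using Jc ord by auto
      \<comment> \<open>In the mixed cases \<open>c\<close> is paired with the end of the old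
        frontier whose component it shares, \<open>?u\<close> on the right or \<open>k\<close> on
        the left. That pair crosses \<open>b\<close> and \<open>d\<close>, so by induction
        \<open>b\<close> lies in the same component and would have been merged too.\<close>
      from la lc show False
      proof (elim disjE conjE)
        assume "?l a = ?l k" "?l c = ?l k" "joins_left m \<chi> k"
        then show False using Suc.IH[of a b c d] bd ord d nb by auto
      next
        assume *: "?l a = ?l k" "?l c = ?l ?u" "joins_up m \<chi> k"
        have "d \<noteq> ?u" using nd * by auto
        then have "?l b = ?l c" using Suc.IH[of b c d ?u] * bd ord d by auto
        then show False using nb * by auto
      next
        assume *: "?l a = ?l ?u" "?l c = ?l k" "joins_left m \<chi> k"
        have "?l k = ?l b" using Suc.IH[of k b c d] * bd ord d by auto
        then show False using nb * by auto
      next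
        assume "?l a = ?l ?u" "?l c = ?l ?u" "joins_up m \<chi> k"
        then show False using Suc.IH[of a b c d] bd ord d nb by auto
      qed
    qed
  next
    case na: False
    then have nc: "\<not> ?J c" using JT[of a c] Suc.prems ord by auto
    have ac: "?l a = ?l c" using eqn na nc Suc.prems by blast
    show ?thesis
    proof (cases "?J b")
      case Jb: True
      then have "joins_left m \<chi> k \<and> ?l b = ?l k \<or> joins_up m \<chi> k \<and> ?l b = ?l ?u"
        using ord by auto
      then show ?thesis
      proof (elim disjE conjE)
        assume *: "joins_left m \<chi> k" "?l b = ?l k"
        have "?l k = ?l a" using Suc.IH[of k a b c] * ac ord by auto
        then show ?thesis using na * by auto
      next
        assume *: "joins_up m \<chi> k" "?l b = ?l ?u"
        have "c \<noteq> ?u" using nc * by auto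
        then have "?l a = ?l b" using Suc.IH[of a b c ?u] * ac ord by auto
        then show ?thesis using na * by auto
      qed
    next
      case nb: False
      then have nd: "\<not> ?J d" using JT[of b d] Suc.prems ord by auto
      then have d: "d < m + k" using ord by (cases "d = m + k") auto
      have bd: "?l b = ?l d" using eqn nb nd Suc.prems by blast
      then have "?l a = ?l b" using Suc.IH[of a b c d] ac ord d by auto
      then show ?thesis using na nb by auto
    qed
  qed
qed

end

section \<open>Frontier states and their transitions\<close>

text \<open>Labels are largest cells, so a component has left the frontier exactly when its label is
  below \<open>k\<close>; \<open>m \<le> q\<close> leaves out the virtual cells.\<close>

definition closed_count :: "nat \<Rightarrow> (nat \<Rightarrow> bool) \<Rightarrow> nat \<Rightarrow> bool \<Rightarrow> nat" where
  "closed_count m \<chi> k c = card {q. m \<le> q \<and> q < k \<and> \<chi> q = c \<and> lab m \<chi> k q = q}"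

text \<open>Entries \<open>m\<close> and \<open>m + 1\<close> count the components of colour \<open>False\<close> and \<open>True\<close>
  that have left the frontier; counts above 2 are not distinguished.\<close>

definition frontier :: "nat \<Rightarrow> (nat \<Rightarrow> bool) \<Rightarrow> nat \<Rightarrow> nat \<Rightarrow> nat" where
  "frontier m \<chi> k p = (if p < m then lab m \<chi> k (k + p) - k + (if \<chi> (k + p) then m else 0)
     else min 2 (closed_count m \<chi> k (p \<noteq> m)))"

text \<open>Entries are relative to the start of the frontier, which moves on by one cell: unmerged
  entries decrease by 1, merged ones become \<open>m - 1 + off\<close>. The last frontier cell is
  its own label, so the component of the cell above, if of colour \<open>c\<close>, is recognized by
  that same value. A counter grows when the dropped cell is its own label and has the other colour,
  that is, when \<open>f 0\<close> is 0 or \<open>m\<close>, respectively.\<close>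

definition advance :: "nat \<Rightarrow> nat \<Rightarrow> bool \<Rightarrow> (nat \<Rightarrow> nat) \<Rightarrow> nat \<Rightarrow> nat" where
  "advance m k c f p = (let off = (if c then m else 0) in
     if p < m - 1 then
       (if k mod m \<noteq> 0 \<and> f (p + 1) = m - 1 + off \<or>
           m \<le> k \<and> off \<le> f 0 \<and> f 0 < off + m \<and> f (p + 1) = f 0
        then m - 1 + off else f (p + 1) - 1)
     else if p = m - 1 then m - 1 + off
     else if (p = m) = c \<and> m \<le> k \<and> f 0 = (if c then 0 else m) \<and> f p < 2 then f p + 1
     else f p)"

lemma closed_count_Suc:
  assumes m: "2 \<le> m"
  shows "closed_count m \<chi> (Suc k) c = closed_count m \<chi> k c +
     (if m \<le> k \<and> \<chi> k = c \<and> c \<noteq> \<chi> (m + k) \<and> lab m \<chi> k k = k then 1 else 0)"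
proof -
  have m0: "0 < m" using m by simp
  let ?l = "lab m \<chi> k"
  have kk: "k \<le> ?l k" "?l (m + k - 1) = m + k - 1" "\<And>s. s < m + k \<Longrightarrow> ?l s < m + k"
    using lab_bounds[OF m0, of _ k \<chi>] lab_max[OF m0] m0 by auto
  have fix_iff: "lab m \<chi> (Suc k) q = q \<longleftrightarrow> ?l q = q" if "q < k" for q
    using that kk m by auto
  \<comment> \<open>A cell \<open>k\<close> that is its own label does not share the label
    \<open>m + k - 1\<close> of the last cell, since \<open>2 \<le> m\<close> makes the two cells
    different. Only a left join can absorb it.\<close>
  have fix_k: "lab m \<chi> (Suc k) k = k \<longleftrightarrow> ?l k = k \<and> \<not> joins_left m \<chi> k"
    using kk m by auto
  let ?A = "{q. m \<le> q \<and> q < k \<and> \<chi> q = c \<and> ?l q = q}"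
  have "{q. m \<le> q \<and> q < Suc k \<and> \<chi> q = c \<and> lab m \<chi> (Suc k) q = q} =
    (if m \<le> k \<and> \<chi> k = c \<and> c \<noteq> \<chi> (m + k) \<and> ?l k = k then insert k ?A else ?A)"
    (is "?B = _")
  proof (rule set_eqI)
    fix q show "q \<in> ?B \<longleftrightarrow>
      q \<in> (if m \<le> k \<and> \<chi> k = c \<and> c \<noteq> \<chi> (m + k) \<and> ?l k = k then insert k ?A else ?A)"
      using fix_iff[of q] fix_k
      by (cases "q = k") (auto simp: joins_left_def less_Suc_eq simp del: lab.simps)
  qed
  moreover have "finite ?A" by (rule finite_subset[of _ "{..<k}"]) auto
  ultimately show ?thesis by (simp add: closed_count_def del: lab.simps)
qed

lemma frontier_Suc:
  assumes m: "2 \<le> m" and p: "p < m + 2"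
  shows "frontier m \<chi> (Suc k) p = advance m k (\<chi> (m + k)) (frontier m \<chi> k) p"
proof -
  have m0: "0 < m" using m by simp
  let ?l = "lab m \<chi> k" and ?c = "\<chi> (m + k)"
  have b: "s \<le> ?l s" "?l s < m + k" if "s < m + k" for s
    using lab_bounds[OF m0 that] by auto
  have f0: "frontier m \<chi> k 0 = ?l k - k + (if \<chi> k then m else 0)"
    using m0 by (simp add: frontier_def)
  have col: "\<chi> (?l s) = \<chi> s" for s by (rule lab_colour[OF m0])
  have mx: "?l (m + k - 1) = m + k - 1" by (rule lab_max[OF m0])
  consider "p < m - 1" | "p = m - 1" | "p = m" | "p = m + 1" using p by linarith
  then show ?thesis
  proof cases
    case 1
    let ?s = "k + p + 1"
    have s: "?s < m + k" using 1 by simp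
    have fp: "frontier m \<chi> k (p + 1) = ?l ?s - k + (if \<chi> ?s then m else 0)"
      using 1 by (simp add: frontier_def less_diff_conv)
    \<comment> \<open>Entries of the two colours occupy the disjoint ranges below \<open>m\<close>
      and from \<open>m\<close> on, so equal entries mean equal labels and equal colours.\<close>
    have "frontier m \<chi> k (p + 1) = m - 1 + (if ?c then m else 0) \<longleftrightarrow> ?l ?s = m + k - 1 \<and> \<chi> ?s = ?c"
      using b[OF s] m0 unfolding fp by (cases "\<chi> ?s"; cases ?c) auto
    then have up: "joins_up m \<chi> k \<and> ?l ?s = ?l (m + k - 1) \<longleftrightarrow>
        k mod m \<noteq> 0 \<and> frontier m \<chi> k (p + 1) = m - 1 + (if ?c then m else 0)"
      using col[of ?s] unfolding mx joins_up_def by metis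
    have "frontier m \<chi> k (p + 1) = frontier m \<chi> k 0 \<longleftrightarrow> ?l ?s = ?l k \<and> \<chi> ?s = \<chi> k"
      using b[OF s] b[of k] m0 s unfolding fp f0 by (cases "\<chi> ?s"; cases "\<chi> k") auto
    moreover have "(if ?c then m else 0) \<le> frontier m \<chi> k 0 \<and>
        frontier m \<chi> k 0 < (if ?c then m else 0) + m \<longleftrightarrow> \<chi> k = ?c"
      using b[of k] m0 unfolding f0 by (cases "\<chi> k"; cases ?c) auto
    ultimately have left: "joins_left m \<chi> k \<and> ?l ?s = ?l k \<longleftrightarrow>
        m \<le> k \<and> (if ?c then m else 0) \<le> frontier m \<chi> k 0 \<and>
        frontier m \<chi> k 0 < (if ?c then m else 0) + m \<and> frontier m \<chi> k (p + 1) = frontier m \<chi> k 0"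
      using col[of ?s] col[of k] unfolding joins_left_def by metis
    let ?J = "joins_up m \<chi> k \<and> ?l ?s = ?l (m + k - 1) \<or> joins_left m \<chi> k \<and> ?l ?s = ?l k"
    have "lab m \<chi> (Suc k) ?s = (if ?J then m + k else ?l ?s)"
      using s by auto
    moreover have "frontier m \<chi> (Suc k) p = lab m \<chi> (Suc k) ?s - Suc k + (if \<chi> ?s then m else 0)"
      using less_imp_diff_less[OF 1] 1 by (cases "p < m") (simp_all add: frontier_def del: lab.simps)
    moreover have "?J \<Longrightarrow> \<chi> ?s = ?c"
      using col[of ?s] col[of k] col[of "m + k - 1"] unfolding joins_left_def joins_up_def by metis
    moreover have "?l ?s - Suc k + (if \<chi> ?s then m else 0) = frontier m \<chi> k (p + 1) - 1"
      using b[OF s] unfolding fp by auto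
    ultimately have "frontier m \<chi> (Suc k) p = (if joins_up m \<chi> k \<and> ?l ?s = ?l (m + k - 1) \<or>
        joins_left m \<chi> k \<and> ?l ?s = ?l k then m - 1 + (if ?c then m else 0)
        else frontier m \<chi> k (p + 1) - 1)"
      by (simp only: split: if_split) auto
    then show ?thesis
      unfolding advance_def Let_def up left by (simp only: 1 if_True)
  next
    case 2
    then show ?thesis using m by (simp add: frontier_def advance_def add.commute)
  next
    case 3
    have "frontier m \<chi> k 0 = 0 \<longleftrightarrow> ?l k = k \<and> \<not> \<chi> k"
      using f0 b[of k] m0 by (cases "\<chi> k") auto
    then show ?thesis
      using 3 m unfolding advance_def
      by (auto simp: frontier_def closed_count_Suc[OF m] simp del: lab.simps)
  next
    case 4
    have "frontier m \<chi> k 0 = m \<longleftrightarrow> ?l k = k \<and> \<chi> k"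
      using f0 b[of k] m0 by (cases "\<chi> k") auto
    then show ?thesis
      using 4 m unfolding advance_def
      by (auto simp: frontier_def closed_count_Suc[OF m] simp del: lab.simps)
  qed
qed

lemma frontier_cong:
  assumes "\<And>q. q < m + k \<Longrightarrow> \<chi> q = \<chi>' q"
  shows "frontier m \<chi> k p = frontier m \<chi>' k p"
proof -
  have "lab m \<chi> k = lab m \<chi>' k" using lab_cong[of m k \<chi> \<chi>'] assms by blast
  moreover have "{q. m \<le> q \<and> q < k \<and> \<chi> q = c \<and> lab m \<chi>' k q = q} =
      {q. m \<le> q \<and> q < k \<and> \<chi>' q = c \<and> lab m \<chi>' k q = q}" for c
    using assms by auto
  ultimately show ?thesis using assms by (simp add: frontier_def closed_count_def)
qed

lemma frontier_less: "2 \<le> m \<Longrightarrow> p < m + 2 \<Longrightarrow> frontier m \<chi> k p < 2 * m"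
  using lab_bounds[of m "k + p" k \<chi>] by (auto simp: frontier_def)

section \<open>The number of frontier states\<close>

text \<open>A noncrossing partition is determined by the sets of first and of last elements of its blocks:
  scanned from the left, an element that is not first belongs to the open block visited most
  recently.\<close>

lemma noncrossing_unique_aux:
  fixes l l' :: "nat \<Rightarrow> nat"
  assumes b: "\<And>p. p < m \<Longrightarrow> p \<le> l p \<and> l p < m" and idem: "\<And>p. p < m \<Longrightarrow> l (l p) = l p"
    and nc: "\<And>a b c d. a < b \<Longrightarrow> b < c \<Longrightarrow> c < d \<Longrightarrow> d < m \<Longrightarrow> l a = l c \<Longrightarrow> l b = l d \<Longrightarrow> l a = l b"
    and b': "\<And>p. p < m \<Longrightarrow> p \<le> l' p \<and> l' p < m" and idem': "\<And>p. p < m \<Longrightarrow> l' (l' p) = l' p"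
    and last: "\<And>p. p < m \<Longrightarrow> l p = p \<longleftrightarrow> l' p = p"
    and agree: "\<And>x y. x < i \<Longrightarrow> y < i \<Longrightarrow> l x = l y \<longleftrightarrow> l' x = l' y"
    and i: "i < m" and a: "a < i" "l a = l i" and a': "a \<le> a'" "a' < i" "l' a' = l' i"
  shows "l a' = l i"
proof (cases "a' = a")
  case False
  then have aa: "a < a'" using a' by simp
  have open': "l' a' \<ge> i" using b'[OF i] a'(3) by simp
  \<comment> \<open>The \<open>l\<close>-block of \<open>a'\<close> is still open at
    \<open>i\<close>: a last element before \<open>i\<close> would, by \<open>agree\<close> and
    \<open>last\<close>, also be the last one of the \<open>l'\<close>-block of \<open>a'\<close>,
    which contains \<open>i\<close>.\<close>
  have ge: "l a' \<ge> i"
  proof (rule ccontr)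
    assume "\<not> l a' \<ge> i"
    then have x: "l a' < i" by simp
    have "l (l a') = l a'" using idem a' i by simp
    then have "l' (l a') = l' a'" "l' (l a') = l a'"
      using agree[of "l a'" a'] x a' last[of "l a'"] i by auto
    then show False using open' x by simp
  qed
  show ?thesis
  proof (rule ccontr)
    assume ne: "l a' \<noteq> l i"
    have "l a' \<noteq> i" using idem[of a'] a' i ne by auto
    then have "i < l a'" using ge by simp
    then have "l a = l a'"
      using nc[of a a' i "l a'"] aa a a' i b[of a'] idem[of a'] by auto
    then show False using a ne by simp
  qed
qed (use a in simp)

text \<open>The block relations are shown to agree on longer and longer prefixes. If
  \<open>i\<close> is not first, each partition has an earlier element in the block of
  \<open>i\<close>, and the later of the two belongs to that block in both partitions. Equal block
  relations give \<open>l = l'\<close> because the common last elements name the blocks.\<close>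

lemma noncrossing_unique:
  fixes l l' :: "nat \<Rightarrow> nat"
  assumes b: "\<And>p. p < m \<Longrightarrow> p \<le> l p \<and> l p < m" and idem: "\<And>p. p < m \<Longrightarrow> l (l p) = l p"
    and nc: "\<And>a b c d. a < b \<Longrightarrow> b < c \<Longrightarrow> c < d \<Longrightarrow> d < m \<Longrightarrow> l a = l c \<Longrightarrow> l b = l d \<Longrightarrow> l a = l b"
    and b': "\<And>p. p < m \<Longrightarrow> p \<le> l' p \<and> l' p < m" and idem': "\<And>p. p < m \<Longrightarrow> l' (l' p) = l' p"
    and nc': "\<And>a b c d. a < b \<Longrightarrow> b < c \<Longrightarrow> c < d \<Longrightarrow> d < m \<Longrightarrow> l' a = l' c \<Longrightarrow> l' b = l' d \<Longrightarrow> l' a = l' b"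
    and last: "\<And>p. p < m \<Longrightarrow> l p = p \<longleftrightarrow> l' p = p"
    and first: "\<And>p. p < m \<Longrightarrow> (\<exists>q<p. l q = l p) \<longleftrightarrow> (\<exists>q<p. l' q = l' p)"
    and "p < m"
  shows "l p = l' p"
proof -
  have agree: "i \<le> m \<Longrightarrow> x < i \<Longrightarrow> y < i \<Longrightarrow> l x = l y \<longleftrightarrow> l' x = l' y" for i x y
  proof (induction i arbitrary: x y)
    case (Suc i)
    have i: "i < m" using Suc.prems by simp
    have IH: "\<And>x y. x < i \<Longrightarrow> y < i \<Longrightarrow> l x = l y \<longleftrightarrow> l' x = l' y" using Suc by simp
    have new: "l x = l i \<longleftrightarrow> l' x = l' i" if x: "x < i" for x
    proof (cases "\<exists>q<i. l q = l i")
      case False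
      then show ?thesis using x first[OF i] by auto
    next
      case True
      then obtain a where a: "a < i" "l a = l i" by auto
      from True first[OF i] obtain a' where a': "a' < i" "l' a' = l' i" by auto
      have "l a' = l i \<or> l' a = l' i"
      proof (cases "a \<le> a'")
        case True
        then have "l a' = l i"
          by (intro noncrossing_unique_aux[of m l l' i a a']) (use assms IH i a a' in auto)
        then show ?thesis ..
      next
        case False
        then have "l' a = l' i"
          by (intro noncrossing_unique_aux[of m l' l i a' a]) (use assms IH i a a' in auto)
        then show ?thesis ..
      qed
      then have "l a = l a'" using IH[of a a'] a a' by auto
      then show ?thesis using a a' IH[OF x a(1)] IH[OF x a'(1)] IH[OF a(1) a'(1)] by auto
    qed
    show ?case
      using Suc.prems new[of x] new[of y] IH[of x y]
      by (cases "x = i"; cases "y = i") auto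
  qed simp
  have lp: "l p < m" "l' p < m" using b b' assms(9) by auto
  have "l' (l p) = l' p" using agree[of m "l p" p] idem lp assms(9) by simp
  moreover have "l' (l p) = l p" using last[OF lp(1)] idem assms(9) by simp
  ultimately show ?thesis by simp
qed

section \<open>Three bits per frontier cell\<close>

definition frontier_list :: "nat \<Rightarrow> (nat \<Rightarrow> bool) \<Rightarrow> nat \<Rightarrow> nat list" where
  "frontier_list m \<chi> k = map (frontier m \<chi> k) [0..<m + 2]"

text \<open>The bits are: colour \<open>True\<close>, last in its block, not first in its block.
  Equal entries mean the same block, as an entry combines label and colour.\<close>

definition block_bits :: "nat \<Rightarrow> nat list \<Rightarrow> (bool \<times> bool \<times> bool) list" where
  "block_bits m v = map (\<lambda>p. (m \<le> v ! p, v ! p = p \<or> v ! p = p + m, \<exists>q<p. v ! q = v ! p)) [0..<m]"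

lemma nth_frontier_list [simp]: "p < m + 2 \<Longrightarrow> frontier_list m \<chi> k ! p = frontier m \<chi> k p"
  unfolding frontier_list_def by (subst nth_map) (simp_all del: upt_Suc)

lemma frontier_list_eqI:
  assumes m: "2 \<le> m"
    and bits: "block_bits m (frontier_list m \<chi> k) = block_bits m (frontier_list m \<chi>' k)"
    and cnt: "frontier m \<chi> k m = frontier m \<chi>' k m" "frontier m \<chi> k (m + 1) = frontier m \<chi>' k (m + 1)"
  shows "frontier_list m \<chi> k = frontier_list m \<chi>' k"
proof -
  have m0: "0 < m" using m by simp
  define l where "l \<chi> p = lab m \<chi> k (k + p) - k" for \<chi> p
  have kl: "k + l \<chi> p = lab m \<chi> k (k + p)" if "p < m" for \<chi> p
    using lab_bounds[OF m0, of "k + p" k \<chi>] that by (simp add: l_def)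
  have b: "p \<le> l \<chi> p \<and> l \<chi> p < m" if "p < m" for \<chi> p
    using lab_bounds[OF m0, of "k + p" k \<chi>] that by (auto simp: l_def)
  have idem: "l \<chi> (l \<chi> p) = l \<chi> p" if "p < m" for \<chi> p
    using kl[of "l \<chi> p" \<chi>] b[OF that, of \<chi>] kl[OF that, of \<chi>] lab_idem[OF m0, of \<chi> k "k + p"]
    by simp
  have lab_iff: "lab m \<chi> k (k + p) = lab m \<chi> k (k + q) \<longleftrightarrow> l \<chi> p = l \<chi> q" if "p < m" "q < m" for \<chi> p q
    using kl[OF that(1), of \<chi>] kl[OF that(2), of \<chi>] by auto
  have nc: "l \<chi> a = l \<chi> b" if "a < b" "b < c" "c < d" "d < m" "l \<chi> a = l \<chi> c" "l \<chi> b = l \<chi> d"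
    for \<chi> a b c d
    using lab_noncrossing[OF m0, of k "k + a" "k + b" "k + c" "k + d" \<chi>] that
    by (simp add: lab_iff)
  have fr: "frontier m \<chi> k p = l \<chi> p + (if \<chi> (k + p) then m else 0)" if "p < m" for \<chi> p
    using that by (simp add: frontier_def l_def)
  have same: "frontier m \<chi> k q = frontier m \<chi> k p \<longleftrightarrow> l \<chi> q = l \<chi> p" if "p < m" "q < m" for \<chi> p q
  proof -
    have "\<chi> (k + p) = \<chi> (k + q)" if "l \<chi> q = l \<chi> p"
      using lab_iff[of q p \<chi>] that \<open>p < m\<close> \<open>q < m\<close> lab_colour[OF m0, of \<chi> k] by metis
    then show ?thesis
      using fr[OF that(1)] fr[OF that(2)] b[OF that(1), of \<chi>] b[OF that(2), of \<chi>] by auto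
  qed
  have nth: "frontier_list m \<chi> k ! p = frontier m \<chi> k p" if "p < m" for \<chi> p
    using that by simp
  have bit: "block_bits m (frontier_list m \<chi> k) ! p = (\<chi> (k + p), l \<chi> p = p, \<exists>q<p. l \<chi> q = l \<chi> p)"
    if p: "p < m" for \<chi> p
  proof -
    have 1: "(\<exists>q<p. frontier_list m \<chi> k ! q = frontier_list m \<chi> k ! p) \<longleftrightarrow> (\<exists>q<p. l \<chi> q = l \<chi> p)"
      using same[OF p] p by (auto simp: nth)
    have 2: "m \<le> frontier m \<chi> k p \<longleftrightarrow> \<chi> (k + p)"
      using fr[OF p] b[OF p, of \<chi>] by auto
    have 3: "frontier m \<chi> k p = p \<or> frontier m \<chi> k p = p + m \<longleftrightarrow> l \<chi> p = p"
      using fr[OF p] b[OF p, of \<chi>] p by auto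
    show ?thesis using p 1 2 3 by (simp add: block_bits_def nth)
  qed
  have eq: "\<chi> (k + p) = \<chi>' (k + p) \<and> (l \<chi> p = p \<longleftrightarrow> l \<chi>' p = p) \<and>
      ((\<exists>q<p. l \<chi> q = l \<chi> p) \<longleftrightarrow> (\<exists>q<p. l \<chi>' q = l \<chi>' p))" if p: "p < m" for p
    using bit[OF p, of \<chi>] bit[OF p, of \<chi>'] bits by simp
  have ll: "l \<chi> p = l \<chi>' p" if "p < m" for p
    by (rule noncrossing_unique[of m "l \<chi>" "l \<chi>'"];
        (rule b idem that | rule nc | simp add: eq)?; assumption?)
  have "frontier m \<chi> k p = frontier m \<chi>' k p" if p: "p < m + 2" for p
  proof -
    consider "p < m" | "p = m" | "p = m + 1" using p by linarith
    then show ?thesis by cases (use fr ll eq cnt in auto)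
  qed
  then show ?thesis by (auto simp: frontier_list_def)
qed

lemma card_frontier_lists:
  assumes m: "2 \<le> m"
  shows "finite (range (\<lambda>\<chi>. frontier_list m \<chi> k))" "card (range (\<lambda>\<chi>. frontier_list m \<chi> k)) \<le> 9 * 8 ^ m"
proof -
  define F where "F v = (block_bits m v, v ! m, v ! (m + 1))" for v
  let ?A = "range (\<lambda>\<chi>. frontier_list m \<chi> k)"
  \<comment> \<open>Each counter takes one of the values 0, 1, 2, whence the factor 9.\<close>
  let ?B = "{xs :: (bool \<times> bool \<times> bool) list. set xs \<subseteq> UNIV \<and> length xs = m} \<times> {..2::nat} \<times> {..2::nat}"
  have inj: "inj_on F ?A"
    using m by (auto simp: inj_on_def F_def intro!: frontier_list_eqI)
  have sub: "F ` ?A \<subseteq> ?B"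
    by (auto simp: F_def block_bits_def frontier_def)
  have cU: "card (UNIV :: (bool \<times> bool \<times> bool) set) = 8"
    by (simp add: card_UNIV_bool flip: UNIV_Times_UNIV)
  have finL: "finite {xs :: (bool \<times> bool \<times> bool) list. set xs \<subseteq> UNIV \<and> length xs = m}"
    by (rule finite_lists_length_eq) simp
  have "card {xs :: (bool \<times> bool \<times> bool) list. set xs \<subseteq> UNIV \<and> length xs = m} = 8 ^ m"
    by (subst card_lists_length_eq) (simp_all only: cU finite)
  then have cB: "card ?B = 9 * 8 ^ m" by (simp only: card_cartesian_product card_atMost) simp
  have finB: "finite ?B" using finL by (intro finite_cartesian_product) auto
  show "finite ?A" using inj finB sub by (meson finite_imageD finite_subset)
  show "card ?A \<le> 9 * 8 ^ m"
    using card_inj_on_le[OF inj sub finB] cB by simp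
qed

section \<open>Connected bipartitions of the grid\<close>

definition cell :: "nat \<Rightarrow> nat \<Rightarrow> nat \<times> nat" where
  "cell m q = (q mod m + 1, q div m)"

fun grid_adj :: "nat \<times> nat \<Rightarrow> nat \<times> nat \<Rightarrow> bool" where
  "grid_adj (i, j) (i', j') \<longleftrightarrow>
     i = i' \<and> (j' = j + 1 \<or> j = j' + 1) \<or> j = j' \<and> (i' = i + 1 \<or> i = i' + 1)"

lemma verts_grid [simp]: "verts (grid_graph m n) = {1..m} \<times> {1..n}"
  by (simp add: grid_graph_def)

lemma rtrancl_on_eq_rtrancl:
  assumes "u \<in> S" "A \<subseteq> S \<times> S"
  shows "(u, v) \<in> rtrancl_on S A \<longleftrightarrow> (u, v) \<in> A\<^sup>*"
proof
  show "(u, v) \<in> A\<^sup>*" if "(u, v) \<in> rtrancl_on S A"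
    using that by (induction rule: rtrancl_on_induct) (auto intro: rtrancl_into_rtrancl)
  show "(u, v) \<in> rtrancl_on S A" if "(u, v) \<in> A\<^sup>*"
    using that
  proof (induction rule: rtrancl_induct)
    case base
    then show ?case using assms by auto
  next
    case (step y z)
    then show ?case using assms by (blast intro: rtrancl_on_into_rtrancl_on)
  qed
qed

text \<open>Connectedness is defined through the symmetric closure and through walks restricted to
  the vertex set; the arcs here are already symmetric and stay within \<open>S\<close>, so ordinary
  reachability is the same.\<close>

lemma connected_grid_iff:
  assumes "S \<subseteq> verts (grid_graph m n)"
  shows "connected (grid_graph m n \<restriction> S) \<longleftrightarrow>
    S \<noteq> {} \<and> (\<forall>u\<in>S. \<forall>v\<in>S. (u, v) \<in> {(x, y). x \<in> S \<and> y \<in> S \<and> grid_adj x y}\<^sup>*)"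
proof -
  let ?H = "with_proj (mk_symmetric (grid_graph m n \<restriction> S))"
  let ?A = "{(x, y). x \<in> S \<and> y \<in> S \<and> grid_adj x y}"
  have "1 \<le> i \<and> i \<le> m \<and> 1 \<le> j \<and> j \<le> n" if "(i, j) \<in> S" for i j
    using assms that by auto
  then have "arcs (grid_graph m n \<restriction> S) = ?A"
    by (auto simp: grid_graph_def)
  then have "parcs (mk_symmetric (grid_graph m n \<restriction> S)) = ?A"
    by (auto simp: mk_symmetric_def grid_graph_def)
  then have "arcs_ends ?H = ?A"
    by (simp add: arcs_ends_def arc_to_ends_def)
  moreover have "verts ?H = S"
    by (simp add: mk_symmetric_def)
  moreover have "(u, v) \<in> rtrancl_on S ?A \<longleftrightarrow> (u, v) \<in> ?A\<^sup>*" if "u \<in> S" for u v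
    by (rule rtrancl_on_eq_rtrancl[OF that]) auto
  ultimately show ?thesis
    unfolding connected_def strongly_connected_def reachable_def by (simp cong: ball_cong)
qed

lemma inj_cell: "0 < m \<Longrightarrow> inj (cell m)"
  unfolding inj_def cell_def by (metis Pair_inject add_right_cancel mult_div_mod_eq)

lemma cell_image:
  assumes "0 < m"
  shows "cell m ` {m..<m + m * n} = {1..m} \<times> {1..n}"
proof (intro equalityI subsetI)
  fix x assume "x \<in> cell m ` {m..<m + m * n}"
  then obtain q where q: "x = cell m q" "m \<le> q" "q < m + m * n" by auto
  have "1 \<le> q div m" using q assms by (simp add: Suc_leI div_greater_zero_iff)
  moreover have "q div m < n + 1" using q assms by (simp add: div_less_iff_less_mult algebra_simps)
  moreover have "q mod m < m" using assms by simp
  ultimately show "x \<in> {1..m} \<times> {1..n}" using q by (auto simp: cell_def)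
next
  fix x assume "x \<in> {1..m} \<times> {1..n}"
  then obtain i j where x: "x = (i, j)" "1 \<le> i" "i \<le> m" "1 \<le> j" "j \<le> n" by auto
  let ?q = "j * m + (i - 1)"
  have "cell m ?q = x" using x by (cases i) (simp_all add: cell_def)
  moreover have "m \<le> ?q" using x by (cases j) auto
  moreover have "j * m \<le> n * m" using x by (intro mult_le_mono1)
  then have "?q < m + n * m" using x by linarith
  then have "?q < m + m * n" by (simp only: mult.commute)
  ultimately show "x \<in> cell m ` {m..<m + m * n}" by force
qed

lemma grid_adj_cell:
  assumes m: "0 < m"
  shows "grid_adj (cell m q) (cell m r) \<longleftrightarrow>
    r = q + m \<or> q = r + m \<or> r = q + 1 \<and> r mod m \<noteq> 0 \<or> q = r + 1 \<and> q mod m \<noteq> 0"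
proof -
  have eq: "x = y \<longleftrightarrow> x mod m = y mod m \<and> x div m = y div m" for x y
    by (metis mult_div_mod_eq)
  have 1: "r = q + m \<longleftrightarrow> q mod m = r mod m \<and> r div m = q div m + 1" for q r
    using m eq[of r "q + m"] by auto
  have 2: "r = q + 1 \<and> r mod m \<noteq> 0 \<longleftrightarrow> q div m = r div m \<and> r mod m = q mod m + 1" for q r
  proof
    assume "r = q + 1 \<and> r mod m \<noteq> 0"
    then show "q div m = r div m \<and> r mod m = q mod m + 1"
      by (auto simp: mod_Suc div_Suc split: if_splits)
  next
    assume a: "q div m = r div m \<and> r mod m = q mod m + 1"
    then show "r = q + 1 \<and> r mod m \<noteq> 0"
      by (metis Suc_eq_plus1 add_Suc_right mult_div_mod_eq nat.distinct(1))
  qed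
  show ?thesis
    unfolding cell_def grid_adj.simps 1[of r q] 1[of q r] 2[of r q] 2[of q r] by auto
qed

section \<open>Components of a colour class and their largest cells\<close>

definition tops :: "nat \<Rightarrow> (nat \<Rightarrow> bool) \<Rightarrow> nat \<Rightarrow> bool \<Rightarrow> nat set" where
  "tops m \<chi> k c = {q. m \<le> q \<and> q < m + k \<and> \<chi> q = c \<and> lab m \<chi> k q = q}"

definition colour_class :: "nat \<Rightarrow> (nat \<Rightarrow> bool) \<Rightarrow> nat \<Rightarrow> bool \<Rightarrow> (nat \<times> nat) set" where
  "colour_class m \<chi> k c = cell m ` {q. m \<le> q \<and> q < m + k \<and> \<chi> q = c}"

text \<open>Each component contains exactly one cell that is its own label, so \<open>tops\<close>
  counts components. An empty class has no component and is not connected either.\<close>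

lemma connected_colour_class:
  assumes m: "0 < m"
  shows "connected (grid_graph m n \<restriction> colour_class m \<chi> (m * n) c) \<longleftrightarrow>
    card (tops m \<chi> (m * n) c) = 1"
proof -
  let ?N = "m * n"
  let ?l = "lab m \<chi> ?N"
  let ?Q = "{q. m \<le> q \<and> q < m + ?N \<and> \<chi> q = c}"
  let ?S = "colour_class m \<chi> ?N c"
  let ?A = "{(x, y). x \<in> ?S \<and> y \<in> ?S \<and> grid_adj x y}"
  have S: "?S \<subseteq> verts (grid_graph m n)"
    unfolding colour_class_def verts_grid cell_image[OF m, of n, symmetric] by (rule image_mono) auto
  have top: "?l q \<in> tops m \<chi> ?N c" if "q \<in> ?Q" for q
    using that lab_bounds[OF m, of q ?N \<chi>] lab_idem[OF m, of \<chi> ?N q] lab_colour[OF m, of \<chi> ?N q]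
    by (auto simp: tops_def)
  have edge: "(q, r) \<in> cell_edges m \<chi> ?N \<longleftrightarrow> grid_adj (cell m q) (cell m r)"
    if "q \<in> ?Q" "r \<in> ?Q" for q r
    using that by (auto simp: cell_edges_def grid_adj_cell[OF m])
  have path_lab: "\<exists>r\<in>?Q. x = cell m r \<and> ?l r = ?l q" if "(cell m q, x) \<in> ?A\<^sup>*" "q \<in> ?Q" for q x
    using that
  proof (induction rule: rtrancl_induct)
    case (step y z)
    then obtain r where r: "r \<in> ?Q" "y = cell m r" "?l r = ?l q" by auto
    from step obtain r' where r': "r' \<in> ?Q" "z = cell m r'"
      by (auto simp: colour_class_def)
    have "(r, r') \<in> cell_edges m \<chi> ?N"
      using edge[OF r(1) r'(1)] step r r' by auto
    from lab_edge[OF m this] r r' show ?case by auto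
  qed auto
  have lab_path: "(cell m q, cell m r) \<in> ?A\<^sup>*" if "q \<in> ?Q" "r \<in> ?Q" "?l q = ?l r" for q r
  proof -
    have "(q, r) \<in> (cell_edges m \<chi> ?N)\<^sup>*" using lab_reachable[OF m that(3)] that by auto
    then have "r \<in> ?Q \<and> (cell m q, cell m r) \<in> ?A\<^sup>*"
    proof (induction rule: rtrancl_induct)
      case (step y z)
      then have z: "z \<in> ?Q" by (auto simp: cell_edges_def)
      then have "(cell m y, cell m z) \<in> ?A"
        using step edge[of y z] by (auto simp: colour_class_def)
      then show ?case using z step by (auto intro: rtrancl_into_rtrancl)
    qed (use that in auto)
    then show ?thesis ..
  qed
  have "connected (grid_graph m n \<restriction> ?S) \<longleftrightarrow> (\<exists>t. tops m \<chi> ?N c = {t})"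
  proof
    assume "connected (grid_graph m n \<restriction> ?S)"
    then have ne: "?S \<noteq> {}" and con: "\<And>u v. u \<in> ?S \<Longrightarrow> v \<in> ?S \<Longrightarrow> (u, v) \<in> ?A\<^sup>*"
      unfolding connected_grid_iff[OF S] by blast+
    from ne obtain q where q: "q \<in> ?Q" by (auto simp: colour_class_def)
    have "t = ?l q" if t: "t \<in> tops m \<chi> ?N c" for t
    proof -
      have tQ: "t \<in> ?Q" "?l t = t" using t by (auto simp: tops_def)
      then have "(cell m q, cell m t) \<in> ?A\<^sup>*" using q by (intro con) (auto simp: colour_class_def)
      from path_lab[OF this q] obtain r where "cell m t = cell m r" "?l r = ?l q" by auto
      then show ?thesis using inj_cell[OF m] tQ by (auto dest: injD)
    qed
    with top[OF q] show "\<exists>t. tops m \<chi> ?N c = {t}" by blast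
  next
    assume "\<exists>t. tops m \<chi> ?N c = {t}"
    then obtain t where t: "tops m \<chi> ?N c = {t}" by auto
    have "?S \<noteq> {}" using t by (auto simp: tops_def colour_class_def)
    moreover have "(u, v) \<in> ?A\<^sup>*" if uv: "u \<in> ?S" "v \<in> ?S" for u v
    proof -
      obtain q r where qr: "u = cell m q" "v = cell m r" "q \<in> ?Q" "r \<in> ?Q"
        using uv unfolding colour_class_def by blast
      then have "?l q = ?l r" using top[of q] top[of r] t by simp
      with qr lab_path show ?thesis by blast
    qed
    ultimately show "connected (grid_graph m n \<restriction> ?S)"
      unfolding connected_grid_iff[OF S] by blast
  qed
  then show ?thesis by (simp add: card_1_singleton_iff)
qed

definition frontier_tops :: "nat \<Rightarrow> (nat \<Rightarrow> nat) \<Rightarrow> bool \<Rightarrow> nat" where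
  "frontier_tops m f c = f (if c then m + 1 else m) + card {p. p < m \<and> f p = p + (if c then m else 0)}"

text \<open>Capping the number of closed components at 2 does not affect whether the total is 1. For
  \<open>m \<le> k\<close> the frontier contains no virtual cell, so its own labels are genuine
  components.\<close>

lemma card_tops_eq_1_iff:
  assumes m: "0 < m" and k: "m \<le> k"
  shows "card (tops m \<chi> k c) = 1 \<longleftrightarrow> frontier_tops m (frontier m \<chi> k) c = 1"
proof -
  let ?B = "{p. p < m \<and> frontier m \<chi> k p = p + (if c then m else 0)}"
  let ?C = "{q. m \<le> q \<and> q < k \<and> \<chi> q = c \<and> lab m \<chi> k q = q}"
  have B: "?B = {p. p < m \<and> lab m \<chi> k (k + p) = k + p \<and> \<chi> (k + p) = c}"
  proof (rule Collect_cong)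
    fix p
    show "p < m \<and> frontier m \<chi> k p = p + (if c then m else 0) \<longleftrightarrow>
      p < m \<and> lab m \<chi> k (k + p) = k + p \<and> \<chi> (k + p) = c"
      using lab_bounds[OF m, of "k + p" k \<chi>] by (cases "\<chi> (k + p)"; cases c) (auto simp: frontier_def)
  qed
  have "tops m \<chi> k c = ?C \<union> (\<lambda>p. k + p) ` ?B"
  proof (intro equalityI subsetI)
    fix q assume q: "q \<in> tops m \<chi> k c"
    show "q \<in> ?C \<union> (\<lambda>p. k + p) ` ?B"
    proof (cases "q < k")
      case False
      then have "q = k + (q - k)" "q - k \<in> ?B" using q unfolding B by (auto simp: tops_def)
      then show ?thesis by blast
    qed (use q in \<open>auto simp: tops_def\<close>)
  qed (use k in \<open>auto simp: tops_def B\<close>)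
  moreover have "finite ?C" by (rule finite_subset[of _ "{..<k}"]) auto
  moreover have "finite ?B" by simp
  moreover have "?C \<inter> (\<lambda>p. k + p) ` ?B = {}" by auto
  moreover have "card ((\<lambda>p. k + p) ` ?B) = card ?B" by (rule card_image) simp
  ultimately have "card (tops m \<chi> k c) = card ?C + card ?B"
    by (simp only: card_Un_disjoint finite_imageI)
  moreover have "frontier_tops m (frontier m \<chi> k) c = min 2 (card ?C) + card ?B"
    by (auto simp: frontier_tops_def frontier_def[of m \<chi> k "m"] frontier_def[of m \<chi> k "Suc m"] closed_count_def)
  ultimately show ?thesis by auto
qed

section \<open>Colour histories\<close>

text \<open>Virtual and not yet coloured cells get \<open>False\<close>, so the cells of colour
  \<open>True\<close> are exactly those put into \<open>U\<close> so far.\<close>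

definition colouring :: "nat \<Rightarrow> bool list \<Rightarrow> nat \<Rightarrow> bool" where
  "colouring m h q \<longleftrightarrow> m \<le> q \<and> q < m + length h \<and> h ! (q - m)"

definition hfront :: "nat \<Rightarrow> bool list \<Rightarrow> nat \<Rightarrow> nat" where
  "hfront m h = frontier m (colouring m h) (length h)"

definition hsum :: "nat \<Rightarrow> (nat \<Rightarrow> nat) \<Rightarrow> bool list \<Rightarrow> nat" where
  "hsum m a h = (\<Sum>q\<in>{m..<m + length h}. if colouring m h q then a q else 0)"

definition hset :: "nat \<Rightarrow> bool list \<Rightarrow> (nat \<times> nat) set" where
  "hset m h = cell m ` {q. colouring m h q}"

definition splits :: "nat \<Rightarrow> bool list \<Rightarrow> bool" where
  "splits m h \<longleftrightarrow> (\<forall>c. frontier_tops m (hfront m h) c = 1)"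

lemma colouring_snoc:
  "q < m + length h \<Longrightarrow> colouring m (h @ [c]) q = colouring m h q"
  "colouring m (h @ [c]) (m + length h) = c"
  by (auto simp: colouring_def nth_append)

lemma hfront_Nil: "0 < m \<Longrightarrow> hfront m [] p = (if p < m then p else 0)"
  by (auto simp: hfront_def frontier_def colouring_def closed_count_def)

lemma hfront_snoc:
  assumes "2 \<le> m" "p < m + 2"
  shows "hfront m (h @ [c]) p = advance m (length h) c (hfront m h) p"
proof -
  have "frontier m (colouring m (h @ [c])) (length h) = frontier m (colouring m h) (length h)"
    by (rule ext, rule frontier_cong) (simp add: colouring_snoc)
  then show ?thesis
    using frontier_Suc[OF assms, of "colouring m (h @ [c])" "length h"]
    by (simp add: hfront_def colouring_snoc)
qed

lemma hfront_less: "2 \<le> m \<Longrightarrow> p < m + 2 \<Longrightarrow> hfront m h p < 2 * m"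
  by (simp add: hfront_def frontier_less)

lemma hsum_Nil [simp]: "hsum m a [] = 0"
  by (simp add: hsum_def)

lemma hsum_snoc [simp]: "hsum m a (h @ [c]) = hsum m a h + (if c then a (m + length h) else 0)"
proof -
  have "hsum m a (h @ [c]) = (\<Sum>q\<in>{m..<m + length h}. if colouring m (h @ [c]) q then a q else 0) +
      (if c then a (m + length h) else 0)"
    by (simp add: hsum_def colouring_snoc)
  also have "(\<Sum>q\<in>{m..<m + length h}. if colouring m (h @ [c]) q then a q else 0) = hsum m a h"
    unfolding hsum_def by (rule sum.cong) (auto simp: colouring_snoc)
  finally show ?thesis .
qed

lemma hsum_le:
  assumes "length h \<le> N"
  shows "hsum m a h \<le> (\<Sum>q\<in>{m..<m + N}. a q)"
proof -
  have "hsum m a h \<le> (\<Sum>q\<in>{m..<m + length h}. a q)"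
    unfolding hsum_def by (rule sum_mono) simp
  also have "\<dots> \<le> (\<Sum>q\<in>{m..<m + N}. a q)"
    using assms by (intro sum_mono2) auto
  finally show ?thesis .
qed

lemma weight_verts:
  "0 < m \<Longrightarrow> weight w (verts (grid_graph m n)) = (\<Sum>q\<in>{m..<m + m * n}. w (cell m q))"
  unfolding weight_def verts_grid cell_image[symmetric]
  by (subst sum.reindex) (auto intro: inj_on_subset[OF inj_cell])

lemma weight_hset:
  assumes "0 < m"
  shows "weight w (hset m h) = hsum m (\<lambda>q. w (cell m q)) h"
proof -
  have "weight w (hset m h) = (\<Sum>q\<in>{q. colouring m h q}. w (cell m q))"
    unfolding weight_def hset_def
    by (subst sum.reindex) (auto intro: inj_on_subset[OF inj_cell[OF assms]])
  also have "\<dots> = (\<Sum>q\<in>{q\<in>{m..<m + length h}. colouring m h q}. w (cell m q))"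
    by (rule sum.cong) (auto simp: colouring_def)
  also have "\<dots> = hsum m (\<lambda>q. w (cell m q)) h"
    unfolding hsum_def by (subst sum.inter_filter) auto
  finally show ?thesis .
qed

lemma hset_subset: "0 < m \<Longrightarrow> length h = m * n \<Longrightarrow> hset m h \<subseteq> verts (grid_graph m n)"
  unfolding verts_grid cell_image[symmetric] by (auto simp: hset_def colouring_def)

lemma weight_compl_hset:
  assumes "0 < m" "length h = m * n"
  shows "weight w (verts (grid_graph m n) - hset m h) =
    weight w (verts (grid_graph m n)) - weight w (hset m h)"
  unfolding weight_def
  by (rule sum_diff_nat) (use hset_subset[OF assms] in \<open>auto intro: finite_subset\<close>)

lemma hset_surj:
  assumes m: "0 < m" and U: "U \<subseteq> verts (grid_graph m n)"
  obtains h where "length h = m * n" "hset m h = U"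
proof
  let ?h = "map (\<lambda>i. cell m (m + i) \<in> U) [0..<m * n]"
  show len: "length ?h = m * n" by simp
  have "{q. colouring m ?h q} = {q \<in> {m..<m + m * n}. cell m q \<in> U}"
    by (auto simp: colouring_def)
  moreover have "cell m ` {q \<in> {m..<m + m * n}. cell m q \<in> U} = U"
    using U cell_image[OF m, of n] by (auto 0 3 simp: image_iff)
  ultimately show "hset m ?h = U" by (simp add: hset_def)
qed

text \<open>Both parts are nonempty as soon as they are connected, so counting components decides
  everything. By \<open>1 \<le> n\<close> the frontier has left the virtual column.\<close>

lemma connected_bipartition_hset:
  assumes m: "0 < m" and n: "1 \<le> n" and len: "length h = m * n"
  shows "connected_bipartition (grid_graph m n) (hset m h) \<longleftrightarrow> splits m h"
proof -
  let ?G = "grid_graph m n" and ?\<chi> = "colouring m h"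
  have T: "colour_class m ?\<chi> (m * n) True = hset m h"
    unfolding colour_class_def hset_def using len by (auto simp: colouring_def intro!: image_eqI)
  have "colour_class m ?\<chi> (m * n) False = cell m ` ({m..<m + m * n} - {q. ?\<chi> q})"
    unfolding colour_class_def by (rule arg_cong[of _ _ "(`) (cell m)"]) auto
  also have "\<dots> = verts ?G - hset m h"
    unfolding hset_def verts_grid cell_image[OF m, of n, symmetric]
    by (rule image_set_diff[OF inj_cell[OF m]])
  finally have F: "colour_class m ?\<chi> (m * n) False = verts ?G - hset m h" .
  have con: "connected (?G \<restriction> colour_class m ?\<chi> (m * n) c) \<longleftrightarrow> frontier_tops m (hfront m h) c = 1" for c
    unfolding connected_colour_class[OF m] hfront_def len
    using n by (intro card_tops_eq_1_iff[OF m]) simp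
  have ne: "connected (?G \<restriction> S) \<Longrightarrow> S \<noteq> {}" if "S \<subseteq> verts ?G" for S
    using connected_grid_iff[OF that] by blast
  show ?thesis
    unfolding connected_bipartition_def splits_def
    using con[of True] con[of False] hset_subset[OF m len] ne[of "hset m h"] ne[of "verts ?G - hset m h"]
    unfolding T F by (metis (full_types) Diff_subset)
qed

section \<open>Existence of a connected bipartition\<close>

lemma connected_rectangle:
  assumes "1 \<le> a" "a \<le> b" "b \<le> m" "1 \<le> n"
  shows "connected (grid_graph m n \<restriction> ({a..b} \<times> {1..n}))"
proof -
  let ?S = "{a..b} \<times> {1..n}"
  let ?A = "{(x, y). x \<in> ?S \<and> y \<in> ?S \<and> grid_adj x y}"
  have S: "?S \<subseteq> verts (grid_graph m n)" using assms by auto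
  have root: "((i, j), (a, 1)) \<in> ?A\<^sup>*" if "(i, j) \<in> ?S" for i j
    using that
  proof (induction "i + j" arbitrary: i j rule: less_induct)
    case less
    consider "1 < j" | "j = 1" "a < i" | "j = 1" "i = a" using less.prems by force
    then show ?case
    proof cases
      case 1
      then have "((i, j), (i, j - 1)) \<in> ?A" using less.prems by auto
      moreover have "((i, j - 1), (a, 1)) \<in> ?A\<^sup>*" using 1 less.prems by (intro less.hyps) auto
      ultimately show ?thesis by (rule converse_rtrancl_into_rtrancl)
    next
      case 2
      then have "((i, j), (i - 1, j)) \<in> ?A" using less.prems by auto
      moreover have "((i - 1, j), (a, 1)) \<in> ?A\<^sup>*" using 2 less.prems by (intro less.hyps) auto
      ultimately show ?thesis by (rule converse_rtrancl_into_rtrancl)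
    qed simp
  qed
  have "grid_adj x y \<Longrightarrow> grid_adj y x" for x y
    by (cases x; cases y) auto
  then have "sym ?A" by (auto intro!: symI)
  then have "sym (?A\<^sup>*)" by (rule sym_rtrancl)
  then have "(u, v) \<in> ?A\<^sup>*" if uv: "u \<in> ?S" "v \<in> ?S" for u v
  proof -
    have "(u, (a, 1)) \<in> ?A\<^sup>*" "(v, (a, 1)) \<in> ?A\<^sup>*" using uv root by (cases u; cases v; blast)+
    then show ?thesis using \<open>sym (?A\<^sup>*)\<close> by (meson rtrancl_trans symD)
  qed
  moreover have "?S \<noteq> {}" using assms by auto
  ultimately show ?thesis unfolding connected_grid_iff[OF S] by blast
qed

text \<open>The first row against the remaining rows. This guarantees that the final selection meets
  at least one candidate.\<close>

lemma splits_exists: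
  assumes "2 \<le> m" "1 \<le> n"
  obtains h where "length h = m * n" "splits m h"
proof -
  let ?U = "{1..1::nat} \<times> {1..n}"
  have c: "verts (grid_graph m n) - ?U = {2..m} \<times> {1..n}" by auto
  have "connected_bipartition (grid_graph m n) ?U"
    unfolding connected_bipartition_def c
    using assms connected_rectangle[of 1 1 m n] connected_rectangle[of 2 m m n] by auto
  moreover obtain h where "length h = m * n" "hset m h = ?U"
    using assms by (auto intro: hset_surj[of m ?U n])
  ultimately show ?thesis
    using connected_bipartition_hset[of m n h] assms that by simp
qed

section \<open>Numerical keys of states\<close>

definition code :: "nat \<Rightarrow> (nat \<Rightarrow> nat) \<Rightarrow> nat" where
  "code m f = (\<Sum>p<m + 2. 2 ^ (2 * m * p + f p))"

text \<open>Weights of colour classes are at most \<open>W\<close>, so the remainder modulo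
  \<open>W + 1\<close> is the weight and the quotient is the code.\<close>

definition key :: "nat \<Rightarrow> (nat \<Rightarrow> nat) \<Rightarrow> nat \<Rightarrow> bool list \<Rightarrow> nat" where
  "key m a W h = hsum m a h + (W + 1) * code m (hfront m h)"

text \<open>The code is the \<open>set_encode\<close> of the set of bit positions, which is
  injective; division by \<open>2 * m\<close> splits a position into block and entry.\<close>

lemma code_inj:
  assumes f: "\<And>p. p < m + 2 \<Longrightarrow> f p < 2 * m" and g: "\<And>p. p < m + 2 \<Longrightarrow> g p < 2 * m"
    and eq: "code m f = code m g" and p: "p < m + 2"
  shows "f p = g p"
proof -
  have dm: "(2 * m * p + x) div (2 * m) = p" "(2 * m * p + x) mod (2 * m) = x" if "x < 2 * m" for p x
    using that by auto
  have inj: "inj_on (\<lambda>p. 2 * m * p + f p) {..<m + 2}" if "\<And>p. p < m + 2 \<Longrightarrow> f p < 2 * m" for f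
    by (rule inj_onI) (metis dm(1) lessThan_iff that)
  have enc: "code m f = set_encode ((\<lambda>p. 2 * m * p + f p) ` {..<m + 2})"
    if "\<And>p. p < m + 2 \<Longrightarrow> f p < 2 * m" for f
    unfolding code_def set_encode_def using inj[OF that] by (subst sum.reindex) auto
  have "(\<lambda>p. 2 * m * p + f p) ` {..<m + 2} = (\<lambda>p. 2 * m * p + g p) ` {..<m + 2}"
    using eq enc[OF f] enc[OF g] by (intro inj_onD[OF inj_on_set_encode]) auto
  then obtain r where r: "r < m + 2" "2 * m * p + f p = 2 * m * r + g r"
    using p by (metis (no_types, lifting) imageE image_eqI lessThan_iff)
  then show ?thesis using dm[of "f p" p] dm[of "g r" r] f[OF p] g[OF r(1)] by metis
qed

lemma key_inj:
  assumes m: "2 \<le> m" and W: "hsum m a h \<le> W" "hsum m a h' \<le> W"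
    and eq: "key m a W h = key m a W h'"
  shows "hsum m a h = hsum m a h'" "\<And>p. p < m + 2 \<Longrightarrow> hfront m h p = hfront m h' p"
proof -
  have *: "key m a W h mod (W + 1) = hsum m a h" "key m a W h div (W + 1) = code m (hfront m h)"
    if "hsum m a h \<le> W" for h
  proof -
    have lt: "hsum m a h < W + 1" using that by simp
    show "key m a W h mod (W + 1) = hsum m a h"
      unfolding key_def mod_mult_self2 using lt by (rule mod_less)
    show "key m a W h div (W + 1) = code m (hfront m h)"
      unfolding key_def using div_mult_self2[of "W + 1" "hsum m a h" "code m (hfront m h)"]
      by (simp only: div_less[OF lt])
  qed
  show "hsum m a h = hsum m a h'" using * W eq by metis
  have "code m (hfront m h) = code m (hfront m h')" using * W eq by metis
  then show "hfront m h p = hfront m h' p" if "p < m + 2" for p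
    using code_inj[of m "hfront m h" "hfront m h'" p] hfront_less[OF m] that by blast
qed

lemma advance_cong:
  assumes "2 \<le> m" "p < m + 2" "\<And>p. p < m + 2 \<Longrightarrow> f p = g p"
  shows "advance m k c f p = advance m k c g p"
proof -
  have e: "f 0 = g 0" "f p = g p" using assms by auto
  show ?thesis
  proof (cases "p < m - 1")
    case True
    then have "f (p + 1) = g (p + 1)" using assms by auto
    then show ?thesis by (simp only: advance_def Let_def True if_True e)
  next
    case False
    then show ?thesis by (simp only: advance_def Let_def False if_False e)
  qed
qed

text \<open>\<open>advance\<close> depends only on the frontier entries, the number of coloured
  cells and the new colour, and the weight grows by the same amount on both sides. This justifies
  keeping one representative per key.\<close>

lemma key_snoc_cong:
  assumes m: "2 \<le> m" and W: "hsum m a h \<le> W" "hsum m a h' \<le> W"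
    and len: "length h = length h'" and eq: "key m a W h = key m a W h'"
  shows "key m a W (h @ [c]) = key m a W (h' @ [c])"
proof -
  note k = key_inj[OF m W eq]
  have "hfront m (h @ [c]) p = hfront m (h' @ [c]) p" if "p < m + 2" for p
    using advance_cong[OF m that k(2)] by (simp add: hfront_snoc[OF m that] len)
  then show ?thesis by (simp add: key_def code_def k(1) len)
qed

lemma card_keys:
  assumes m: "2 \<le> m" and W: "\<And>h. length h = k \<Longrightarrow> hsum m a h \<le> W"
  shows "finite (key m a W ` {h. length h = k})"
    "card (key m a W ` {h. length h = k}) \<le> 9 * 8 ^ m * (W + 1)"
proof -
  let ?R = "range (\<lambda>\<chi>. frontier_list m \<chi> k) \<times> {..W}"
  \<comment> \<open>\<open>?F\<close> rebuilds the key from a frontier list and a weight, so there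
    are at most as many keys as such pairs.\<close>
  let ?F = "\<lambda>(v, x). x + (W + 1) * code m ((!) v)"
  have R: "finite ?R" "card ?R \<le> 9 * 8 ^ m * (W + 1)"
    using card_frontier_lists[OF m, of k] by (auto simp: card_cartesian_product simp del: mult_Suc_right)
  have "key m a W ` {h. length h = k} \<subseteq> ?F ` ?R"
  proof (intro subsetI)
    fix x assume "x \<in> key m a W ` {h. length h = k}"
    then obtain h where h: "x = key m a W h" "length h = k" by auto
    let ?v = "frontier_list m (colouring m h) k"
    have "code m (hfront m h) = code m ((!) ?v)"
      unfolding code_def by (rule sum.cong) (auto simp: hfront_def h)
    then have "x = ?F (?v, hsum m a h)" by (simp add: h key_def)
    moreover have "(?v, hsum m a h) \<in> ?R" using W h by auto
    ultimately show "x \<in> ?F ` ?R" by (rule image_eqI)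
  qed
  then show "finite (key m a W ` {h. length h = k})"
    "card (key m a W ` {h. length h = k}) \<le> 9 * 8 ^ m * (W + 1)"
    using R by (meson finite_imageI finite_subset, meson R card_image_le card_mono finite_imageI le_trans)
qed

section \<open>The program\<close>

definition neq :: "exp \<Rightarrow> exp \<Rightarrow> exp" where
  "neq x y = Plus (Minus x y) (Minus y x)"

lemma eval_neq [simp]: "0 < eval (neq x y) s \<longleftrightarrow> eval x s \<noteq> eval y s"
  by (auto simp: neq_def)

lemma cost_neq [simp]: "cost (neq x y) = 2 * cost x + 2 * cost y + 3"
  by (simp add: neq_def)

abbreviation incr :: "vname \<Rightarrow> com" where
  "incr v \<equiv> Assign v (Plus (Var v) (Num 1))"

abbreviation decr :: "vname \<Rightarrow> com" where
  "decr v \<equiv> Assign v (Minus (Var v) (Num 1))"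

text \<open>The input lists rows, whereas cell numbers run down the columns; hence the stride
  \<open>m\<close>. \<open>VN\<close> is counted up along the way, as no instruction forms the
  product \<open>m * n\<close>.\<close>

definition read_row :: com where
  "read_row = While (Var Vj)
     (Input Vx \<Zsemi> Put Weights (Var Vq) (Var Vx) \<Zsemi> Assign VW (Plus (Var VW) (Var Vx)) \<Zsemi> incr VN \<Zsemi>
      Assign Vq (Plus (Var Vq) (Var Vm)) \<Zsemi> decr Vj)"

definition read_rows :: com where
  "read_rows = While (Var Vi)
     (Assign Vq (Plus (Var Vp) (Var Vm)) \<Zsemi> Assign Vj (Var Vn) \<Zsemi> read_row \<Zsemi> incr Vp \<Zsemi> decr Vi)"

definition read_prog :: com where
  "read_prog = Input Vm \<Zsemi> Input Vn \<Zsemi> Assign Vi (Var Vm) \<Zsemi> read_rows"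

text \<open>The multiples of \<open>W + 1\<close> by powers of two come from repeated doubling. Two
  nested counters stand for the product in the table length
  \<open>(m + 2) * (2 * m)\<close>.\<close>

definition table_block :: com where
  "table_block = While (Var Vj)
     (Put Table (Plus (Var Vq) (Num 1)) (Plus (Elem Table (Var Vq)) (Elem Table (Var Vq))) \<Zsemi>
      incr Vq \<Zsemi> decr Vj)"

definition table_blocks :: com where
  "table_blocks = While (Var Vi) (Assign Vj (Var Vmm) \<Zsemi> table_block \<Zsemi> decr Vi)"

definition table_prog :: com where
  "table_prog = Put Table (Num 0) (Plus (Var VW) (Num 1)) \<Zsemi> Assign Vmm (Plus (Var Vm) (Var Vm)) \<Zsemi>
     Assign Vs (Plus (Var Vm) (Num 2)) \<Zsemi> Assign Vi (Var Vs) \<Zsemi> Assign Vq (Num 0) \<Zsemi> table_blocks"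

definition init_loop :: com where
  "init_loop = While (Var Vi) (Put States (Var Vp) (Var Vp) \<Zsemi> incr Vp \<Zsemi> decr Vi)"

definition init_prog :: com where
  "init_prog = Assign Vp (Num 0) \<Zsemi> Assign Vi (Var Vm) \<Zsemi> init_loop \<Zsemi>
     Assign Vnx (Num 1) \<Zsemi> Assign Vnb (Var Vs)"

definition shift_loop :: com where
  "shift_loop = While (Var Vi)
     (Assign Vv (Elem States (Plus (Var Veb) (Plus (Var Vp) (Num 1)))) \<Zsemi>
      If (neq (Var Vv) (Var Va))
        (If (neq (Var Vv) (Var Vb)) (decr Vv) (Assign Vv (Var Vtop)))
        (Assign Vv (Var Vtop)) \<Zsemi>
      Put States (Plus (Var Vnb) (Var Vp)) (Var Vv) \<Zsemi> incr Vp \<Zsemi> decr Vi)"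

text \<open>The variables \<open>Va\<close> and \<open>Vb\<close> hold the entries of the components that the new cell joins, or
  \<open>2 * m\<close>, which is no entry.\<close>

definition shift_head :: "bool \<Rightarrow> com" where
  "shift_head c =
     Assign Vvx (Elem States (Var Veb)) \<Zsemi>
     Assign Vtop (Minus (if c then Var Vmm else Var Vm) (Num 1)) \<Zsemi>
     Assign Va (Var Vmm) \<Zsemi> Assign Vb (Var Vmm) \<Zsemi>
     If (Var Vr) (Assign Va (Var Vtop)) Skip \<Zsemi>
     If (Minus (Plus (Var Vk) (Num 1)) (Var Vm))
       (If (if c then Minus (Plus (Var Vvx) (Num 1)) (Var Vm) else Minus (Var Vm) (Var Vvx))
         (Assign Vb (Var Vvx)) Skip) Skip \<Zsemi>
     Assign Vp (Num 0) \<Zsemi> Assign Vi (Minus (Var Vm) (Num 1))"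

definition counter :: "bool \<Rightarrow> vname \<Rightarrow> exp" where
  "counter c v = Plus (Var v) (if c then Plus (Var Vm) (Num 1) else Var Vm)"

definition shift_tail :: "bool \<Rightarrow> com" where
  "shift_tail c =
     Put States (Plus (Var Vnb) (Var Vp)) (Var Vtop) \<Zsemi>
     Put States (counter False Vnb) (Elem States (counter False Veb)) \<Zsemi>
     Put States (counter True Vnb) (Elem States (counter True Veb)) \<Zsemi>
     If (Minus (Plus (Var Vk) (Num 1)) (Var Vm))
       (If (neq (Var Vvx) (if c then Num 0 else Var Vm)) Skip
         (If (Minus (Num 2) (Elem States (counter (\<not> c) Veb)))
           (Put States (counter (\<not> c) Vnb) (Plus (Elem States (counter (\<not> c) Veb)) (Num 1)))
           Skip)) Skip"

definition shift :: "bool \<Rightarrow> com" where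
  "shift c = shift_head c \<Zsemi> shift_loop \<Zsemi> shift_tail c"

definition key_loop :: com where
  "key_loop = While (Var Vi)
     (Assign Vkey (Plus (Var Vkey)
        (Elem Table (Plus (Var Vq) (Elem States (Plus (Var Vnb) (Var Vp)))))) \<Zsemi>
      Assign Vq (Plus (Var Vq) (Var Vmm)) \<Zsemi> incr Vp \<Zsemi> decr Vi)"

definition key_prog :: "bool \<Rightarrow> com" where
  "key_prog c =
     Assign Vx (if c then Plus (Elem Sums (Var Ve)) (Var Vwq) else Elem Sums (Var Ve)) \<Zsemi>
     Assign Vkey (Var Vx) \<Zsemi> Assign Vq (Num 0) \<Zsemi> Assign Vp (Num 0) \<Zsemi> Assign Vi (Var Vs) \<Zsemi> key_loop"

text \<open>A mark is 1 plus the queue position of the latest entry with that key, so marks above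
  \<open>Vhi\<close> are exactly those of the layer under construction. Marks of earlier layers thus
  never pass for duplicates and need no erasing.\<close>

definition enqueue :: "bool \<Rightarrow> com" where
  "enqueue c = If (Minus (Elem Seen (Var Vkey)) (Var Vhi)) Skip
     (Put Seen (Var Vkey) (Plus (Var Vnx) (Num 1)) \<Zsemi>
      Put Sums (Var Vnx) (Var Vx) \<Zsemi> Put Parent (Var Vnx) (Var Ve) \<Zsemi>
      Put Choice (Var Vnx) (Num (if c then 1 else 0)) \<Zsemi>
      incr Vnx \<Zsemi> Assign Vnb (Plus (Var Vnb) (Var Vs)))"

text \<open>The successor is written at the free end of the queue before it is known to be new; for
  a duplicate, \<open>Vnb\<close> stays and the next successor overwrites it.\<close>

definition expand :: "bool \<Rightarrow> com" where
  "expand c = shift c \<Zsemi> key_prog c \<Zsemi> enqueue c"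

subsection \<open>Reading the input\<close>

text \<open>Whatever the body does not modify keeps its initial value by the frame condition, so
  \<open>I\<close> has to mention only what the loop changes.\<close>

lemma wp_loop_frame:
  fixes s :: state
  assumes start: "I 0 s"
    and body: "\<And>i s'. i < n \<Longrightarrow> I i s' \<Longrightarrow> frame (While e c) s s' \<Longrightarrow>
      eval e s' > 0 \<and> wp c (\<lambda>s''. I (Suc i) (tick 2 s'')) (tick (cost e + 1) s')"
    and final: "\<And>s'. I n s' \<Longrightarrow> frame (While e c) s s' \<Longrightarrow> eval e s' = 0 \<and> Q (tick (cost e + 3) s')"
  shows "wp (While e c) Q s"
proof (rule wp_loop[where I = "\<lambda>i s'. I i s' \<and> frame (While e c) s s'" and n = n])
  show "I 0 s \<and> frame (While e c) s s" using start by (simp add: frame_def)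
next
  fix i s' assume i: "i < n" and I: "I i s' \<and> frame (While e c) s s'"
  then have b: "eval e s' > 0" "wp c (\<lambda>s''. I (Suc i) (tick 2 s'')) (tick (cost e + 1) s')"
    using body by blast+
  have "wp c (\<lambda>s''. I (Suc i) (tick 2 s'') \<and> frame (While e c) s (tick 2 s'')) (tick (cost e + 1) s')"
    using b(2) by (rule wp_frame) (use I in \<open>auto simp: frame_def\<close>)
  with b(1) show "eval e s' > 0 \<and>
    wp c (\<lambda>s''. I (Suc i) (tick 2 s'') \<and> frame (While e c) s (tick 2 s'')) (tick (cost e + 1) s')" by simp
qed (use final in blast)

lemma sub_pos_iff [simp]: "0 < a - b \<longleftrightarrow> b < (a :: nat)"
  by auto

definition read_upto :: "nat \<Rightarrow> nat \<Rightarrow> (nat \<times> nat \<Rightarrow> nat) \<Rightarrow> nat \<Rightarrow> nat \<Rightarrow> (nat \<Rightarrow> nat) \<Rightarrow> bool" where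
  "read_upto m n w i t A \<longleftrightarrow> (\<forall>i' j'. i' < m \<and> 1 \<le> j' \<and> j' \<le> n \<and> (i' < i \<or> i' = i \<and> j' \<le> t) \<longrightarrow>
     A (j' * m + i') = w (i' + 1, j'))"

lemma mult_add_eq_iff: "(i :: nat) < m \<Longrightarrow> i' < m \<Longrightarrow> j' * m + i' = j * m + i \<longleftrightarrow> j' = j \<and> i' = i"
  by (metis div_mult_self3 add.right_neutral div_less less_nat_zero_code mod_less mod_mult_self3
      gr_zeroI add.commute)

lemma read_upto_Suc:
  assumes "read_upto m n w i t A" "i < m"
  shows "read_upto m n w i (Suc t) (A(m + t * m + i := w (i + 1, Suc t)))"
  unfolding read_upto_def
proof (intro allI impI)
  fix i' j'
  assume a: "i' < m \<and> 1 \<le> j' \<and> j' \<le> n \<and> (i' < i \<or> i' = i \<and> j' \<le> Suc t)"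
  have "j' * m + i' = m + t * m + i \<longleftrightarrow> j' = Suc t \<and> i' = i"
    using mult_add_eq_iff[of i m i' j' "Suc t"] a assms by simp
  then show "(A(m + t * m + i := w (i + 1, Suc t))) (j' * m + i') = w (i' + 1, j')"
    using assms a unfolding read_upto_def by (auto simp: le_Suc_eq)
qed

lemma read_upto_next: "read_upto m n w i n A \<Longrightarrow> read_upto m n w (Suc i) 0 A"
  unfolding read_upto_def by (auto simp: less_Suc_eq)

lemma wp_read_row:
  assumes i: "i < m"
    and pre: "vars s Vm = m" "vars s Vq = m + i" "vars s Vj = n"
      "inp s = map (\<lambda>j. w (i + 1, j)) [1..<n + 1] @ rest"
      "read_upto m n w i 0 (arrs s Weights)" "vars s VW + sum_list (inp s) = W" "vars s VN = N"
    and Q: "\<And>s'. frame read_row s s' \<Longrightarrow> inp s' = rest \<Longrightarrow> read_upto m n w i n (arrs s' Weights) \<Longrightarrow>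
      vars s' VW + sum_list (inp s') = W \<Longrightarrow> vars s' VN = N + n \<Longrightarrow> clk s' \<le> clk s + 60 * n + 10 \<Longrightarrow> Q s'"
  shows "wp read_row Q s"
  unfolding read_row_def
proof (rule wp_loop_frame[where n = n and I = "\<lambda>t s'. vars s' Vq = m + t * m + i \<and> vars s' Vj = n - t \<and>
      inp s' = map (\<lambda>j. w (i + 1, j)) [t + 1..<n + 1] @ rest \<and>
      read_upto m n w i t (arrs s' Weights) \<and> vars s' VW + sum_list (inp s') = W \<and>
      vars s' VN = N + t \<and> clk s' \<le> clk s + 60 * t"], goal_cases)
  case 1
  then show ?case using pre by simp
next
  case (2 t s')
  then have fr: "vars s' Vm = m" using pre by (simp add: frame_def)
  have up: "[t + 1..<n + 1] = (t + 1) # [Suc t + 1..<n + 1]"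
    using 2 by (simp add: upt_conv_Cons del: upt_Suc)
  have inp: "inp s' = w (i + 1, Suc t) # map (\<lambda>j. w (i + 1, j)) [Suc t + 1..<n + 1] @ rest"
    using 2 unfolding up by simp
  show ?case
    using 2 fr inp read_upto_Suc[of m n w i t "arrs s' Weights"] i by (simp add: algebra_simps del: upt_Suc)
next
  case (3 s')
  then have "frame read_row s (tick (cost (Var Vj) + 3) s')" by (simp add: frame_def read_row_def)
  then show ?case using 3 by (auto intro!: Q)
qed

definition rows :: "nat \<Rightarrow> nat \<Rightarrow> (nat \<times> nat \<Rightarrow> nat) \<Rightarrow> nat \<Rightarrow> nat list" where
  "rows m n w i = concat (map (\<lambda>i. map (\<lambda>j. w (i + 1, j)) [1..<n + 1]) [i..<m])"

lemma rows_step: "i < m \<Longrightarrow> rows m n w i = map (\<lambda>j. w (i + 1, j)) [1..<n + 1] @ rows m n w (Suc i)"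
  by (simp add: rows_def upt_conv_Cons del: upt_Suc)

lemma map_grid_nodes: "map w (grid_nodes m n) = rows m n w 0"
proof -
  have "[1..<m + 1] = map Suc [0..<m]" by (simp add: map_Suc_upt del: upt_Suc)
  then show ?thesis
    by (simp add: grid_nodes_def rows_def map_concat comp_def del: upt_Suc)
qed

lemma wp_read_rows:
  assumes pre: "vars s Vm = m" "vars s Vn = n" "vars s Vp = 0" "vars s Vi = m" "inp s = rows m n w 0"
      "vars s VW = 0" "vars s VN = 0"
    and Q: "\<And>s'. frame read_rows s s' \<Longrightarrow> read_upto m n w m 0 (arrs s' Weights) \<Longrightarrow>
      vars s' VW = sum_list (rows m n w 0) \<Longrightarrow> vars s' VN = m * n \<Longrightarrow>
      clk s' \<le> clk s + m * (60 * n + 60) + 10 \<Longrightarrow> Q s'"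
  shows "wp read_rows Q s"
  unfolding read_rows_def
proof (rule wp_loop_frame[where n = m and I = "\<lambda>i s'. vars s' Vp = i \<and> vars s' Vi = m - i \<and>
      inp s' = rows m n w i \<and> read_upto m n w i 0 (arrs s' Weights) \<and>
      vars s' VW + sum_list (inp s') = sum_list (rows m n w 0) \<and> vars s' VN = i * n \<and>
      clk s' \<le> clk s + i * (60 * n + 60)"], goal_cases)
  case 1
  then show ?case using pre by (simp add: read_upto_def)
next
  case (2 i s')
  have fr: "vars s' Vm = m" "vars s' Vn = n"
    using 2(3) pre by (simp_all add: frame_def read_row_def)
  show ?case
    using 2 fr rows_step[of i m n w]
    apply (simp del: upt_Suc)
    apply (rule wp_read_row[where i = i and m = m and n = n and w = w and W = "sum_list (rows m n w 0)"
        and N = "i * n" and rest = "rows m n w (Suc i)"])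
            apply (simp_all add: add.commute del: upt_Suc)
    apply (auto simp: frame_def read_row_def read_upto_next algebra_simps)
    done
next
  case (3 s')
  then have "frame read_rows s (tick (cost (Var Vi) + 3) s')" by (simp add: frame_def read_rows_def)
  then show ?case using 3 by (auto intro!: Q simp: rows_def)
qed

lemma wp_read_prog:
  assumes pre: "inp s = m # n # map w (grid_nodes m n)" "vars s Vp = 0" "vars s VW = 0" "vars s VN = 0"
    and Q: "\<And>s'. frame read_prog s s' \<Longrightarrow> vars s' Vm = m \<Longrightarrow> vars s' Vn = n \<Longrightarrow>
      \<forall>q\<in>{m..<m + m * n}. arrs s' Weights q = w (cell m q) \<Longrightarrow>
      vars s' VW = sum_list (map w (grid_nodes m n)) \<Longrightarrow> vars s' VN = m * n \<Longrightarrow>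
      clk s' \<le> clk s + m * (60 * n + 60) + 20 \<Longrightarrow> Q s'"
  shows "wp read_prog Q s"
proof -
  have all: "\<forall>q\<in>{m..<m + m * n}. A q = w (cell m q)" if "read_upto m n w m 0 A" for A
  proof
    fix q assume q: "q \<in> {m..<m + m * n}"
    then have m: "0 < m" by (cases m) auto
    have "cell m q \<in> {1..m} \<times> {1..n}" using cell_image[OF m, of n] q by blast
    then have "q mod m < m" "1 \<le> q div m" "q div m \<le> n" by (auto simp: cell_def)
    then have "A (q div m * m + q mod m) = w (q mod m + 1, q div m)"
      using that unfolding read_upto_def by blast
    then show "A q = w (cell m q)" by (simp add: cell_def)
  qed
  show ?thesis
    using pre unfolding read_prog_def map_grid_nodes
    apply simp
    apply (rule wp_read_rows[where m = m and n = n and w = w])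
           apply simp_all
    apply (rule Q)
          apply (simp_all add: all map_grid_nodes)
     apply (auto simp: frame_def read_prog_def read_rows_def read_row_def)
    done
qed

subsection \<open>Initialization\<close>

lemma wp_table_block:
  assumes pre: "vars s Vj = l" "vars s Vq = q" "\<forall>x\<le>q. arrs s Table x = B * 2 ^ x"
    and Q: "\<And>s'. frame table_block s s' \<Longrightarrow> vars s' Vq = q + l \<Longrightarrow>
      \<forall>x\<le>q + l. arrs s' Table x = B * 2 ^ x \<Longrightarrow> clk s' \<le> clk s + 60 * l + 10 \<Longrightarrow> Q s'"
  shows "wp table_block Q s"
  unfolding table_block_def
proof (rule wp_loop_frame[where n = l and I = "\<lambda>t s'. vars s' Vq = q + t \<and> vars s' Vj = l - t \<and>
      (\<forall>x\<le>q + t. arrs s' Table x = B * 2 ^ x) \<and> clk s' \<le> clk s + 60 * t"], goal_cases)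
  case 1
  then show ?case using pre by simp
next
  case (2 t s')
  then show ?case by (auto simp: le_Suc_eq)
next
  case (3 s')
  then have "frame table_block s (tick (cost (Var Vj) + 3) s')" by (simp add: frame_def table_block_def)
  then show ?case using 3 by (auto intro!: Q)
qed

lemma wp_table_prog:
  assumes pre: "vars s Vm = m" "vars s VW = W"
    and Q: "\<And>s'. frame table_prog s s' \<Longrightarrow> vars s' Vmm = 2 * m \<Longrightarrow> vars s' Vs = m + 2 \<Longrightarrow>
      \<forall>x<(m + 2) * (2 * m). arrs s' Table x = (W + 1) * 2 ^ x \<Longrightarrow>
      clk s' \<le> clk s + (m + 2) * (120 * m + 60) + 100 \<Longrightarrow> Q s'"
  shows "wp table_prog Q s"
proof -
  have blocks: "wp table_blocks Q s" if pre: "vars s Vi = m + 2" "vars s Vq = 0" "vars s Vmm = 2 * m"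
      "arrs s Table 0 = W + 1"
    and Q: "\<And>s'. frame table_blocks s s' \<Longrightarrow> \<forall>x<(m + 2) * (2 * m). arrs s' Table x = (W + 1) * 2 ^ x \<Longrightarrow>
      clk s' \<le> clk s + (m + 2) * (120 * m + 60) + 10 \<Longrightarrow> Q s'" for Q s
    unfolding table_blocks_def
  proof (rule wp_loop_frame[where n = "m + 2" and I = "\<lambda>i s'. vars s' Vq = i * (2 * m) \<and>
      vars s' Vi = m + 2 - i \<and> (\<forall>x\<le>i * (2 * m). arrs s' Table x = (W + 1) * 2 ^ x) \<and>
      clk s' \<le> clk s + i * (120 * m + 60)"], goal_cases)
    case 1
    then show ?case using pre by simp
  next
    case (2 i s')
    have fr: "vars s' Vmm = 2 * m"
      using 2(3) pre by (simp add: frame_def table_block_def)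
    show ?case
      using 2 fr
      apply simp
      apply (rule wp_table_block[where l = "2 * m" and q = "i * (2 * m)" and B = "W + 1"])
         apply simp_all
      apply (auto simp: frame_def table_block_def algebra_simps)
      done
  next
    case (3 s')
    then have "frame table_blocks s (tick (cost (Var Vi) + 3) s')"
      by (simp add: frame_def table_blocks_def)
    then show ?case using 3 by (auto intro!: that(5) simp del: mult_Suc)
  qed
  show ?thesis
    using pre unfolding table_prog_def
    apply simp
    apply (rule blocks)
        apply simp_all
    apply (rule Q)
        apply (auto simp: frame_def table_prog_def table_blocks_def table_block_def)
    done
qed

lemma wp_init_prog:
  assumes pre: "vars s Vm = m" "vars s Vs = m + 2" "\<forall>x. arrs s States x = 0"
    and Q: "\<And>s'. frame init_prog s s' \<Longrightarrow> vars s' Vnx = 1 \<Longrightarrow> vars s' Vnb = m + 2 \<Longrightarrow>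
      \<forall>x. arrs s' States x = (if x < m then x else 0) \<Longrightarrow>
      clk s' \<le> clk s + 60 * m + 60 \<Longrightarrow> Q s'"
  shows "wp init_prog Q s"
proof -
  have loop: "wp init_loop Q s" if pre: "vars s Vi = m" "vars s Vp = 0" "\<forall>x. arrs s States x = 0"
    and Q: "\<And>s'. frame init_loop s s' \<Longrightarrow> \<forall>x. arrs s' States x = (if x < m then x else 0) \<Longrightarrow>
      clk s' \<le> clk s + 60 * m + 10 \<Longrightarrow> Q s'" for Q s
    unfolding init_loop_def
  proof (rule wp_loop_frame[where n = m and I = "\<lambda>i s'. vars s' Vp = i \<and>
      vars s' Vi = m - i \<and> (\<forall>x. arrs s' States x = (if x < i then x else 0)) \<and>
      clk s' \<le> clk s + 60 * i"], goal_cases)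
    case 1
    then show ?case using pre by simp
  next
    case (2 i s')
    then show ?case by (auto simp: less_Suc_eq)
  next
    case (3 s')
    then have "frame init_loop s (tick (cost (Var Vi) + 3) s')" by (simp add: frame_def init_loop_def)
    then show ?case using 3 by (auto intro!: that(4))
  qed
  show ?thesis
    using pre unfolding init_prog_def
    apply simp
    apply (rule loop)
       apply simp_all
    apply (rule Q)
        apply (auto simp: frame_def init_prog_def init_loop_def)
    done
qed

subsection \<open>Expanding a state\<close>

text \<open>Under truncated subtraction, positivity of \<open>x + 1 - y\<close> expresses
  \<open>y \<le> x\<close>. The colour test needs a single comparison: for \<open>True\<close> the
  upper bound is the assumption \<open>v < 2 * m\<close>, for \<open>False\<close> the lower bound
  is 0.\<close>

lemma wp_shift_head:
  assumes m: "3 \<le> m"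
    and pre: "vars s Vm = m" "vars s Vmm = 2 * m" "vars s Vk = k" "vars s Vr = k mod m"
      "arrs s States (vars s Veb) = v" "v < 2 * m"
    and Q: "\<And>s'. frame (shift_head c) s s' \<Longrightarrow> vars s' Vvx = v \<Longrightarrow>
      vars s' Vtop = m - 1 + (if c then m else 0) \<Longrightarrow>
      vars s' Va = (if k mod m \<noteq> 0 then m - 1 + (if c then m else 0) else 2 * m) \<Longrightarrow>
      vars s' Vb = (if m \<le> k \<and> (if c then m else 0) \<le> v \<and> v < (if c then m else 0) + m then v else 2 * m) \<Longrightarrow>
      vars s' Vp = 0 \<Longrightarrow> vars s' Vi = m - 1 \<Longrightarrow> clk s' \<le> clk s + 120 \<Longrightarrow> Q s'"
  shows "wp (shift_head c) Q s"
proof (rule wp_frame)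
  show "wp (shift_head c) (\<lambda>s'. vars s' Vvx = v \<and>
      vars s' Vtop = m - 1 + (if c then m else 0) \<and>
      vars s' Va = (if k mod m \<noteq> 0 then m - 1 + (if c then m else 0) else 2 * m) \<and>
      vars s' Vb = (if m \<le> k \<and> (if c then m else 0) \<le> v \<and> v < (if c then m else 0) + m then v else 2 * m) \<and>
      vars s' Vp = 0 \<and> vars s' Vi = m - 1 \<and> clk s' \<le> clk s + 120) s"
    using m pre by (cases c) (auto simp: shift_head_def)
qed (use Q in blast)

lemma wp_shift_loop:
  assumes pre: "vars s Vi = l" "vars s Vp = 0" "vars s Veb + l < vars s Vnb" "vars s Vnb = nb"
      "\<And>p. f p = arrs s States (vars s Veb + p)"
    and Q: "\<And>s'. frame shift_loop s s' \<Longrightarrow> vars s' Vp = l \<Longrightarrow>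
      \<forall>p<l. arrs s' States (nb + p) =
        (if f (p + 1) = vars s Va \<or> f (p + 1) = vars s Vb then vars s Vtop else f (p + 1) - 1) \<Longrightarrow>
      \<forall>x<nb. arrs s' States x = arrs s States x \<Longrightarrow> clk s' \<le> clk s + 120 * l + 10 \<Longrightarrow> Q s'"
  shows "wp shift_loop Q s"
  unfolding shift_loop_def
proof (rule wp_loop_frame[where n = l and I = "\<lambda>t s'. vars s' Vi = l - t \<and> vars s' Vp = t \<and>
      (\<forall>p<t. arrs s' States (nb + p) =
        (if f (p + 1) = vars s Va \<or> f (p + 1) = vars s Vb then vars s Vtop else f (p + 1) - 1)) \<and>
      (\<forall>x<nb. arrs s' States x = arrs s States x) \<and> clk s' \<le> clk s + 120 * t"], goal_cases)
  case 1
  then show ?case using pre by simp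
next
  case (2 t s')
  have fr: "vars s' Va = vars s Va" "vars s' Vb = vars s Vb" "vars s' Vtop = vars s Vtop"
    "vars s' Veb = vars s Veb" "vars s' Vnb = nb"
    using 2(3) pre by (simp_all add: frame_def)
  have ft: "arrs s' States (vars s Veb + (t + 1)) = f (t + 1)"
    using 2 pre by simp
  show ?case using 2(1,2) fr ft by (auto simp: less_Suc_eq)
next
  case (3 s')
  then have "frame shift_loop s (tick (cost (Var Vi) + 3) s')" by (simp add: frame_def shift_loop_def)
  then show ?case using 3 by (auto intro!: Q)
qed

lemma wp_shift_tail:
  assumes m: "3 \<le> m"
    and pre: "vars s Vm = m" "vars s Vk = k" "vars s Vp = m - 1" "vars s Vnb = nb" "vars s Veb = eb"
      "eb + m + 2 \<le> nb" "vars s Vvx = v"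
    and f: "arrs s States (eb + m) = f m" "arrs s States (eb + (m + 1)) = f (m + 1)"
    and Q: "\<And>s'. frame (shift_tail c) s s' \<Longrightarrow>
      \<forall>x<nb + (m - 1). arrs s' States x = arrs s States x \<Longrightarrow> arrs s' States (nb + (m - 1)) = vars s Vtop \<Longrightarrow>
      (\<And>p. p = m \<or> p = m + 1 \<Longrightarrow> arrs s' States (nb + p) =
        (if (p = m) = c \<and> m \<le> k \<and> v = (if c then 0 else m) \<and> f p < 2 then f p + 1 else f p)) \<Longrightarrow>
      clk s' \<le> clk s + 200 \<Longrightarrow> Q s'"
  shows "wp (shift_tail c) Q s"
proof -
  let ?u = "\<lambda>p c'. if c' = c \<and> m \<le> k \<and> v = (if c then 0 else m) \<and> f p < 2 then f p + 1 else f p"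
  \<comment> \<open>The five addresses read or written are named so that simplification uses only
    that they are distinct, and not their arithmetic.\<close>
  define A B C E F where d: "A = nb + (m - 1)" "B = nb + m" "C = nb + (m + 1)" "E = eb + m" "F = eb + (m + 1)"
  have ne: "A \<noteq> B" "A \<noteq> C" "B \<noteq> C" "A \<noteq> E" "A \<noteq> F" "B \<noteq> E" "B \<noteq> F" "C \<noteq> E" "C \<noteq> F"
    using m pre by (auto simp: d)
  have lt: "x < A \<Longrightarrow> x \<noteq> A \<and> x \<noteq> B \<and> x \<noteq> C" for x
    using m by (auto simp: d)
  have ev: "vars s Vnb + vars s Vp = A" "vars s Vnb + vars s Vm = B" "vars s Vnb + (vars s Vm + 1) = C"
    "vars s Veb + vars s Vm = E" "vars s Veb + (vars s Vm + 1) = F"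
    "vars s Vm < vars s Vk + 1 \<longleftrightarrow> m \<le> k" "vars s Vvx = v" "v = vars s Vm \<longleftrightarrow> v = m"
    using pre by (auto simp: d)
  have fE: "arrs s States E = f m" "arrs s States F = f (m + 1)"
    using f by (simp_all add: d)
  have "wp (shift_tail c) (\<lambda>s'. (\<forall>x<A. arrs s' States x = arrs s States x) \<and>
      arrs s' States A = vars s Vtop \<and> arrs s' States B = ?u m True \<and>
      arrs s' States C = ?u (m + 1) False \<and> clk s' \<le> clk s + 200) s"
    by (cases c; cases "m \<le> k")
      (simp_all add: shift_tail_def counter_def ev ne ne[symmetric] lt fE del: One_nat_def add_Suc_right add_Suc)
  then show ?thesis
    by (rule wp_frame) (rule Q; auto simp: d)
qed

lemma wp_shift:
  assumes m: "3 \<le> m"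
    and pre: "vars s Vm = m" "vars s Vmm = 2 * m" "vars s Vk = k" "vars s Vr = k mod m"
      "vars s Vnb = nb" "vars s Veb = eb" "eb + m + 2 \<le> nb"
    and f: "\<And>p. p < m + 2 \<Longrightarrow> arrs s States (eb + p) = f p" "\<And>p. p < m + 2 \<Longrightarrow> f p < 2 * m"
    and Q: "\<And>s'. frame (shift c) s s' \<Longrightarrow>
      \<forall>p<m + 2. arrs s' States (nb + p) = advance m k c f p \<Longrightarrow>
      \<forall>x<nb. arrs s' States x = arrs s States x \<Longrightarrow> clk s' \<le> clk s + 120 * m + 400 \<Longrightarrow> Q s'"
  shows "wp (shift c) Q s"
proof (rule wp_frame)
  let ?off = "if c then m else 0"
  have f0: "arrs s States (vars s Veb) = f 0" "f 0 < 2 * m"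
    using f[of 0] pre by simp_all
  show "wp (shift c) (\<lambda>s'. (\<forall>p<m + 2. arrs s' States (nb + p) = advance m k c f p) \<and>
      (\<forall>x<nb. arrs s' States x = arrs s States x) \<and> clk s' \<le> clk s + 120 * m + 400) s"
    unfolding shift_def wp_simps(4)
  proof (rule wp_shift_head[OF m pre(1-4) f0, of c], goal_cases)
    case (1 s1)
    have s1: "vars s1 v = vars s v" if "v \<notin> {Vvx, Vtop, Va, Vb, Vp, Vi}" for v
      using 1(1) that by (simp add: frame_def shift_head_def)
    have s1S: "arrs s1 = arrs s"
      using 1(1) by (auto simp: frame_def shift_head_def)
    show ?case
    proof (rule wp_shift_loop[where l = "m - 1" and nb = nb and f = "\<lambda>p. arrs s States (eb + p)"], goal_cases)
      case (6 s2)
      have s2: "vars s2 v = vars s1 v" if "v \<notin> {Vv, Vp, Vi}" for v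
        using 6(1) that by (simp add: frame_def shift_loop_def)
      have lt: "p < m - 1 \<Longrightarrow> p + 1 < m + 2" for p by simp
      have loop: "arrs s2 States (nb + p) = advance m k c f p" if p: "p < m - 1" for p
      proof -
        have fp: "arrs s States (eb + (p + 1)) = f (p + 1)" "f (p + 1) < 2 * m" "f (p + 1) \<noteq> 2 * m"
          using f[OF lt[OF p]] by simp_all
        have "arrs s2 States (nb + p) = (if f (p + 1) = vars s1 Va \<or> f (p + 1) = vars s1 Vb
            then vars s1 Vtop else f (p + 1) - 1)"
          using 6(3) p fp by simp
        also have "\<dots> = advance m k c f p"
          unfolding 1(3-5) advance_def Let_def using p fp(3) by (simp only: if_True) (auto split: if_split)
        finally show ?thesis .
      qed
      have old: "arrs s2 States (eb + p) = f p" if "p < m + 2" for p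
        using 6(4) pre f(1)[OF that] that by (simp add: s1S)
      have cnt: "arrs s2 States (eb + m) = f m" "arrs s2 States (eb + (m + 1)) = f (m + 1)"
        by (rule old; simp)+
      have vs: "vars s2 Vm = m" "vars s2 Vk = k" "vars s2 Vp = m - 1" "vars s2 Vnb = nb" "vars s2 Veb = eb"
        "vars s2 Vvx = f 0"
        using 1(2) 6(2) pre by (simp_all add: s1 s2)
      show ?case
      proof (rule wp_shift_tail[OF m, where k = k and nb = nb and eb = eb and v = "f 0" and f = f and c = c], goal_cases)
        case (10 s3)
        have "arrs s3 States (nb + p) = advance m k c f p" if p: "p < m + 2" for p
        proof -
          consider "p < m - 1" | "p = m - 1" | "p = m \<or> p = m + 1" using p by linarith
          then show ?thesis
          proof cases
            case 1
            then show ?thesis using 10(2) loop by simp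
          next
            case 2
            then show ?thesis
              using 10(3) s2[of Vtop] \<open>vars s1 Vtop = _\<close> by (simp add: advance_def)
          next
            case 3
            then have "\<not> p < m - 1" "p \<noteq> m - 1" using m by auto
            then show ?thesis
              using 10(4)[OF 3] by (simp only: advance_def Let_def if_False)
          qed
        qed
        moreover have "clk s3 \<le> clk s + 120 * m + 400"
          using 1(8) 6(5) 10(5) by simp
        moreover have "\<forall>x<nb. arrs s3 States x = arrs s States x"
          using 10(2) 6(4) s1S by simp
        ultimately show ?case by blast
      qed (fact vs cnt pre(7))+
    qed (use pre 1 s1 s1S m in auto)
  qed
qed (use Q in blast)

lemma wp_key_prog:
  assumes pre: "vars s Vmm = 2 * m" "vars s Vs = m + 2" "vars s Vnb = nb" "vars s Ve = e"
      "\<forall>x<(m + 2) * (2 * m). arrs s Table x = B * 2 ^ x"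
    and g: "\<And>p. p < m + 2 \<Longrightarrow> arrs s States (nb + p) = g p" "\<And>p. p < m + 2 \<Longrightarrow> g p < 2 * m"
    and Q: "\<And>s'. frame (key_prog c) s s' \<Longrightarrow>
      vars s' Vx = arrs s Sums e + (if c then vars s Vwq else 0) \<Longrightarrow>
      vars s' Vkey = arrs s Sums e + (if c then vars s Vwq else 0) + B * code m g \<Longrightarrow>
      clk s' \<le> clk s + 100 * m + 400 \<Longrightarrow> Q s'"
  shows "wp (key_prog c) Q s"
proof -
  have loop: "wp key_loop Q s" if pre: "vars s Vi = m + 2" "vars s Vp = 0" "vars s Vq = 0" "vars s Vkey = x"
      "vars s Vmm = 2 * m" "vars s Vnb = nb" "\<forall>x<(m + 2) * (2 * m). arrs s Table x = B * 2 ^ x"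
      "\<And>p. p < m + 2 \<Longrightarrow> arrs s States (nb + p) = g p"
    and Q: "\<And>s'. frame key_loop s s' \<Longrightarrow> vars s' Vkey = x + B * code m g \<Longrightarrow>
      clk s' \<le> clk s + 100 * (m + 2) + 10 \<Longrightarrow> Q s'" for Q s x
    unfolding key_loop_def
  proof (rule wp_loop_frame[where n = "m + 2" and I = "\<lambda>i s'. vars s' Vi = m + 2 - i \<and> vars s' Vp = i \<and>
      vars s' Vq = 2 * m * i \<and> vars s' Vkey = x + B * (\<Sum>p<i. 2 ^ (2 * m * p + g p)) \<and>
      clk s' \<le> clk s + 100 * i"], goal_cases)
    case 1
    then show ?case using pre by simp
  next
    case (2 i s')
    have "2 * m * i + g i < 2 * m * Suc i" using g(2)[OF 2(1)] by simp
    also have "\<dots> \<le> 2 * m * (m + 2)" using 2(1) by (intro mult_le_mono2) simp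
    finally have lt: "2 * m * i + g i < (m + 2) * (2 * m)" by (simp only: mult.commute)
    have fr: "vars s' Vmm = 2 * m" "vars s' Vnb = nb" "arrs s' = arrs s"
      using 2(3) pre by (auto simp: frame_def)
    have "arrs s' States (nb + i) = g i" "arrs s' Table (2 * m * i + g i) = B * 2 ^ (2 * m * i + g i)"
      using that(7,8) lt 2(1) fr by auto
    then show ?case using 2(1,2) fr by (simp add: algebra_simps)
  next
    case (3 s')
    then have "frame key_loop s (tick (cost (Var Vi) + 3) s')" by (simp add: frame_def key_loop_def)
    then show ?case using 3 by (auto intro!: that(9) simp: code_def)
  qed
  show ?thesis
    using pre g(1) unfolding key_prog_def
    apply (cases c; simp)
     apply (rule loop; (simp; fail)?)
     apply (rule Q; fastforce simp: frame_def key_prog_def key_loop_def)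
    apply (rule loop; (simp; fail)?)
    apply (rule Q; fastforce simp: frame_def key_prog_def key_loop_def)
    done
qed

subsection \<open>The queue of states\<close>

definition static :: "nat \<Rightarrow> nat \<Rightarrow> (nat \<Rightarrow> nat) \<Rightarrow> nat \<Rightarrow> state \<Rightarrow> bool" where
  "static m n a W s \<longleftrightarrow> vars s Vm = m \<and> vars s Vn = n \<and> vars s VN = m * n \<and> vars s VW = W \<and>
     vars s Vmm = 2 * m \<and> vars s Vs = m + 2 \<and>
     (\<forall>q\<in>{m..<m + m * n}. arrs s Weights q = a q) \<and>
     (\<forall>x<(m + 2) * (2 * m). arrs s Table x = (W + 1) * 2 ^ x)"

text \<open>The list \<open>H\<close> of the histories of the queued states exists only in the proof; the program keeps
  their frontier states, weights, predecessors and last colours.\<close>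

definition entries :: "nat \<Rightarrow> (nat \<Rightarrow> nat) \<Rightarrow> bool list list \<Rightarrow> state \<Rightarrow> bool" where
  "entries m a H s \<longleftrightarrow> (\<forall>e<length H.
     (\<forall>p<m + 2. arrs s States (e * (m + 2) + p) = hfront m (H ! e) p) \<and>
     arrs s Sums e = hsum m a (H ! e) \<and>
     (H ! e \<noteq> [] \<longrightarrow> arrs s Parent e < length H \<and> H ! arrs s Parent e = butlast (H ! e) \<and>
       arrs s Choice e = (if last (H ! e) then 1 else 0)))"

text \<open>The bound on \<open>Seen\<close> ensures that at the start of a layer, when
  \<open>Vhi\<close> becomes the queue length, no mark exceeds \<open>Vhi\<close>.\<close>

definition queue :: "nat \<Rightarrow> nat \<Rightarrow> (nat \<Rightarrow> nat) \<Rightarrow> nat \<Rightarrow> nat \<Rightarrow> bool list list \<Rightarrow> nat \<Rightarrow> state \<Rightarrow> bool" where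
  "queue m n a W k H e s \<longleftrightarrow> static m n a W s \<and> entries m a H s \<and> (\<forall>x. arrs s Seen x \<le> length H) \<and>
     vars s Vnx = length H \<and> vars s Vnb = length H * (m + 2) \<and>
     vars s Ve = e \<and> vars s Veb = e * (m + 2) \<and> vars s Vk = k \<and> vars s Vr = k mod m"

definition seen_new :: "nat \<Rightarrow> (nat \<Rightarrow> nat) \<Rightarrow> nat \<Rightarrow> nat \<Rightarrow> bool list list \<Rightarrow> state \<Rightarrow> bool" where
  "seen_new m a W hi H s \<longleftrightarrow> (\<forall>x. hi < arrs s Seen x \<longleftrightarrow> x \<in> key m a W ` set (drop hi H))"

lemma wp_enqueue:
  assumes q: "queue m n a W k H e s" and e: "e < length H" and hi: "hi \<le> length H" "vars s Vhi = hi"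
    and seen: "seen_new m a W hi H s"
    and h': "h' = H ! e @ [c]"
    and new: "\<And>p. p < m + 2 \<Longrightarrow> arrs s States (length H * (m + 2) + p) = hfront m h' p"
    and x: "vars s Vx = hsum m a h'" "vars s Vkey = key m a W h'"
    and Q: "\<And>s' H'. frame (enqueue c) s s' \<Longrightarrow>
      H' = (if key m a W h' \<in> key m a W ` set (drop hi H) then H else H @ [h']) \<Longrightarrow>
      queue m n a W k H' e s' \<Longrightarrow> seen_new m a W hi H' s' \<Longrightarrow> clk s' \<le> clk s + 200 \<Longrightarrow> Q s'"
  shows "wp (enqueue c) Q s"
proof (rule wp_frame)
  let ?H = "if key m a W h' \<in> key m a W ` set (drop hi H) then H else H @ [h']"
  have v: "vars s Vnx = length H" "vars s Vnb = length H * (m + 2)" "vars s Ve = e" "vars s Vs = m + 2"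
    using q by (auto simp: queue_def static_def)
  have iff: "hi < arrs s Seen (vars s Vkey) \<longleftrightarrow> key m a W h' \<in> key m a W ` set (drop hi H)"
    using seen x by (simp add: seen_new_def)
  show "wp (enqueue c) (\<lambda>s'. queue m n a W k ?H e s' \<and> seen_new m a W hi ?H s' \<and> clk s' \<le> clk s + 200) s"
  proof (cases "key m a W h' \<in> key m a W ` set (drop hi H)")
    case True
    then show ?thesis
      using iff hi q seen
      by (simp add: enqueue_def queue_def static_def entries_def seen_new_def)
  next
    case False
    \<comment> \<open>The resulting state up to the clock, on which neither \<open>queue\<close> nor
      \<open>seen_new\<close> depends.\<close>
    define s' where "s' = s\<lparr>
      vars := (vars s)(Vnx := length H + 1, Vnb := length H * (m + 2) + (m + 2)),
      arrs := (arrs s)(Seen := (arrs s Seen)(key m a W h' := length H + 1),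
        Sums := (arrs s Sums)(length H := hsum m a h'),
        Parent := (arrs s Parent)(length H := e),
        Choice := (arrs s Choice)(length H := if c then 1 else 0))\<rparr>"
    have "entries m a (H @ [h']) s'"
      unfolding entries_def
    proof (intro allI impI)
      fix i assume i: "i < length (H @ [h'])"
      show "(\<forall>p<m + 2. arrs s' States (i * (m + 2) + p) = hfront m ((H @ [h']) ! i) p) \<and>
        arrs s' Sums i = hsum m a ((H @ [h']) ! i) \<and>
        ((H @ [h']) ! i \<noteq> [] \<longrightarrow> arrs s' Parent i < length (H @ [h']) \<and>
          (H @ [h']) ! arrs s' Parent i = butlast ((H @ [h']) ! i) \<and>
          arrs s' Choice i = (if last ((H @ [h']) ! i) then 1 else 0))"
      proof (cases "i = length H")
        case True
        then show ?thesis using new e by (simp add: s'_def nth_append h')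
      next
        case False
        then have "i < length H" using i by simp
        then show ?thesis using q by (auto simp: s'_def nth_append queue_def entries_def)
      qed
    qed
    moreover have "static m n a W s'"
      using q by (simp add: queue_def static_def s'_def)
    moreover have "arrs s' Seen y \<le> length (H @ [h'])" for y
      using q by (simp add: queue_def s'_def le_SucI)
    ultimately have "queue m n a W k (H @ [h']) e s'"
      using q by (simp add: queue_def s'_def)
    moreover have "seen_new m a W hi (H @ [h']) s'"
      using seen hi by (auto simp: seen_new_def s'_def)
    ultimately have s': "queue m n a W k (H @ [h']) e s'" "seen_new m a W hi (H @ [h']) s'" .
    have eq: "queue m n a W k (H @ [h']) e s'' \<longleftrightarrow> queue m n a W k (H @ [h']) e s'"
      "seen_new m a W hi (H @ [h']) s'' \<longleftrightarrow> seen_new m a W hi (H @ [h']) s'"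
      if "vars s'' = vars s'" "arrs s'' = arrs s'" for s'' :: state
      using that by (simp_all add: queue_def static_def entries_def seen_new_def)
    have "wp (enqueue c) (\<lambda>s''. vars s'' = vars s' \<and> arrs s'' = arrs s' \<and> clk s'' \<le> clk s + 200) s"
      using False iff hi v x by (simp add: enqueue_def s'_def)
    then show ?thesis
    proof (rule wp_mono)
      fix s'' :: state assume "vars s'' = vars s' \<and> arrs s'' = arrs s' \<and> clk s'' \<le> clk s + 200"
      then show "queue m n a W k ?H e s'' \<and> seen_new m a W hi ?H s'' \<and> clk s'' \<le> clk s + 200"
        using s' eq[of s''] False by (simp only: if_False)
    qed
  qed
qed (use Q in blast)

lemma wp_expand:
  assumes m: "3 \<le> m"
    and q: "queue m n a W k H e s" and e: "e < length H" and hi: "hi \<le> length H" "vars s Vhi = hi"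
    and seen: "seen_new m a W hi H s" and wq: "vars s Vwq = a (m + k)" and k: "length (H ! e) = k"
    and h': "h' = H ! e @ [c]"
    and Q: "\<And>s' H'. frame (expand c) s s' \<Longrightarrow>
      H' = (if key m a W h' \<in> key m a W ` set (drop hi H) then H else H @ [h']) \<Longrightarrow>
      queue m n a W k H' e s' \<Longrightarrow> seen_new m a W hi H' s' \<Longrightarrow> clk s' \<le> clk s + 220 * m + 1000 \<Longrightarrow> Q s'"
  shows "wp (expand c) Q s"
proof (rule wp_frame)
  let ?H = "if key m a W h' \<in> key m a W ` set (drop hi H) then H else H @ [h']"
  let ?nb = "length H * (m + 2)" and ?eb = "e * (m + 2)"
  have m2: "2 \<le> m" using m by simp
  have v: "vars s Vm = m" "vars s Vmm = 2 * m" "vars s Vk = k" "vars s Vr = k mod m"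
    "vars s Vnb = ?nb" "vars s Veb = ?eb"
    using q by (auto simp: queue_def static_def)
  have "Suc e * (m + 2) \<le> ?nb" using e by (intro mult_le_mono1) simp
  then have le: "?eb + m + 2 \<le> ?nb" by simp
  have f: "arrs s States (?eb + p) = hfront m (H ! e) p" if "p < m + 2" for p
    using q e that by (simp add: queue_def entries_def)
  show "wp (expand c) (\<lambda>s'. queue m n a W k ?H e s' \<and> seen_new m a W hi ?H s' \<and>
      clk s' \<le> clk s + 220 * m + 1000) s"
    unfolding expand_def wp_simps(4)
  proof (rule wp_shift[OF m v le f hfront_less[OF m2], of c], goal_cases)
    case (3 s1)
    have fr1: "vars s1 x = vars s x" if "x \<notin> {Vvx, Vtop, Va, Vb, Vp, Vi, Vv}" for x
      using 3(1) that by (simp add: frame_def shift_def shift_head_def shift_loop_def shift_tail_def)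
    have fa1: "arrs s1 b = arrs s b" if "b \<noteq> States" for b
      using 3(1) that by (simp add: frame_def shift_def shift_head_def shift_loop_def shift_tail_def)
    have st1: "static m n a W s1"
      using q by (auto simp: queue_def static_def fr1 fa1)
    have new1: "arrs s1 States (?nb + p) = hfront m h' p" if "p < m + 2" for p
      using 3(2) that hfront_snoc[OF m2 that, of "H ! e" c] by (simp add: h' k)
    have ent1: "entries m a H s1"
      unfolding entries_def
    proof (intro allI impI)
      fix i assume i: "i < length H"
      have "arrs s1 States (i * (m + 2) + p) = arrs s States (i * (m + 2) + p)" if p: "p < m + 2" for p
      proof -
        \<comment> \<open>Block \<open>i\<close> ends no later than the free end \<open>?nb\<close>,
          so writing the successor does not touch it.\<close>
        have "Suc i * (m + 2) \<le> ?nb" using i by (intro mult_le_mono1) simp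
        then show ?thesis using 3(3) p by simp
      qed
      then show "(\<forall>p<m + 2. arrs s1 States (i * (m + 2) + p) = hfront m (H ! i) p) \<and>
        arrs s1 Sums i = hsum m a (H ! i) \<and>
        (H ! i \<noteq> [] \<longrightarrow> arrs s1 Parent i < length H \<and> H ! arrs s1 Parent i = butlast (H ! i) \<and>
          arrs s1 Choice i = (if last (H ! i) then 1 else 0))"
        using q i by (simp add: fa1 queue_def entries_def)
    qed
    have q1: "queue m n a W k H e s1"
      using q st1 ent1 by (simp add: queue_def fr1 fa1)
    show ?case
    proof (rule wp_key_prog[where m = m and nb = ?nb and e = e and B = "W + 1" and g = "hfront m h'"], goal_cases)
      case (8 s2)
      have fr2: "vars s2 x = vars s1 x" if "x \<notin> {Vx, Vkey, Vq, Vp, Vi}" for x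
        using 8(1) that by (simp add: frame_def key_prog_def key_loop_def)
      have fa2: "arrs s2 = arrs s1"
        using 8(1) by (auto simp: frame_def key_prog_def key_loop_def)
      have q2: "queue m n a W k H e s2"
        using q1 by (simp add: queue_def static_def entries_def fr2 fa2)
      have sums: "arrs s1 Sums e + (if c then vars s1 Vwq else 0) = hsum m a h'"
        using q1 e wq fr1[of Vwq] by (simp add: queue_def entries_def h' k)
      show ?case
      proof (rule wp_enqueue[OF q2 e hi(1) _ _ h'], goal_cases)
        case (6 s3 H')
        then show ?case using 3(4) 8(4) by simp
      qed (use hi seen new1 8 sums fr1 fr2 in \<open>auto simp: seen_new_def fa2 fa1 key_def\<close>)
    qed (use q1 new1 hfront_less[OF m2] in \<open>auto simp: queue_def static_def\<close>)
  qed
qed (use Q in blast)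

subsection \<open>Layers\<close>

definition layer_loop :: com where
  "layer_loop = While (Minus (Var Vhi) (Var Ve))
     (expand False \<Zsemi> expand True \<Zsemi> incr Ve \<Zsemi> Assign Veb (Plus (Var Veb) (Var Vs)))"

definition layer_end :: com where
  "layer_end = incr Vk \<Zsemi> incr Vr \<Zsemi> If (Minus (Var Vm) (Var Vr)) Skip (Assign Vr (Num 0)) \<Zsemi> decr Vcnt"

definition layers :: com where
  "layers = While (Var Vcnt)
     (Assign Vwq (Elem Weights (Plus (Var Vm) (Var Vk))) \<Zsemi> Assign Vhi (Var Vnx) \<Zsemi> layer_loop \<Zsemi>
      layer_end)"

text \<open>A system of representatives of all colourings of the first \<open>k\<close> cells modulo
  equality of keys.\<close>

definition layer :: "nat \<Rightarrow> (nat \<Rightarrow> nat) \<Rightarrow> nat \<Rightarrow> nat \<Rightarrow> bool list list \<Rightarrow> bool" where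
  "layer m a W k C \<longleftrightarrow> set C \<subseteq> {h. length h = k} \<and> distinct (map (key m a W) C) \<and>
     key m a W ` set C = key m a W ` {h. length h = k}"

definition insert_new :: "nat \<Rightarrow> (nat \<Rightarrow> nat) \<Rightarrow> nat \<Rightarrow> bool list list \<Rightarrow> bool list \<Rightarrow> bool list list" where
  "insert_new m a W D h = (if key m a W h \<in> key m a W ` set D then D else D @ [h])"

lemma insert_new:
  "key m a W ` set (insert_new m a W D h) = insert (key m a W h) (key m a W ` set D)"
  "distinct (map (key m a W) D) \<Longrightarrow> distinct (map (key m a W) (insert_new m a W D h))"
  "set (insert_new m a W D h) \<subseteq> insert h (set D)"
  by (auto simp: insert_new_def)

lemma length_layer:
  assumes m: "2 \<le> m" and W: "\<And>h. length h = k \<Longrightarrow> hsum m a h \<le> W" and C: "layer m a W k C"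
  shows "length C \<le> 9 * 8 ^ m * (W + 1)"
proof -
  have "length C = card (key m a W ` set C)"
    using C distinct_card[of "map (key m a W) C"] by (simp add: layer_def)
  then show ?thesis using card_keys(2)[OF m W] C by (simp add: layer_def)
qed

lemma mod_vars_expand:
  "mod_vars (expand c) = {Vvx, Vtop, Va, Vb, Vp, Vi, Vv, Vx, Vkey, Vq, Vnx, Vnb}"
  "mod_arrs (expand c) = {States, Seen, Sums, Parent, Choice}" "no_out (expand c)"
  by (auto simp: expand_def shift_def shift_head_def shift_loop_def shift_tail_def key_prog_def
      key_loop_def enqueue_def)

lemma queue_clk [simp]:
  "queue m n a W k H e (tick t s) = queue m n a W k H e s"
  "seen_new m a W hi H (tick t s) = seen_new m a W hi H s"
  by (simp_all add: queue_def static_def entries_def seen_new_def)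

text \<open>The queue consists of the older layers \<open>P\<close>, the layer \<open>C\<close>
  being expanded and the layer \<open>D\<close> being built; \<open>P\<close> stays because its
  parent links are followed for the output. An entry costs two expansions of
  \<open>220 * m + 1000\<close> and at most 100 for the loop itself.\<close>

lemma wp_layer_loop:
  assumes m: "3 \<le> m" and W: "\<And>h. length h \<le> k + 1 \<Longrightarrow> hsum m a h \<le> W" and C: "layer m a W k C"
    and q: "queue m n a W k (P @ C) (length P) s" and hi: "vars s Vhi = length (P @ C)"
    and wq: "vars s Vwq = a (m + k)"
    and Q: "\<And>s' D. frame layer_loop s s' \<Longrightarrow> queue m n a W k (P @ C @ D) (length (P @ C)) s' \<Longrightarrow>
      layer m a W (k + 1) D \<Longrightarrow> clk s' \<le> clk s + length C * (440 * m + 2100) + 20 \<Longrightarrow> Q s'"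
  shows "wp layer_loop Q s"
  unfolding layer_loop_def
proof (rule wp_loop_frame[where n = "length C" and I = "\<lambda>i s'. \<exists>D.
      queue m n a W k (P @ C @ D) (length P + i) s' \<and>
      seen_new m a W (length (P @ C)) (P @ C @ D) s' \<and>
      set D \<subseteq> {h. length h = k + 1} \<and> distinct (map (key m a W) D) \<and>
      key m a W ` set D = key m a W ` (\<Union>h\<in>set (take i C). {h @ [False], h @ [True]}) \<and>
      clk s' \<le> clk s + i * (440 * m + 2100)"], goal_cases)
  case 1
  have "queue m n a W k (P @ C @ []) (length P + 0) s" using q by simp
  moreover have "seen_new m a W (length (P @ C)) (P @ C @ []) s"
    using q by (auto simp: seen_new_def queue_def not_less)
  ultimately show ?case by (intro exI[of _ "[]"]) simp
next
  case (2 i s')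
  then obtain D where D: "queue m n a W k (P @ C @ D) (length P + i) s'"
      "seen_new m a W (length (P @ C)) (P @ C @ D) s'" "set D \<subseteq> {h. length h = k + 1}"
      "distinct (map (key m a W) D)"
      "key m a W ` set D = key m a W ` (\<Union>h\<in>set (take i C). {h @ [False], h @ [True]})"
      "clk s' \<le> clk s + i * (440 * m + 2100)" by auto
  have fr: "vars s' Vhi = length (P @ C)" "vars s' Vwq = a (m + k)"
    using 2(3) hi wq by (simp_all add: frame_def mod_vars_expand)
  let ?h = "C ! i"
  have nth: "(P @ C @ E) ! (length P + i) = ?h" for E using 2(1) by (simp add: nth_append)
  have len: "length ?h = k" using C nth_mem[OF 2(1)] unfolding layer_def by blast
  let ?D1 = "insert_new m a W D (?h @ [False])"
  let ?D2 = "insert_new m a W ?D1 (?h @ [True])"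
  have "wp (expand False \<Zsemi> expand True \<Zsemi> incr Ve \<Zsemi> Assign Veb (Plus (Var Veb) (Var Vs)))
     (\<lambda>s''. queue m n a W k (P @ C @ ?D2) (length P + Suc i) (tick 2 s'') \<and>
      seen_new m a W (length (P @ C)) (P @ C @ ?D2) (tick 2 s'') \<and>
      clk (tick 2 s'') \<le> clk s + Suc i * (440 * m + 2100)) (tick (cost (Minus (Var Vhi) (Var Ve)) + 1) s')"
    unfolding wp_simps(4)
  proof (rule wp_expand[OF m, where k = k and n = n and a = a and W = W and H = "P @ C @ D" and e = "length P + i" and hi = "length (P @ C)"
        and h' = "?h @ [False]"], goal_cases)
    case (9 s1 H1)
    have fr1: "vars s1 Vhi = length (P @ C)" "vars s1 Vwq = a (m + k)"
      using 9(1) fr by (simp_all add: frame_def mod_vars_expand)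
    have H1: "H1 = P @ C @ ?D1" using 9(2) by (simp add: insert_new_def)
    show ?case
    proof (rule wp_expand[OF m, where k = k and n = n and a = a and W = W and H = H1 and e = "length P + i" and hi = "length (P @ C)"
        and h' = "?h @ [True]"], goal_cases)
      case (9 s2 H2)
      have H2: "H2 = P @ C @ ?D2" using 9(2) H1 by (simp add: insert_new_def)
      have v: "vars s2 Veb = (length P + i) * (m + 2)" "vars s2 Ve = length P + i" "vars s2 Vs = m + 2"
        using 9(3) by (auto simp: queue_def static_def)
      have "clk s2 \<le> clk s' + 6 + (220 * m + 1000) + (220 * m + 1000)"
        using 9(5) \<open>clk s1 \<le> _\<close> by simp
      then have clk: "clk s2 + 16 \<le> clk s + Suc i * (440 * m + 2100)"
        using D(6) by simp
      have upd: "queue m n a W k (P @ C @ ?D2) (length P + Suc i) x"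
        "seen_new m a W (length (P @ C)) (P @ C @ ?D2) x"
        if "vars x Ve = length P + Suc i" "vars x Veb = (length P + Suc i) * (m + 2)"
          "\<And>v. v \<noteq> Ve \<Longrightarrow> v \<noteq> Veb \<Longrightarrow> vars x v = vars s2 v" "arrs x = arrs s2" for x
        using 9(3,4) that unfolding H2 by (simp_all add: queue_def static_def entries_def seen_new_def)
      show ?case
        unfolding wp_simps by (intro conjI upd) (use clk v in \<open>simp_all add: algebra_simps\<close>)
    qed (use 9 fr1 H1 2(1) nth len in auto)
  qed (use D fr 2(1) nth len in auto)
  then show ?case
  proof (intro conjI, goal_cases)
    case 1
    show ?case using D(1) fr 2(1) by (simp add: queue_def)
  next
    case 2
    note loop = this
    have t: "set (take (Suc i) C) = insert ?h (set (take i C))"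
      using \<open>i < length C\<close> by (simp add: take_Suc_conv_app_nth)
    have k: "key m a W ` set ?D2 = key m a W ` (\<Union>h\<in>set (take (Suc i) C). {h @ [False], h @ [True]})"
      unfolding insert_new(1) D(5) t by auto
    have l: "set ?D2 \<subseteq> {h. length h = k + 1}"
    proof -
      have "set ?D2 \<subseteq> insert (?h @ [True]) (insert (?h @ [False]) (set D))"
        using insert_new(3)[of m a W ?D1 "?h @ [True]"] insert_new(3)[of m a W D "?h @ [False]"] by blast
      also have "\<dots> \<subseteq> {h. length h = k + 1}" using D(3) len by simp
      finally show ?thesis .
    qed
    have d: "distinct (map (key m a W) ?D2)" by (intro insert_new(2) D(4))
    show ?case
      by (rule wp_mono[OF loop], rule exI[of _ ?D2]) (use k l d in blast)
  qed
next
  case (3 s')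
  then obtain D where D: "queue m n a W k (P @ C @ D) (length P + length C) s'"
      "set D \<subseteq> {h. length h = k + 1}" "distinct (map (key m a W) D)"
      "key m a W ` set D = key m a W ` (\<Union>h\<in>set C. {h @ [False], h @ [True]})"
      "clk s' \<le> clk s + length C * (440 * m + 2100)" by auto
  have fr: "vars s' Vhi = length (P @ C)"
    using 3(2) hi by (simp add: frame_def mod_vars_expand)
  \<comment> \<open>A colouring of \<open>k + 1\<close> cells need not extend a stored one, but its
    prefix has a stored representative with the same key, and appending the last colour to both
    preserves this.\<close>
  have "key m a W ` {h. length h = k + 1} \<subseteq> key m a W ` set D"
  proof
    fix x assume "x \<in> key m a W ` {h. length h = k + 1}"
    then obtain h where h: "x = key m a W h" "length h = Suc k" by auto
    then obtain g c where g: "h = g @ [c]" "length g = k" by (metis length_Suc_conv_rev)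
    then have "key m a W g \<in> key m a W ` set C" using C by (auto simp: layer_def)
    then obtain g' where g': "g' \<in> set C" "key m a W g = key m a W g'" by auto
    then have "length g' = k" using C by (auto simp: layer_def)
    then have "key m a W (g @ [c]) = key m a W (g' @ [c])"
      using g g' m W by (intro key_snoc_cong) auto
    then have "x = key m a W (g' @ [c])" using h g by simp
    moreover have "g' @ [c] \<in> (\<Union>h\<in>set C. {h @ [False], h @ [True]})"
      using g'(1) by (cases c) auto
    ultimately show "x \<in> key m a W ` set D" unfolding D(4) by blast
  qed
  then have "layer m a W (k + 1) D" using D(2,3) by (auto simp: layer_def)
  moreover have "frame layer_loop s (tick (cost (Minus (Var Vhi) (Var Ve)) + 3) s')"
    using 3(2) by (simp add: frame_def layer_loop_def)
  moreover have "eval (Minus (Var Vhi) (Var Ve)) s' = 0" using D(1) fr by (simp add: queue_def)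
  ultimately show ?case using D(1,5) by (auto intro!: Q)
qed

lemma wp_layers:
  assumes m: "3 \<le> m" and W: "\<And>h. length h \<le> m * n \<Longrightarrow> hsum m a h \<le> W"
    and q: "queue m n a W 0 [[]] 0 s" and cnt: "vars s Vcnt = m * n"
    and Q: "\<And>s' P C. frame layers s s' \<Longrightarrow> queue m n a W (m * n) (P @ C) (length P) s' \<Longrightarrow>
      layer m a W (m * n) C \<Longrightarrow>
      clk s' \<le> clk s + m * n * (9 * 8 ^ m * (W + 1) * (440 * m + 2100) + 200) + 10 \<Longrightarrow> Q s'"
  shows "wp layers Q s"
proof -
  define K where "K = 9 * 8 ^ m * (W + 1) * (440 * m + 2100)"
  have m2: "2 \<le> m" using m by simp
  show ?thesis
    unfolding layers_def
  proof (rule wp_loop_frame[where n = "m * n" and I = "\<lambda>k s'. \<exists>P C.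
        queue m n a W k (P @ C) (length P) s' \<and> layer m a W k C \<and> vars s' Vcnt = m * n - k \<and>
        clk s' \<le> clk s + k * (K + 200)"], goal_cases)
    case 1
    have "queue m n a W 0 ([] @ [[]]) (length ([] :: bool list list)) s" using q by simp
    moreover have "layer m a W 0 [[]]" by (simp add: layer_def)
    ultimately show ?case using cnt by (intro exI[of _ "[]"] exI[of _ "[[]]"]) simp
  next
    case (2 k s')
    then obtain P C where D: "queue m n a W k (P @ C) (length P) s'" "layer m a W k C"
        "vars s' Vcnt = m * n - k" "clk s' \<le> clk s + k * (K + 200)" by auto
    have W': "hsum m a h \<le> W" if "length h \<le> k + 1" for h
      using W that 2(1) by simp
    have K: "length C * (440 * m + 2100) \<le> K"
      unfolding K_def using length_layer[OF m2 W' D(2)] by (intro mult_le_mono1) simp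
    have wk: "arrs s' Weights (m + k) = a (m + k)" "vars s' Vm = m" "vars s' Vk = k"
        "vars s' Vnx = length (P @ C)" "vars s' Vr = k mod m"
      using D(1) 2(1) by (auto simp: queue_def static_def)
    have loop: "wp layer_loop (wp layer_end (\<lambda>s''. \<exists>P C. queue m n a W (Suc k) (P @ C) (length P) (tick 2 s'') \<and>
          layer m a W (Suc k) C \<and> vars (tick 2 s'') Vcnt = m * n - Suc k \<and>
          clk (tick 2 s'') \<le> clk s + Suc k * (K + 200))) s1"
      if s1: "vars s1 Vhi = length (P @ C)" "vars s1 Vwq = a (m + k)" "arrs s1 = arrs s'"
        "\<And>v. v \<noteq> Vhi \<Longrightarrow> v \<noteq> Vwq \<Longrightarrow> vars s1 v = vars s' v" "clk s1 \<le> clk s' + 30" for s1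
    proof (rule wp_layer_loop[OF m W' D(2), where n = n and P = P], goal_cases)
      case 2
      show ?case using D(1) s1 by (simp add: queue_def static_def entries_def)
    next
      case (5 s2 D')
      have v: "vars s2 Vm = m" "vars s2 Vk = k" "vars s2 Vr = k mod m" "vars s2 Vcnt = m * n - k"
        using 5(2) wk D(3) 5(1) s1 by (auto simp: queue_def static_def frame_def layer_loop_def mod_vars_expand)
      have clk: "clk s2 + 100 \<le> clk s + Suc k * (K + 200)"
        using 5(4) K D(4) s1(5) by simp
      \<comment> \<open>\<open>Vr\<close> follows the remainder by counting up and resetting at
        \<open>m\<close>.\<close>
      have r: "Suc k mod m = (if Suc (k mod m) < m then Suc (k mod m) else 0)"
      proof -
        have "k mod m < m" using m by simp
        then show ?thesis by (auto simp: mod_Suc)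
      qed
      have upd: "queue m n a W (Suc k) ((P @ C) @ D') (length (P @ C)) x"
        if "vars x Vk = Suc k" "vars x Vr = Suc k mod m" "arrs x = arrs s2"
          "\<And>v. v \<noteq> Vk \<Longrightarrow> v \<noteq> Vr \<Longrightarrow> v \<noteq> Vcnt \<Longrightarrow> vars x v = vars s2 v" for x
        using 5(2) that by (simp add: queue_def static_def entries_def)
      show ?case
      proof (cases "Suc (k mod m) < m")
        case True
        then show ?thesis using v clk 5(3) r unfolding layer_end_def
          by simp (intro exI[of _ "P @ C"] exI[of _ D'] conjI upd; simp)
      next
        case False
        then show ?thesis using v clk 5(3) r unfolding layer_end_def
          by simp (intro exI[of _ "P @ C"] exI[of _ D'] conjI upd; simp)
      qed
    qed (use s1 in auto)
    show ?case
    proof (rule conjI, goal_cases)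
      case 1
      show ?case using 2(1) D(3) by simp
    next
      case 2
      show ?case unfolding wp_simps by (rule loop) (use wk in simp_all)
    qed
  next
    case (3 s')
    then obtain P C where D: "queue m n a W (m * n) (P @ C) (length P) s'" "layer m a W (m * n) C"
        "vars s' Vcnt = 0" "clk s' \<le> clk s + m * n * (K + 200)" by auto
    then show ?case
      using 3(2) unfolding K_def by (auto intro!: Q simp: frame_def layers_def)
  qed
qed

subsection \<open>Selecting an optimal state\<close>

text \<open>\<open>Vq\<close> stays \<open>m\<close> ahead of \<open>Vp\<close>: a cell is its own
  label if its entry is its position, shifted by \<open>m\<close> for colour \<open>True\<close>.
  Started with the counters of closed components, the loop yields \<open>frontier_tops\<close> for
  both colours.\<close>

definition count_loop :: com where
  "count_loop = While (Var Vi)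
     (Assign Vv (Elem States (Plus (Var Veb) (Var Vp))) \<Zsemi>
      If (neq (Var Vv) (Var Vp)) Skip (incr Vc0) \<Zsemi>
      If (neq (Var Vv) (Var Vq)) Skip (incr Vc1) \<Zsemi> incr Vp \<Zsemi> incr Vq \<Zsemi> decr Vi)"

definition select_head :: com where
  "select_head = Assign Vc0 (Elem States (counter False Veb)) \<Zsemi> Assign Vc1 (Elem States (counter True Veb)) \<Zsemi>
     Assign Vp (Num 0) \<Zsemi> Assign Vq (Var Vm) \<Zsemi> Assign Vi (Var Vm)"

text \<open>The comparison with \<open>Vbv\<close> is not strict: \<open>Vbv\<close> starts at 0,
  and the first qualifying entry must be accepted even if its balance is 0.\<close>

definition select_tail :: com where
  "select_tail = Assign Vx (Elem Sums (Var Ve)) \<Zsemi> Assign Vy (Minus (Var VW) (Var Vx)) \<Zsemi>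
     If (Minus (Var Vy) (Var Vx)) (Assign Vy (Var Vx)) Skip \<Zsemi>
     If (Plus (neq (Var Vc0) (Num 1)) (neq (Var Vc1) (Num 1))) Skip
       (If (Minus (Plus (Var Vy) (Num 1)) (Var Vbv)) (Assign Vbv (Var Vy) \<Zsemi> Assign Vbe (Var Ve)) Skip) \<Zsemi>
     incr Ve \<Zsemi> Assign Veb (Plus (Var Veb) (Var Vs))"

definition select_loop :: com where
  "select_loop = While (Minus (Var Vnx) (Var Ve)) (select_head \<Zsemi> count_loop \<Zsemi> select_tail)"

definition balance :: "nat \<Rightarrow> (nat \<Rightarrow> nat) \<Rightarrow> nat \<Rightarrow> bool list \<Rightarrow> nat" where
  "balance m a W h = min (hsum m a h) (W - hsum m a h)"

lemma card_less_Suc: "card {p. p < Suc i \<and> R p} = card {p. p < i \<and> R p} + (if R i then 1 else 0)"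
proof -
  have "{p. p < Suc i \<and> R p} = (if R i then insert i {p. p < i \<and> R p} else {p. p < i \<and> R p})"
    by (auto simp: less_Suc_eq)
  then show ?thesis by simp
qed

lemma wp_count_loop:
  assumes pre: "vars s Vi = m" "vars s Vp = 0" "vars s Vq = m" "vars s Veb = eb"
      "\<And>p. p < m \<Longrightarrow> arrs s States (eb + p) = f p"
    and Q: "\<And>s'. frame count_loop s s' \<Longrightarrow> vars s' Vc0 = vars s Vc0 + card {p. p < m \<and> f p = p} \<Longrightarrow>
      vars s' Vc1 = vars s Vc1 + card {p. p < m \<and> f p = p + m} \<Longrightarrow> clk s' \<le> clk s + 150 * m + 10 \<Longrightarrow> Q s'"
  shows "wp count_loop Q s"
  unfolding count_loop_def
proof (rule wp_loop_frame[where n = m and I = "\<lambda>i s'. vars s' Vi = m - i \<and> vars s' Vp = i \<and>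
      vars s' Vq = m + i \<and> vars s' Vc0 = vars s Vc0 + card {p. p < i \<and> f p = p} \<and>
      vars s' Vc1 = vars s Vc1 + card {p. p < i \<and> f p = p + m} \<and> clk s' \<le> clk s + 150 * i"], goal_cases)
  case 1
  then show ?case using pre by simp
next
  case (2 i s')
  have fr: "vars s' Veb = eb" "arrs s' = arrs s"
    using 2(3) pre by (auto simp: frame_def)
  have "arrs s' States (eb + i) = f i" using pre(5)[OF 2(1)] fr by simp
  then show ?case using 2(1,2) fr by (simp add: card_less_Suc[of i] add.commute[of m])
next
  case (3 s')
  then have "frame count_loop s (tick (cost (Var Vi) + 3) s')" by (simp add: frame_def count_loop_def)
  then show ?case using 3 by (auto intro!: Q)
qed

definition best :: "nat \<Rightarrow> (nat \<Rightarrow> nat) \<Rightarrow> nat \<Rightarrow> nat \<Rightarrow> bool list list \<Rightarrow> nat \<Rightarrow> nat \<Rightarrow> nat \<Rightarrow> bool" where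
  "best m a W l C i bv be \<longleftrightarrow> (\<forall>j<i. splits m (C ! j) \<longrightarrow> balance m a W (C ! j) \<le> bv) \<and>
     ((\<exists>j<i. be = l + j \<and> splits m (C ! j) \<and> bv = balance m a W (C ! j)) \<or>
      bv = 0 \<and> (\<forall>j<i. \<not> splits m (C ! j)))"

lemma best_Suc:
  assumes "best m a W l C i bv be"
  shows "splits m (C ! i) \<Longrightarrow> bv \<le> balance m a W (C ! i) \<Longrightarrow>
      best m a W l C (Suc i) (balance m a W (C ! i)) (l + i)"
    and "\<not> (splits m (C ! i) \<and> bv \<le> balance m a W (C ! i)) \<Longrightarrow> best m a W l C (Suc i) bv be"
  using assms unfolding best_def less_Suc_eq by (fastforce, fastforce)

lemma wp_select_tail:
  assumes pre: "vars s Ve = e" "vars s Veb = e * (m + 2)" "vars s Vs = m + 2" "vars s VW = W"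
      "arrs s Sums e = x"
  defines "upd \<equiv> vars s Vc0 = 1 \<and> vars s Vc1 = 1 \<and> vars s Vbv \<le> min x (W - x)"
  assumes Q: "\<And>s'. (\<And>v. v \<notin> {Vx, Vy, Vbv, Vbe, Ve, Veb} \<Longrightarrow> vars s' v = vars s v) \<Longrightarrow> arrs s' = arrs s \<Longrightarrow>
      vars s' Ve = Suc e \<Longrightarrow> vars s' Veb = Suc e * (m + 2) \<Longrightarrow>
      vars s' Vbv = (if upd then min x (W - x) else vars s Vbv) \<Longrightarrow>
      vars s' Vbe = (if upd then e else vars s Vbe) \<Longrightarrow> clk s' \<le> clk s + 150 \<Longrightarrow> Q s'"
  shows "wp select_tail Q s"
proof -
  have "wp select_tail (\<lambda>s'. (\<forall>v. v \<notin> {Vx, Vy, Vbv, Vbe, Ve, Veb} \<longrightarrow> vars s' v = vars s v) \<and> arrs s' = arrs s \<and>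
      vars s' Ve = Suc e \<and> vars s' Veb = Suc e * (m + 2) \<and>
      vars s' Vbv = (if upd then min x (W - x) else vars s Vbv) \<and>
      vars s' Vbe = (if upd then e else vars s Vbe) \<and> clk s' \<le> clk s + 150) s"
  proof (cases "x < W - x")
    case True
    then have "min x (W - x) = x" "x + x < W" by linarith+
    then show ?thesis
      using pre True unfolding upd_def select_tail_def
      by (cases "vars s Vc0 = 1"; cases "vars s Vc1 = 1") (simp_all add: less_Suc_eq_le)
  next
    case False
    then have "min x (W - x) = W - x" "\<not> x + x < W" by linarith+
    then show ?thesis
      using pre False unfolding upd_def select_tail_def
      by (cases "vars s Vc0 = 1"; cases "vars s Vc1 = 1") (simp_all add: less_Suc_eq_le)
  qed
  then show ?thesis by (rule wp_mono) (rule Q; simp)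
qed

lemma wp_select_loop:
  assumes q: "queue m n a W k (P @ C) (length P) s" and bv: "vars s Vbv = 0"
    and Q: "\<And>s'. frame select_loop s s' \<Longrightarrow> queue m n a W k (P @ C) (length (P @ C)) s' \<Longrightarrow>
      best m a W (length P) C (length C) (vars s' Vbv) (vars s' Vbe) \<Longrightarrow>
      clk s' \<le> clk s + length C * (150 * m + 400) + 20 \<Longrightarrow> Q s'"
  shows "wp select_loop Q s"
  unfolding select_loop_def
proof (rule wp_loop_frame[where n = "length C" and I = "\<lambda>i s'. queue m n a W k (P @ C) (length P + i) s' \<and>
      best m a W (length P) C i (vars s' Vbv) (vars s' Vbe) \<and> clk s' \<le> clk s + i * (150 * m + 400)"], goal_cases)
  case 1
  then show ?case using q bv by (simp add: best_def)
next
  case (2 i s')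
  let ?h = "C ! i" and ?e = "length P + i"
  have v: "vars s' Vm = m" "vars s' Vnx = length (P @ C)" "vars s' Ve = ?e" "vars s' Veb = ?e * (m + 2)"
    "vars s' Vs = m + 2" "vars s' VW = W"
    using 2(2) by (auto simp: queue_def static_def)
  have st: "arrs s' States (?e * (m + 2) + p) = hfront m ?h p" if "p < m + 2" for p
    using 2(1,2) that by (simp add: queue_def entries_def nth_append)
  have cnt: "arrs s' States (?e * (m + 2) + m) = hfront m ?h m"
      "arrs s' States (?e * (m + 2) + (m + 1)) = hfront m ?h (m + 1)"
    by (rule st; simp)+
  have sum: "arrs s' Sums ?e = hsum m a ?h"
    using 2(1,2) by (simp add: queue_def entries_def nth_append)
  have body: "wp count_loop (wp select_tail (\<lambda>x. queue m n a W k (P @ C) (length P + Suc i) (tick 2 x) \<and>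
      best m a W (length P) C (Suc i) (vars (tick 2 x) Vbv) (vars (tick 2 x) Vbe) \<and>
      clk (tick 2 x) \<le> clk s + Suc i * (150 * m + 400))) s1"
    if s1: "vars s1 Vc0 = hfront m ?h m" "vars s1 Vc1 = hfront m ?h (m + 1)" "vars s1 Vi = m" "vars s1 Vp = 0"
      "vars s1 Vq = m" "arrs s1 = arrs s'" "clk s1 \<le> clk s' + 100"
      "\<And>x. x \<notin> {Vc0, Vc1, Vp, Vq, Vi} \<Longrightarrow> vars s1 x = vars s' x" for s1
  proof (rule wp_count_loop[where m = m and eb = "?e * (m + 2)" and f = "hfront m ?h"], goal_cases)
    case (6 s2)
    have fr: "vars s2 x = vars s' x" if "x \<notin> {Vc0, Vc1, Vp, Vq, Vi, Vv}" for x
      using 6(1) s1(8) that by (simp add: frame_def count_loop_def)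
    have fa: "arrs s2 = arrs s'"
      using 6(1) s1(6) by (auto simp: frame_def count_loop_def)
    have sp: "splits m ?h \<longleftrightarrow> vars s2 Vc0 = 1 \<and> vars s2 Vc1 = 1"
      unfolding 6(2,3) s1(1,2) splits_def frontier_tops_def by (auto simp: all_bool_eq)
    show ?case
    proof (rule wp_select_tail[where e = ?e and m = m and W = W and x = "hsum m a ?h"], goal_cases)
      case (6 s3)
      have "queue m n a W k (P @ C) (length P + Suc i) (tick 2 s3)"
        using 2(2) 6(1-4) fr fa by (simp add: queue_def static_def entries_def)
      moreover have "best m a W (length P) C (Suc i) (vars s3 Vbv) (vars s3 Vbe)"
        using best_Suc[of m a W "length P" C i "vars s2 Vbv" "vars s2 Vbe"] 2(2) 6(5,6) fr sp
        by (auto simp: balance_def)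
      moreover have "clk s3 + 2 \<le> clk s + Suc i * (150 * m + 400)"
        using 2(2) 6(7) \<open>clk s2 \<le> _\<close> s1(7) by simp
      ultimately show ?case by simp
    qed (use v fr fa sum in auto)
  qed (use s1 v st in auto)
  show ?case
  proof (rule conjI, goal_cases)
    case 1
    show ?case using v 2(1) by simp
  next
    case 2
    show ?case
      unfolding wp_simps select_head_def
      by (rule body) (use v cnt in \<open>simp_all add: counter_def\<close>)
  qed
next
  case (3 s')
  then have "eval (Minus (Var Vnx) (Var Ve)) s' = 0" by (simp add: queue_def)
  moreover have "frame select_loop s (tick (cost (Minus (Var Vnx) (Var Ve)) + 3) s')"
    using 3 by (simp add: frame_def select_loop_def)
  ultimately show ?case using 3(1) by (auto intro!: Q)
qed

subsection \<open>Writing the output\<close>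

text \<open>Parent links lead from the last cell to the first, so \<open>Output\<close> is filled
  from its end, indexed by cell numbers; printing restores row order with stride
  \<open>m\<close>.\<close>

definition back_loop :: com where
  "back_loop = While (Var Vi)
     (decr Vq \<Zsemi> Put Output (Var Vq) (Elem Choice (Var Vbe)) \<Zsemi> Assign Vbe (Elem Parent (Var Vbe)) \<Zsemi> decr Vi)"

definition back_prog :: com where
  "back_prog = Assign Vq (Plus (Var Vm) (Var VN)) \<Zsemi> Assign Vi (Var VN) \<Zsemi> back_loop"

definition print_row :: com where
  "print_row = While (Var Vj)
     (Out (Elem Output (Var Vq)) \<Zsemi> Assign Vq (Plus (Var Vq) (Var Vm)) \<Zsemi> decr Vj)"

definition print_rows :: com where
  "print_rows = While (Var Vi)
     (Assign Vq (Plus (Var Vp) (Var Vm)) \<Zsemi> Assign Vj (Var Vn) \<Zsemi> print_row \<Zsemi> incr Vp \<Zsemi> decr Vi)"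

definition print_prog :: com where
  "print_prog = Assign Vp (Num 0) \<Zsemi> Assign Vi (Var Vm) \<Zsemi> print_rows"

lemma wp_back_prog:
  assumes ent: "entries m a H s" and pre: "vars s Vm = m" "vars s VN = N" "vars s Vbe < length H"
      "H ! vars s Vbe = h" "length h = N"
    and Q: "\<And>s'. frame back_prog s s' \<Longrightarrow>
      \<forall>q\<in>{m..<m + N}. arrs s' Output q = (if h ! (q - m) then 1 else 0) \<Longrightarrow>
      clk s' \<le> clk s + 80 * N + 50 \<Longrightarrow> Q s'"
  shows "wp back_prog Q s"
proof -
  have loop: "wp back_loop Q s" if ent: "entries m a H s" and pre: "vars s Vq = m + N" "vars s Vi = N"
      "vars s Vbe < length H" "H ! vars s Vbe = h"
    and Q: "\<And>s'. frame back_loop s s' \<Longrightarrow>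
      \<forall>q\<in>{m..<m + N}. arrs s' Output q = (if h ! (q - m) then 1 else 0) \<Longrightarrow>
      clk s' \<le> clk s + 80 * N + 10 \<Longrightarrow> Q s'" for s Q
    unfolding back_loop_def
  proof (rule wp_loop_frame[where n = N and I = "\<lambda>t s'. vars s' Vq = m + (N - t) \<and> vars s' Vi = N - t \<and>
      vars s' Vbe < length H \<and> H ! vars s' Vbe = take (N - t) h \<and>
      (\<forall>q\<in>{m + (N - t)..<m + N}. arrs s' Output q = (if h ! (q - m) then 1 else 0)) \<and>
      clk s' \<le> clk s + 80 * t"], goal_cases)
    case 1
    then show ?case using that \<open>length h = N\<close> by simp
  next
    case (2 t s')
    have fr: "arrs s' Parent = arrs s Parent" "arrs s' Choice = arrs s Choice"
      using 2(3) by (simp_all add: frame_def)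
    obtain r where r: "N - t = Suc r" "N - Suc t = r" using 2(1) by (cases "N - t") auto
    have rl: "r < length h" using r \<open>length h = N\<close> by simp
    have tk: "take (Suc r) h = take r h @ [h ! r]" using rl by (simp add: take_Suc_conv_app_nth)
    then have "H ! vars s' Vbe = take r h @ [h ! r]" using 2(2) r by simp
    then have "arrs s Parent (vars s' Vbe) < length H" "H ! arrs s Parent (vars s' Vbe) = take r h"
      "arrs s Choice (vars s' Vbe) = (if h ! r then 1 else 0)"
      using ent 2(2) unfolding entries_def by auto
    then show ?case using 2(2) fr r by (auto simp: le_Suc_eq)
  next
    case (3 s')
    then have "frame back_loop s (tick (cost (Var Vi) + 3) s')" by (simp add: frame_def back_loop_def)
    then show ?case using 3 by (auto intro!: that(6))
  qed
  show ?thesis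
    using ent pre unfolding back_prog_def
    apply simp
    apply (rule loop)
         apply (simp_all add: entries_def)
    apply (rule Q)
      apply (auto simp: frame_def back_prog_def back_loop_def)
    done
qed

lemma wp_print_row:
  assumes pre: "vars s Vm = m" "vars s Vq = m + i" "vars s Vj = n"
      "outp s @ map (\<lambda>j. w (i + 1, j)) [1..<n + 1] @ rest = full"
      "\<And>j. 1 \<le> j \<Longrightarrow> j \<le> n \<Longrightarrow> arrs s Output (j * m + i) = w (i + 1, j)"
    and Q: "\<And>s'. frame print_row s s' \<Longrightarrow> outp s' @ rest = full \<Longrightarrow> clk s' \<le> clk s + 60 * n + 10 \<Longrightarrow> Q s'"
  shows "wp print_row Q s"
  unfolding print_row_def
proof (rule wp_loop_frame[where n = n and I = "\<lambda>t s'. vars s' Vq = m + t * m + i \<and> vars s' Vj = n - t \<and>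
      outp s' @ map (\<lambda>j. w (i + 1, j)) [t + 1..<n + 1] @ rest = full \<and> clk s' \<le> clk s + 60 * t"], goal_cases)
  case 1
  then show ?case using pre by simp
next
  case (2 t s')
  have fr: "vars s' Vm = m" "arrs s' = arrs s" using 2(3) pre by (auto simp: frame_def)
  have up: "[t + 1..<n + 1] = (t + 1) # [Suc t + 1..<n + 1]"
    using 2 by (simp add: upt_conv_Cons del: upt_Suc)
  have "arrs s Output (m + t * m + i) = w (i + 1, t + 1)"
    using pre(5)[of "t + 1"] 2(1) by simp
  then have "(outp s' @ [arrs s' Output (vars s' Vq)]) @ map (\<lambda>j. w (i + 1, j)) [Suc t + 1..<n + 1] @ rest = full"
    using 2(2) fr unfolding up by simp
  then show ?case
    using 2 fr by (simp add: algebra_simps del: upt_Suc)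
next
  case (3 s')
  then have "frame print_row s (tick (cost (Var Vj) + 3) s')" by (simp add: frame_def print_row_def)
  then show ?case using 3 by (auto intro!: Q)
qed

lemma wp_print_prog:
  assumes pre: "vars s Vm = m" "vars s Vn = n" "outp s = []"
      "\<And>i j. i < m \<Longrightarrow> 1 \<le> j \<Longrightarrow> j \<le> n \<Longrightarrow> arrs s Output (j * m + i) = w (i + 1, j)"
    and Q: "\<And>s'. outp s' = map w (grid_nodes m n) \<Longrightarrow> clk s' \<le> clk s + m * (60 * n + 60) + 50 \<Longrightarrow> Q s'"
  shows "wp print_prog Q s"
proof -
  have loop: "wp print_rows Q s" if pre: "vars s Vm = m" "vars s Vn = n" "vars s Vp = 0" "vars s Vi = m" "outp s = []"
      and outs: "\<And>i j. i < m \<Longrightarrow> 1 \<le> j \<Longrightarrow> j \<le> n \<Longrightarrow> arrs s Output (j * m + i) = w (i + 1, j)"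
    and Q: "\<And>s'. outp s' = rows m n w 0 \<Longrightarrow> clk s' \<le> clk s + m * (60 * n + 60) + 10 \<Longrightarrow> Q s'" for s Q
    unfolding print_rows_def
  proof (rule wp_loop_frame[where n = m and I = "\<lambda>i s'. vars s' Vp = i \<and> vars s' Vi = m - i \<and>
      outp s' @ rows m n w i = rows m n w 0 \<and> clk s' \<le> clk s + i * (60 * n + 60)"], goal_cases)
    case 1
    then show ?case using that by simp
  next
    case (2 i s')
    have fr: "vars s' Vm = m" "vars s' Vn = n" "arrs s' = arrs s"
      using 2(3) pre by (auto simp: frame_def print_row_def)
    have out: "arrs s' Output (j * m + i) = w (i + 1, j)" if "1 \<le> j" "j \<le> n" for j
      using outs[OF 2(1) that] fr by simp
    show ?case
    proof (rule conjI, goal_cases)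
      case 1
      show ?case using 2 by simp
    next
      case 2
      show ?case
        unfolding wp_simps
      proof (rule wp_print_row[where i = i and m = m and n = n and w = w and rest = "rows m n w (Suc i)"
          and full = "rows m n w 0"], goal_cases)
        case 4
        show ?case using \<open>vars s' Vp = i \<and> _\<close> rows_step[OF \<open>i < m\<close>, of n w] by (simp del: upt_Suc)
      next
        case (6 s2)
        then show ?case using \<open>vars s' Vp = i \<and> _\<close> \<open>i < m\<close> by (auto simp: frame_def print_row_def)
      qed (use fr out \<open>vars s' Vp = i \<and> _\<close> in \<open>simp_all add: add.commute[of i m]\<close>)
    qed
  next
    case (3 s')
    then show ?case by (auto intro!: that(7) simp: rows_def)
  qed
  show ?thesis
    using pre unfolding print_prog_def
    apply simp
    apply (rule loop)
          apply simp_all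
    apply (rule Q)
     apply (simp_all add: map_grid_nodes)
    done
qed

subsection \<open>The whole program\<close>

definition main_prog :: com where
  "main_prog = read_prog \<Zsemi> table_prog \<Zsemi> init_prog \<Zsemi> Assign Vcnt (Var VN) \<Zsemi> layers \<Zsemi>
     select_loop \<Zsemi> back_prog \<Zsemi> print_prog"

text \<open>In order: reading and printing, table, initial state, tracing back, all layers,
  selection in the last layer, constant overhead. \<open>L\<close> bounds the length of a
  layer.\<close>

definition run_time :: "nat \<Rightarrow> nat \<Rightarrow> nat \<Rightarrow> nat" where
  "run_time m n W = (let L = 9 * 8 ^ m * (W + 1) in
     2 * (m * (60 * n + 60)) + (m + 2) * (120 * m + 60) + 60 * m + 80 * (m * n) +
     m * n * (L * (440 * m + 2100) + 200) + L * (150 * m + 400) + 500)"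

lemma sum_list_grid_nodes:
  assumes "1 \<le> n"
  shows "sum_list (map w (grid_nodes m n)) = weight w (verts (grid_graph m n))"
proof -
  have "distinct (grid_nodes m n)"
    unfolding grid_nodes_def using assms
    by (auto simp: distinct_map inj_on_def intro!: distinct_concat)
  moreover have "set (grid_nodes m n) = verts (grid_graph m n)"
    by (auto simp: grid_nodes_def image_iff simp del: upt_Suc)
  ultimately show ?thesis
    by (simp add: sum_list_distinct_conv_sum_set weight_def del: verts_grid)
qed

lemma read_prog_frame:
  "mod_vars read_prog = {Vm, Vn, Vi, Vq, Vj, Vx, VW, VN, Vp}" "mod_arrs read_prog = {Weights}" "no_out read_prog"
  "mod_vars table_prog = {Vmm, Vs, Vi, Vq, Vj}" "mod_arrs table_prog = {Table}" "no_out table_prog"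
  "mod_vars init_prog = {Vp, Vi, Vnx, Vnb}" "mod_arrs init_prog = {States}" "no_out init_prog"
  "no_out layers" "no_out select_loop" "no_out back_prog" "mod_vars layers \<inter> {Vbv} = {}"
  "mod_vars back_prog \<inter> {Vm, Vn} = {}"
  by (auto simp: read_prog_def read_rows_def read_row_def table_prog_def table_blocks_def table_block_def
      init_prog_def init_loop_def layers_def layer_loop_def layer_end_def mod_vars_expand select_loop_def
      select_head_def select_tail_def count_loop_def back_prog_def back_loop_def)

text \<open>\<open>balance\<close> and \<open>splits\<close> depend only on the key, so every full
  colouring has a representative of equal value in the layer, and an optimum of the layer is an
  optimum of all.\<close>

lemma optimal_of_layer:
  assumes m: "2 \<le> m" and n: "1 \<le> n" and W: "\<And>h. length h = m * n \<Longrightarrow> hsum m a h \<le> W"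
    and C: "layer m a W (m * n) C" and b: "best m a W l C (length C) bv be"
  obtains j where "j < length C" "be = l + j" "length (C ! j) = m * n" "splits m (C ! j)"
    "\<And>g. length g = m * n \<Longrightarrow> splits m g \<Longrightarrow> balance m a W g \<le> balance m a W (C ! j)"
proof -
  have rep: "\<exists>i<length C. splits m (C ! i) = splits m g \<and> balance m a W (C ! i) = balance m a W g"
    if g: "length g = m * n" for g
  proof -
    have "key m a W g \<in> key m a W ` set C" using C g by (auto simp: layer_def)
    then obtain i where i: "i < length C" "key m a W (C ! i) = key m a W g"
      by (auto simp: in_set_conv_nth)
    then have "length (C ! i) = m * n" using C nth_mem[OF i(1)] unfolding layer_def by blast
    note k = key_inj[OF m W[OF this] W[OF g] i(2)]
    have f: "hfront m (C ! i) p = hfront m g p" if "p < m + 2" for p using k(2) that by blast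
    have "{p. p < m \<and> hfront m (C ! i) p = p + x} = {p. p < m \<and> hfront m g p = p + x}" for x
      using f by auto
    then have "splits m (C ! i) = splits m g"
      using f[of m] f[of "m + 1"] by (simp add: splits_def frontier_tops_def)
    then show ?thesis using i(1) k(1) by (auto simp: balance_def)
  qed
  \<comment> \<open>Some representative splits, which excludes the default disjunct of
    \<open>best\<close>.\<close>
  obtain h where h: "length h = m * n" "splits m h" using splits_exists[OF m n] .
  from rep[OF h(1)] h(2) have "\<exists>i<length C. splits m (C ! i)" by auto
  with b obtain j where j: "j < length C" "be = l + j" "splits m (C ! j)" "bv = balance m a W (C ! j)"
    unfolding best_def by blast
  show ?thesis
  proof (rule that[OF j(1,2) _ j(3)])
    show "length (C ! j) = m * n" using C nth_mem[OF j(1)] unfolding layer_def by blast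
    show "balance m a W g \<le> balance m a W (C ! j)" if g: "length g = m * n" "splits m g" for g
      using rep[OF g(1)] g(2) b j(4) unfolding best_def by metis
  qed
qed

lemma wp_main:
  fixes w :: "nat \<times> nat \<Rightarrow> nat"
  assumes m: "3 \<le> m" and n: "1 \<le> n"
  defines "W \<equiv> weight w (verts (grid_graph m n))" and "a \<equiv> \<lambda>q. w (cell m q)"
  shows "wp main_prog (\<lambda>s. \<exists>h. length h = m * n \<and> splits m h \<and>
      (\<forall>g. length g = m * n \<longrightarrow> splits m g \<longrightarrow> balance m a W g \<le> balance m a W h) \<and>
      outp s = encode_node_set m n (hset m h) \<and> clk s \<le> run_time m n W)
    (start (encode_instance m n w))"
proof -
  let ?s = "start (encode_instance m n w)" and ?N = "m * n"
  define L where "L = 9 * 8 ^ m * (W + 1)"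
  have m2: "2 \<le> m" "0 < m" using m by simp_all
  have Wa: "W = (\<Sum>q\<in>{m..<m + ?N}. a q)"
    unfolding W_def a_def by (rule weight_verts[OF m2(2)])
  have W: "hsum m a h \<le> W" if "length h \<le> ?N" for h
    unfolding Wa using hsum_le[OF that] .
  show ?thesis
    unfolding main_prog_def wp_simps(4)
  proof (rule wp_read_prog[where m = m and n = n and w = w], goal_cases)
    case (5 s1)
    have v1: "vars s1 x = 0" if "x \<notin> {Vm, Vn, Vi, Vq, Vj, Vx, VW, VN, Vp}" for x
      using 5(1) that by (simp add: frame_def read_prog_frame)
    have a1: "arrs s1 x = (\<lambda>_. 0)" if "x \<noteq> Weights" for x
      using 5(1) that by (simp add: frame_def read_prog_frame start_def)
    have o1: "outp s1 = []" using 5(1) by (simp add: frame_def read_prog_frame)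
    show ?case
    proof (rule wp_table_prog[where m = m and W = W], goal_cases)
      case (3 s2)
      have v2: "vars s2 x = vars s1 x" if "x \<notin> {Vmm, Vs, Vi, Vq, Vj}" for x
        using 3(1) that by (simp add: frame_def read_prog_frame)
      have a2: "arrs s2 x = arrs s1 x" if "x \<noteq> Table" for x
        using 3(1) that by (simp add: frame_def read_prog_frame)
      have o2: "outp s2 = []" using 3(1) o1 by (simp add: frame_def read_prog_frame)
      show ?case
      proof (rule wp_init_prog[where m = m], goal_cases)
        case (4 s3)
        have v3: "vars s3 x = vars s2 x" if "x \<notin> {Vp, Vi, Vnx, Vnb}" for x
          using 4(1) that by (simp add: frame_def read_prog_frame)
        have a3: "arrs s3 x = arrs s2 x" if "x \<noteq> States" for x
          using 4(1) that by (simp add: frame_def read_prog_frame)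
        have o3: "outp s3 = []" using 4(1) o2 by (simp add: frame_def read_prog_frame)
        define s4 where "s4 = tick 4 (s3\<lparr>vars := (vars s3)(Vcnt := vars s3 VN)\<rparr>)"
        have st: "static m n a W s4"
          using 5(2-6) 3(2-4) by (simp add: static_def s4_def v3 v2 a3 a2 a_def W_def sum_list_grid_nodes[OF n] del: verts_grid)
        have ent: "entries m a [[]] s4"
          using 4(4) by (simp add: entries_def s4_def a3 a2 a1 hfront_Nil[OF m2(2)])
        have q: "queue m n a W 0 [[]] 0 s4"
          using st ent 4(2,3) by (simp add: queue_def s4_def v3 v2 v1 a3 a2 a1)
        have cnt: "vars s4 Vcnt = ?N" using 5(6) by (simp add: s4_def v3 v2)
        have bv4: "vars s4 Vbv = 0" by (simp add: s4_def v3 v2 v1)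
        have layers: "wp layers (wp select_loop (wp back_prog (wp print_prog (\<lambda>s. \<exists>h. length h = m * n \<and> splits m h \<and>
            (\<forall>g. length g = m * n \<longrightarrow> splits m g \<longrightarrow> balance m a W g \<le> balance m a W h) \<and>
            outp s = encode_node_set m n (hset m h) \<and> clk s \<le> run_time m n W)))) s4"
        proof (rule wp_layers[OF m W q cnt], goal_cases)
          case (2 s5 P C)
          have bv5: "vars s5 Vbv = 0"
            using 2(1) bv4 read_prog_frame(13) by (auto simp: frame_def)
          have o5: "outp s5 = []" using 2(1) o3 by (simp add: frame_def read_prog_frame s4_def)
          have LC: "length C \<le> L"
            unfolding L_def using length_layer[OF m2(1) W 2(3)] by simp
          show ?case
          proof (rule wp_select_loop[OF 2(2) bv5], goal_cases)
            case (1 s6)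
            obtain j where j: "j < length C" "vars s6 Vbe = length P + j" "length (C ! j) = ?N" "splits m (C ! j)"
              "\<And>g. length g = ?N \<Longrightarrow> splits m g \<Longrightarrow> balance m a W g \<le> balance m a W (C ! j)"
              using optimal_of_layer[OF m2(1) n W 2(3) 1(3)] by (metis order_refl)
            let ?h = "C ! j"
            have v6: "vars s6 Vm = m" "vars s6 Vn = n" "vars s6 VN = ?N" "entries m a (P @ C) s6"
              using 1(2) by (auto simp: queue_def static_def)
            have o6: "outp s6 = []" using 1(1) o5 by (simp add: frame_def read_prog_frame)
            show ?case
            proof (rule wp_back_prog[OF v6(4) v6(1) v6(3), where h = ?h], goal_cases)
              case (4 s7)
              have v7: "vars s7 Vm = m" "vars s7 Vn = n" "outp s7 = []"
                using 4(1) v6 o6 read_prog_frame(12,14) by (auto simp: frame_def)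
              show ?case
              proof (rule wp_print_prog[OF v7, where w = "\<lambda>v. if v \<in> hset m ?h then 1 else 0"], goal_cases)
                case (1 i j')
                have q: "j' * m + i \<in> {m..<m + ?N}"
                proof -
                  have "1 * m \<le> j' * m" "j' * m \<le> n * m" using 1 by (intro mult_le_mono1; simp)+
                  moreover have "n * m = ?N" by simp
                  ultimately show ?thesis using 1 unfolding atLeastLessThan_iff by linarith
                qed
                have "cell m (j' * m + i) = (i + 1, j')" using 1 by (simp add: cell_def)
                then have "(i + 1, j') \<in> hset m ?h \<longleftrightarrow> colouring m ?h (j' * m + i)"
                  unfolding hset_def using inj_image_mem_iff[OF inj_cell[OF m2(2)]] by (metis mem_Collect_eq)
                also have "\<dots> \<longleftrightarrow> ?h ! (j' * m + i - m)" using q j(3) by (simp add: colouring_def)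
                finally show ?case using 4(2) q by auto
              next
                case (2 s8)
                have "clk s8 \<le> run_time m n W"
                proof -
                  have "clk s4 \<le> m * (60 * n + 60) + 20 + ((m + 2) * (120 * m + 60) + 100) + (60 * m + 60) + 4"
                    using 5(7) 3(5) 4 \<open>clk s3 \<le> _\<close> by (simp add: s4_def)
                  moreover have "clk s5 \<le> clk s4 + ?N * (L * (440 * m + 2100) + 200) + 10"
                    using \<open>clk s5 \<le> _\<close> by (simp add: L_def)
                  moreover have "length C * (150 * m + 400) \<le> L * (150 * m + 400)"
                    using LC by (rule mult_le_mono1)
                  ultimately show ?thesis
                    using \<open>clk s6 \<le> _\<close> 4(3) 2(2) unfolding run_time_def Let_def L_def[symmetric] by linarith
                qed
                then show ?case
                  using 2(1) j(3,4,5) by (auto intro!: exI[of _ ?h] simp: encode_node_set_def)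
              qed
            qed (use j in \<open>simp_all add: nth_append\<close>)
          qed
        qed
        show ?case using layers by (simp add: s4_def)
      qed (use 5(2) 3(3) in \<open>simp_all add: v2 a2 a1\<close>)
    qed (use 5 in \<open>simp_all add: W_def sum_list_grid_nodes[OF n] del: verts_grid\<close>)
  qed (simp_all add: encode_instance_def)
qed

text \<open>\<open>W + 1 \<le> 2 * W\<close> and \<open>3 \<le> m\<close> absorb the additive
  constants, e.g. \<open>440 * m + 2100 \<le> 1140 * m\<close>. The layers then contribute
  \<open>18 * 1140 = 20520\<close>, the quadratic cost of the table is covered by
  \<open>m * m \<le> m * N\<close>, and 100000 leaves a wide margin for the rest.\<close>

lemma run_time_le:
  assumes "3 \<le> m" "1 \<le> n" "1 \<le> W"
  shows "run_time m n W \<le> 100000 * (m * (m * n) * W * 8 ^ m)"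
proof -
  define Y where "Y = W * 8 ^ m"
  define N where "N = m * n"
  have Y1: "1 \<le> Y" using assms by (simp add: Y_def)
  have Nm: "m \<le> N" using assms by (simp add: N_def)
  have XN: "m * N \<le> m * N * Y" using Y1 by simp
  have NX: "1 * N \<le> m * N" using assms by (intro mult_le_mono1) simp
  have mm: "m * m \<le> m * N" using Nm by simp
  have "(W + 1) * 8 ^ m \<le> (2 * W) * 8 ^ m" using assms by (intro mult_le_mono1) simp
  then have L: "9 * 8 ^ m * (W + 1) \<le> 18 * Y" by (simp add: Y_def algebra_simps)
  have "9 * 8 ^ m * (W + 1) * (440 * m + 2100) \<le> 18 * Y * (1140 * m)"
    using assms by (intro mult_le_mono L) simp
  then have 1: "N * (9 * 8 ^ m * (W + 1) * (440 * m + 2100)) \<le> N * (18 * Y * (1140 * m))"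
    by (rule mult_le_mono2)
  have "9 * 8 ^ m * (W + 1) * (150 * m + 400) \<le> 18 * Y * (300 * m)"
    using assms by (intro mult_le_mono L) simp
  also have "\<dots> = 5400 * (m * 1 * Y)" by simp
  also have "\<dots> \<le> 5400 * (m * N * Y)"
    using Nm assms by (intro mult_le_mono) simp_all
  finally have 2: "9 * 8 ^ m * (W + 1) * (150 * m + 400) \<le> 5400 * (m * N * Y)" .
  have "(m + 2) * (120 * m + 60) \<le> (2 * m) * (140 * m)"
    using assms by (intro mult_le_mono) simp_all
  also have "\<dots> = 280 * (m * m)" by simp
  also have "\<dots> \<le> 280 * (m * N * Y)" using mm XN by linarith
  finally have 3: "(m + 2) * (120 * m + 60) \<le> 280 * (m * N * Y)" .
  have 4: "m * (60 * n + 60) \<le> 120 * (m * N * Y)"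
  proof -
    have "m * (60 * n + 60) = 60 * N + 60 * m" by (simp add: N_def algebra_simps)
    then show ?thesis using NX XN Nm by linarith
  qed
  have "N * (18 * Y * (1140 * m)) = 20520 * (m * N * Y)" by simp
  moreover have "run_time m n W = 2 * (m * (60 * n + 60)) + (m + 2) * (120 * m + 60) + 60 * m + 80 * N +
      (N * (9 * 8 ^ m * (W + 1) * (440 * m + 2100)) + 200 * N) + 9 * 8 ^ m * (W + 1) * (150 * m + 400) + 500"
    by (simp add: run_time_def Let_def N_def algebra_simps)
  moreover have "1 \<le> m * N * Y" using NX XN Nm assms by linarith
  ultimately have "run_time m n W \<le> 100000 * (m * N * Y)"
    using 1 2 3 4 NX XN Nm by linarith
  then show ?thesis by (simp add: N_def Y_def ac_simps)
qed

theorem theorem5: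
  shows "\<exists>(P :: program) (C :: nat). \<forall>(m :: nat) (n :: nat) (w :: nat \<times> nat \<Rightarrow> nat).
    m \<ge> 3 \<longrightarrow> n \<ge> 1 \<longrightarrow> (\<forall>v \<in> verts (grid_graph m n). w v > 0) \<longrightarrow>
    (let N = m * n; W = weight w (verts (grid_graph m n)) in
      \<exists>U. optimal_connected_bipartition (grid_graph m n) w U \<and>
          computes_within P (encode_instance m n w) (encode_node_set m n U)
            (C * (m * N * W * 8 ^ m)))"
proof (rule exI[of _ "comp main_prog 0"], rule exI[of _ 100000], intro allI impI)
  fix m n :: nat and w :: "nat \<times> nat \<Rightarrow> nat"
  assume m: "m \<ge> 3" and n: "n \<ge> 1" and pos: "\<forall>v \<in> verts (grid_graph m n). w v > 0"
  let ?G = "grid_graph m n"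
  let ?W = "weight w (verts ?G)" and ?a = "\<lambda>q. w (cell m q)"
  have m0: "0 < m" using m by simp
  from wp_main[OF m n, of w] obtain s h where s: "big_step main_prog (start (encode_instance m n w)) s"
    and h: "length h = m * n" "splits m h"
      "\<And>g. length g = m * n \<Longrightarrow> splits m g \<Longrightarrow> balance m ?a ?W g \<le> balance m ?a ?W h"
    and out: "outp s = encode_node_set m n (hset m h)" and clk: "clk s \<le> run_time m n ?W"
    unfolding wp_def by blast
  have val: "min (weight w (hset m g)) (weight w (verts ?G - hset m g)) = balance m ?a ?W g"
    if "length g = m * n" for g
    unfolding balance_def weight_compl_hset[OF m0 that] weight_hset[OF m0] ..
  have "optimal_connected_bipartition ?G w (hset m h)"
    unfolding optimal_connected_bipartition_def is_arg_max_def
  proof (intro conjI notI)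
    show "connected_bipartition ?G (hset m h)"
      using connected_bipartition_hset[OF m0 n h(1)] h(2) by simp
    assume "\<exists>U. connected_bipartition ?G U \<and> min (weight w (hset m h)) (weight w (verts ?G - hset m h))
      < min (weight w U) (weight w (verts ?G - U))"
    then obtain U where U: "connected_bipartition ?G U"
      "min (weight w (hset m h)) (weight w (verts ?G - hset m h)) < min (weight w U) (weight w (verts ?G - U))"
      by blast
    then have "U \<subseteq> verts ?G" by (simp add: connected_bipartition_def)
    \<comment> \<open>Every competitor is the class of some colouring, so optimality among
      colourings covers it.\<close>
    then obtain g where g: "length g = m * n" "hset m g = U" by (rule hset_surj[OF m0])
    then have "splits m g" using U(1) connected_bipartition_hset[OF m0 n g(1)] by simp
    moreover have "balance m ?a ?W h < balance m ?a ?W g"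
      using U(2) unfolding g(2)[symmetric] val[OF g(1)] val[OF h(1)] .
    ultimately show False using h(3)[OF g(1)] by simp
  qed
  moreover have "computes_within (comp main_prog 0) (encode_instance m n w) (encode_node_set m n (hset m h))
      (100000 * (m * (m * n) * ?W * 8 ^ m))"
  proof -
    \<comment> \<open>A nonempty grid with positive weights has \<open>1 \<le> W\<close>, which the
      bound of \<open>W + 1\<close> by \<open>2 * W\<close> requires.\<close>
    have "(1, 1) \<in> verts ?G" using m n by simp
    then have "0 < ?W"
      unfolding weight_def using pos by (intro sum_pos) (auto simp del: verts_grid, simp)
    then have "run_time m n ?W \<le> 100000 * (m * (m * n) * ?W * 8 ^ m)"
      using m n by (intro run_time_le) simp_all
    with clk show ?thesis
      unfolding out[symmetric] by (intro computes_within_comp[OF s]) simp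
  qed
  ultimately show "let N = m * n; W = weight w (verts ?G) in
      \<exists>U. optimal_connected_bipartition ?G w U \<and>
          computes_within (comp main_prog 0) (encode_instance m n w) (encode_node_set m n U)
            (100000 * (m * N * W * 8 ^ m))"
    unfolding Let_def by blast
qed

end
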